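(* Consider the problem $\min\{f(x): x\in\Omega\}$ and the stochastic interior-point method with Polyak momentum (SIPM-PM) described in the context, with input $s_\eta\in(0,1)$. Assume: (a) $\Omega^\circ\neq\emptyset$, and there is a finite $\phi_{\mathrm{low}}$ with $\inf_{x\in\Omega^\circ,\,\mu\in(0,1]}\{f(x)+\mu B(x)\}\ge\phi_{\mathrm{low}}$; (b) for every $s\in(0,1)$ there is a constant $L_1(s)>0$ such that $\|\nabla f(y)-\nabla f(x)\|_x^*\le L_1(s)\|y-x\|_x$ for all $x,y\in\Omega^\circ$ with $\|y-x\|_x\le s$; write $L_1=L_1(s_\eta)$; (c) the estimator $G:\Omega^\circ\times\Xi\to\mathbb{R}^n$ satisfies, for some $\sigma>0$, $\mathbb{E}_\xi[G(x;\xi)]=\nabla f(x)$ and $\mathbb{E}_\xi[(\|G(x;\xi)-\nabla f(x)\|_x^* )^2]\le\sigma^2$ for all $x\in\Omega^\circ$. Let $\epsilon\in(0,1)$ and let the input parameters be, for all $k\ge0$, $$\eta_k=\frac{s_\eta}{(k+1)^{3/4}},\qquad \gamma_k=\frac{1}{(k+1)^{1/2}},\qquad \mu_k=\max\Big\{\frac{1}{(k+1)^{1/4}},\frac{\epsilon}{1+\sqrt{\vartheta}}\Big\}.$$ Let $\kappa(K)$ be uniformly drawn from $\{\lfloor K/2\rfloor,\ldots,K-1\}$, and define $$M_{\mathrm{pm}}=2\Big(\frac{\Delta(x^0)+\sigma^2/L_1}{s_\eta}+\frac{3s_\eta L_\phi}{2}+2\Big(\frac{5s_\eta L_1}{1-s_\eta}+\frac{\sigma^2}{s_\eta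 L_1}\Big)\Big).$$ Then $$\mathbb{E}\big[\|\nabla\phi_{\mu_{\kappa(K)}}(x^{\kappa(K)})+A^T\lambda^{\kappa(K)}\|^*_{x^{\kappa(K)}}\big]\le\mu_{\kappa(K)}\quad\text{with}\quad \mu_{\kappa(K)}\le\frac{\epsilon}{1+\sqrt{\vartheta}}$$ for all integers $$K\ge\max\Big\{2\Big(\frac{1+\sqrt{\vartheta}}{\epsilon}\Big)^4,\ \Big(\frac{8M_{\mathrm{pm}}(1+\sqrt{\vartheta})}{\epsilon}\ln\Big(\frac{8M_{\mathrm{pm}}(1+\sqrt{\vartheta})}{\epsilon}\Big)\Big)^4,\ 3\Big\}.$$
   Context: Setting. $\mathcal{K}\subseteq\mathbb{R}^n$ is a closed pointed convex cone with nonempty interior, $A\in\mathbb{R}^{m\times n}$ has full row rank, $b\in\mathbb{R}^m$, $\Omega=\{x: Ax=b,\ x\in\mathcal{K}\}$, $\Omega^\circ=\{x\in\mathrm{int}\,\mathcal{K}: Ax=b\}$; $f$ is continuously differentiable (possibly nonconvex) on $\Omega$, and $\min_{x\in\Omega}f(x)$ has at least one optimal solution. Barrier. $\mathcal{K}$ is equipped with a $\vartheta$-logarithmically homogeneous self-concordant barrier $B:\mathrm{int}\,\mathcal{K}\to\mathbb{R}$, $\vartheta\ge1$: $B$ is convex and three times continuously differentiable; for $\varphi(t)=B(x+tu)$ one has $|\varphi'''(0)|\le2(\varphi''(0))^{3/2}$ for all $x\in\mathrm{int}\,\mathcal{K}$, $u\in\mathbb{R}^n$; $B(x)\to\infty$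 as $x$ approaches the boundary of $\mathcal{K}$; and $B(tx)=B(x)-\vartheta\ln t$ for all $x\in\mathrm{int}\,\mathcal{K}$, $t>0$. For $x\in\mathrm{int}\,\mathcal{K}$ and $v\in\mathbb{R}^n$: $\|v\|_x=(v^T\nabla^2B(x)v)^{1/2}$ and $\|v\|_x^*=(v^T\nabla^2B(x)^{-1}v)^{1/2}$. Notation. $\phi_\mu(x)=f(x)+\mu(f(x)+B(x))$ for $x\in\Omega^\circ$, $\mu\in(0,1]$. With $[t]_+=\max\{t,0\}$ and $[t]_-=\min\{t,0\}$, $\Delta(x)=f(x)+[f(x)+B(x)]_+-2[\phi_{\mathrm{low}}]_-$, and $L_\phi=2L_1+1/(1-s_\eta)$. Algorithm (SIPM framework). Input: $s_\eta\in(0,1)$, $x^0\in\Omega^\circ$ (deterministic), nonincreasing step sizes $\{\eta_k\}_{k\ge0}\subset(0,s_\eta]$, nonincreasing barrier parameters $\{\mu_k\}_{k\ge0}\subset(0,1]$. For $k=0,1,2,\ldots$: construct an estimator $\overline m^k$ of $\nabla f(x^k)$, set $m^k=\overline m^k+\mu_k(\overline m^k+\nabla B(x^k))$, $H_k=\nabla^2B(x^k)^{-1}$, $$\lambda^k=-(AH_kA^T)^{-1}AH_km^k,\qquad x^{k+1}=x^k-\eta_k\frac{H_k(m^k+A^T\lambda^k)}{\|m^k+A^T\lambda^k\|^*_{x^k}}.$$ The update is understood to be well defined, i.e. $m^k+A^T\lambda^k\ne0$ for all $k$. SIPM-PM is this framework with momentum parameters $\{\gamma_k\}_{k\ge0}\subset(0,1]$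 and $\gamma_{-1}=1$, $\overline m^{-1}=0$, $\overline m^k=(1-\gamma_{k-1})\overline m^{k-1}+\gamma_{k-1}G(x^k;\xi^k)$ for $k\ge0$, where $\xi^0,\xi^1,\ldots$ are independent copies of the random variable $\xi$ (with sample space $\Xi$). The draw of $\kappa(K)$ is independent of the samples; $\mathbb{E}$ is expectation over all randomness. *)

theory Defs
  imports "HOL-Probability.Probability"
begin

section \<open>Gradients and smoothness\<close>

definition grad :: "(real^'n \<Rightarrow> real) \<Rightarrow> real^'n \<Rightarrow> real^'n" where
  "grad f x = (\<chi> i. frechet_derivative f (at x) (axis i 1))"

definition hess :: "(real^'n \<Rightarrow> real) \<Rightarrow> real^'n \<Rightarrow> real^'n^'n" where
  "hess f x = jacobian (grad f) (at x)"

text \<open>Derivatives are always those in the ambient space \<open>\<real>\<^sup>n\<close> (filter \<open>at x\<close>, not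
  \<open>at x within S\<close>), also when \<open>S\<close> is not open; only the continuity of the highest partial
  derivatives is relative to \<open>S\<close>.\<close>

primrec cont_diff_on :: "nat \<Rightarrow> (real^'n) set \<Rightarrow> (real^'n \<Rightarrow> real) \<Rightarrow> bool" where
  "cont_diff_on 0 S f \<longleftrightarrow> continuous_on S f"
| "cont_diff_on (Suc k) S f \<longleftrightarrow>
     (\<forall>x\<in>S. f differentiable (at x)) \<and> (\<forall>i. cont_diff_on k S (\<lambda>x. grad f x $ i))"


section \<open>The feasible region and the barrier\<close>

definition proper_cone :: "(real^'n) set \<Rightarrow> bool" where
  "proper_cone \<K> \<longleftrightarrow> cone \<K> \<and> convex \<K> \<and> closed \<K> \<and> interior \<K> \<noteq> {} \<and>
     (\<forall>x. x \<in> \<K> \<and> - x \<in> \<K> \<longrightarrow> x = 0)"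

definition feasible :: "real^'n^'m \<Rightarrow> real^'m \<Rightarrow> (real^'n) set \<Rightarrow> (real^'n) set" where
  "feasible A b \<K> = {x. A *v x = b \<and> x \<in> \<K>}"

definition strictly_feasible :: "real^'n^'m \<Rightarrow> real^'m \<Rightarrow> (real^'n) set \<Rightarrow> (real^'n) set" where
  "strictly_feasible A b \<K> = {x \<in> interior \<K>. A *v x = b}"

text \<open>A \<open>\<theta>\<close>-logarithmically homogeneous self-concordant barrier. Values of \<open>B\<close> outside
  the interior of \<open>\<K>\<close> are irrelevant.\<close>

definition lhsc_barrier :: "(real^'n) set \<Rightarrow> real \<Rightarrow> (real^'n \<Rightarrow> real) \<Rightarrow> bool" where
  "lhsc_barrier \<K> \<theta> B \<longleftrightarrow>
     1 \<le> \<theta> \<and>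
     convex_on (interior \<K>) B \<and>
     cont_diff_on 3 (interior \<K>) B \<and>
     (\<forall>x\<in>interior \<K>. \<forall>u.
        \<bar>(deriv ^^ 3) (\<lambda>t. B (x + t *\<^sub>R u)) 0\<bar>
          \<le> 2 * ((deriv ^^ 2) (\<lambda>t. B (x + t *\<^sub>R u)) 0) powr (3/2)) \<and>
     (\<forall>z\<in>frontier \<K>. filterlim B at_top (at z within interior \<K>)) \<and>
     (\<forall>x\<in>interior \<K>. \<forall>t>0. B (t *\<^sub>R x) = B x - \<theta> * ln t)"

definition local_norm :: "(real^'n \<Rightarrow> real) \<Rightarrow> real^'n \<Rightarrow> real^'n \<Rightarrow> real" where
  "local_norm B x v = sqrt (v \<bullet> (hess B x *v v))"

definition dual_norm :: "(real^'n \<Rightarrow> real) \<Rightarrow> real^'n \<Rightarrow> real^'n \<Rightarrow> real" where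
  "dual_norm B x v = sqrt (v \<bullet> (matrix_inv (hess B x) *v v))"

definition phi :: "(real^'n \<Rightarrow> real) \<Rightarrow> (real^'n \<Rightarrow> real) \<Rightarrow> real \<Rightarrow> real^'n \<Rightarrow> real" where
  "phi f B \<mu> x = f x + \<mu> * (f x + B x)"


section \<open>The stochastic interior-point method with Polyak momentum\<close>

text \<open>The following predicate describes the run of the method along one fixed sequence of
  samples \<open>\<xi>\<close>; \<open>mbar\<close> is the momentum estimator of the gradient of \<open>f\<close>. With the
  conventions \<open>\<gamma>\<^sub>-\<^sub>1 = 1\<close> and \<open>mbar\<^sub>-\<^sub>1 = 0\<close> the momentum recursion at index \<open>0\<close> reads
  \<open>mbar\<^sub>0 = G x\<^sub>0 \<xi>\<^sub>0\<close>. That the step is well defined, i.e. that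
  \<open>m k + transpose A *v lam k \<noteq> 0\<close>, is not part of the predicate.\<close>

definition sipm_pm_run ::
  "real^'n^'m \<Rightarrow> (real^'n \<Rightarrow> real) \<Rightarrow> (real^'n \<Rightarrow> 'b \<Rightarrow> real^'n) \<Rightarrow> real^'n \<Rightarrow>
   (nat \<Rightarrow> real) \<Rightarrow> (nat \<Rightarrow> real) \<Rightarrow> (nat \<Rightarrow> real) \<Rightarrow> (nat \<Rightarrow> 'b) \<Rightarrow>
   (nat \<Rightarrow> real^'n) \<Rightarrow> (nat \<Rightarrow> real^'n) \<Rightarrow> (nat \<Rightarrow> real^'n) \<Rightarrow> (nat \<Rightarrow> real^'m) \<Rightarrow> bool" where
  "sipm_pm_run A B G x0 \<eta> \<gamma> \<mu> \<xi> x mbar m lam \<longleftrightarrow>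
     x 0 = x0 \<and>
     mbar 0 = G (x 0) (\<xi> 0) \<and>
     (\<forall>k. mbar (Suc k) = (1 - \<gamma> k) *\<^sub>R mbar k + \<gamma> k *\<^sub>R G (x (Suc k)) (\<xi> (Suc k))) \<and>
     (\<forall>k. m k = mbar k + \<mu> k *\<^sub>R (mbar k + grad B (x k))) \<and>
     (\<forall>k. let H = matrix_inv (hess B (x k)) in
        lam k = - (matrix_inv (A ** H ** transpose A) *v (A *v (H *v m k))) \<and>
        x (Suc k) = x k - (\<eta> k / dual_norm B (x k) (m k + transpose A *v lam k)) *\<^sub>R
                            (H *v (m k + transpose A *v lam k)))"


section \<open>Constants in the complexity bound\<close>

definition Delta :: "(real^'n \<Rightarrow> real) \<Rightarrow> (real^'n \<Rightarrow> real) \<Rightarrow> real \<Rightarrow> real^'n \<Rightarrow> real" where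
  "Delta f B \<phi>low x = f x + max (f x + B x) 0 - 2 * min \<phi>low 0"

definition L_phi :: "real \<Rightarrow> real \<Rightarrow> real" where
  "L_phi L s = 2 * L + 1 / (1 - s)"

text \<open>The arguments are \<open>\<Delta>(x\<^sup>0)\<close>, \<open>\<sigma>\<close>, \<open>L\<^sub>1(s)\<close> and \<open>s = s\<^sub>\<eta>\<close>.\<close>

definition M_pm :: "real \<Rightarrow> real \<Rightarrow> real \<Rightarrow> real \<Rightarrow> real" where
  "M_pm \<Delta>0 \<sigma> L s =
     2 * ((\<Delta>0 + \<sigma>\<^sup>2 / L) / s + 3 * s * L_phi L s / 2
          + 2 * (5 * s * L / (1 - s) + \<sigma>\<^sup>2 / (s * L)))"

end

theory Submission
  imports Defs
begin

text \<open>Self-concordance and the equality of a symmetric trilinear form's norm with its norm on the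
  diagonal show that the local norm at \<open>x\<close> is at most \<open>1 / (1 - \<parallel>d\<parallel>\<^sub>x)\<close> times the one at \<open>x + d\<close>,
  and dually for the dual norms, and that \<open>B\<close> lies below a quadratic near \<open>x\<close>. Hence one step
  decreases \<open>\<phi>\<^sub>\<mu>\<close> by \<open>\<eta>\<close> times the residual up to \<open>4 \<eta> e\<close>, with \<open>e\<close> the dual norm of the momentum error, and up to \<open>L\<^sub>\<phi> \<eta>\<^sup>2 / 2\<close>. Since the new
  sample is independent of the past, \<open>E\<close>, the expectation of \<open>e\<^sup>2\<close>, contracts:
  \<open>E' \<le> (1 - \<alpha>) E + L\<^sub>1\<^sup>2 \<eta>\<^sup>2 / \<alpha> + \<gamma>\<^sup>2 \<sigma>\<^sup>2\<close> with \<open>\<alpha> = (\<gamma> - \<eta>) / (1 - \<eta>)\<close>. By AM-GM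
  \<open>4 \<eta> e \<le> \<alpha> e\<^sup>2 / L\<^sub>1 + 4 L\<^sub>1 \<eta>\<^sup>2 / \<alpha>\<close>, so telescoping bounds the sum of \<open>\<eta>\<close> times the expected
  residual by a constant times \<open>ln K\<close>. A vanishing direction yields a zero step because of
  \<open>x / 0 = 0\<close>, and the estimates remain valid for it.\<close>

section \<open>Symmetry of second derivatives\<close>

text \<open>Self-concordance bounds the third derivative only on the diagonal, while carrying a norm
  from one point to another involves D^3 B[u, u, d] with \<open>u\<close> and \<open>d\<close>
  unrelated; this is what the trilinear bound is for. Three facts needed at every iterate are
  derived rather than given: the blow-up of \<open>B\<close> at the boundary keeps open unit local
  balls inside the cone, pointedness then makes the Hessian definite, and continuity of the data on
  the strictly feasible set makes the iterates measurable. The exponents 3/4 and 1/2 make \<eta>^2 /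
  \<alpha> and \<gamma>^2 both of order 1 / (k + 1), whose sum is the source of ln K, while \<eta>^2
  alone is summable. The index is drawn from the upper half, where \<eta> is at least s K^(-3/4), so
  that the unweighted average of the residuals is at most M ln K / K^(1/4). The second lower bound
  on K makes this at most \<epsilon> / (1 + sqrt \<theta>); the first makes \<mu> reach that same
  floor on the whole upper half.\<close>

lemma has_derivative_grad:
  assumes "f differentiable (at x)"
  shows "(f has_derivative (\<lambda>h. grad f x \<bullet> h)) (at x)"
proof -
  let ?F = "frechet_derivative f (at x)"
  have der: "(f has_derivative ?F) (at x)"
    using assms frechet_derivative_works by blast
  then interpret F: bounded_linear ?F
    by (rule has_derivative_bounded_linear)
  have "?F h = grad f x \<bullet> h" for h
  proof -
    have "?F h = ?F (\<Sum>i\<in>UNIV. h $ i *\<^sub>R axis i 1)"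
      by (metis basis_expansion scalar_mult_eq_scaleR)
    then show ?thesis
      by (simp add: F.sum F.scaleR grad_def inner_vec_def mult.commute)
  qed
  then have "?F = (\<lambda>h. grad f x \<bullet> h)" by auto
  with der show ?thesis by simp
qed

lemma grad_eqI:
  assumes "(f has_derivative (\<lambda>h. g \<bullet> h)) (at x)"
  shows "grad f x = g"
proof -
  have "frechet_derivative f (at x) = (\<lambda>h. g \<bullet> h)"
    using assms frechet_derivative_at by metis
  then show ?thesis
    by (simp add: grad_def vec_eq_iff inner_axis)
qed

lemma has_real_derivative_line:
  assumes "f differentiable (at (x + t *\<^sub>R u))"
  shows "((\<lambda>t. f (x + t *\<^sub>R u)) has_real_derivative (grad f (x + t *\<^sub>R u) \<bullet> u)) (at t)"
proof -
  have "((\<lambda>t. x + t *\<^sub>R u) has_derivative (\<lambda>h. h *\<^sub>R u)) (at t)"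
    by (auto intro!: derivative_eq_intros)
  from has_derivative_compose[OF this has_derivative_grad[OF assms]]
  show ?thesis
    by (simp add: has_field_derivative_def mult.commute[of _ "grad f (x + t *\<^sub>R u) \<bullet> u"])
qed

text \<open>Clairaut by the mean value theorem in one variable, using differentiability of the
  gradient at the single point \<open>x\<close>. The limit serves twice: it yields the symmetry in
  \<open>u\<close> and \<open>v\<close>, and for v = -u it turns midpoint convexity into a sign of
  the Hessian.\<close>

lemma second_difference_tendsto:
  fixes f :: "real^'n \<Rightarrow> real"
  assumes S: "open S" "x \<in> S" and diff: "\<And>y. y \<in> S \<Longrightarrow> f differentiable (at y)"
    and F: "(grad f has_derivative F) (at x)"
  shows "((\<lambda>s. (f (x + s *\<^sub>R u + s *\<^sub>R v) - f (x + s *\<^sub>R u) - f (x + s *\<^sub>R v) + f x) / s\<^sup>2)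
          \<longlongrightarrow> u \<bullet> F v) (at_right 0)"
proof (rule tendstoI)
  fix e :: real assume e: "e > 0"
  interpret F: bounded_linear F using F by (rule has_derivative_bounded_linear)
  define N where "N = norm u + norm v + 1"
  have N: "N > 0" "norm u \<le> N" "norm u + norm v \<le> N" unfolding N_def
    by (simp_all add: add_nonneg_pos)
  define e' where "e' = e / (4 * N\<^sup>2)"
  have e': "e' > 0" using e N by (simp add: e'_def)
  obtain d1 where d1: "d1 > 0"
    "\<And>y. norm (y - x) < d1 \<Longrightarrow> norm (grad f y - grad f x - F (y - x)) \<le> e' * norm (y - x)"
    using F e' unfolding has_derivative_at_alt by blast
  obtain d2 where d2: "d2 > 0" "ball x d2 \<subseteq> S"
    using S openE by blast
  define d where "d = min d1 d2 / N"
  have d: "d > 0" using d1 d2 N by (simp add: d_def)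
  have "\<bar>(f (x + s *\<^sub>R u + s *\<^sub>R v) - f (x + s *\<^sub>R u) - f (x + s *\<^sub>R v) + f x) / s\<^sup>2 - u \<bullet> F v\<bar> < e"
    if s: "0 < s" "s < d" for s
  proof -
    have sN: "s * N < min d1 d2"
      using s N by (simp add: d_def pos_less_divide_eq)
    have small: "norm (a *\<^sub>R u + c *\<^sub>R v) \<le> s * N" if "0 \<le> a" "a \<le> s" "0 \<le> c" "c \<le> s" for a c
    proof -
      have "norm (a *\<^sub>R u + c *\<^sub>R v) \<le> a * norm u + c * norm v"
        using that norm_triangle_ineq[of "a *\<^sub>R u" "c *\<^sub>R v"] by simp
      also have "\<dots> \<le> s * norm u + s * norm v"
        using that by (intro add_mono mult_right_mono) auto
      also have "\<dots> \<le> s * N" using N s by (simp flip: distrib_left)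
      finally show ?thesis .
    qed
    have inS: "x + (a *\<^sub>R u + c *\<^sub>R v) \<in> S" if "0 \<le> a" "a \<le> s" "0 \<le> c" "c \<le> s" for a c
    proof -
      have "dist x (x + w) = norm w" for w by (simp add: dist_norm)
      then have "x + (a *\<^sub>R u + c *\<^sub>R v) \<in> ball x d2"
        using small[OF that] sN by simp
      then show ?thesis using d2(2) by blast
    qed
    define r where "r w = grad f (x + w) - grad f x - F w" for w
    have r: "norm (r (a *\<^sub>R u + c *\<^sub>R v)) \<le> e' * (s * N)" if "0 \<le> a" "a \<le> s" "0 \<le> c" "c \<le> s" for a c
    proof -
      have "norm (r (a *\<^sub>R u + c *\<^sub>R v)) \<le> e' * norm (a *\<^sub>R u + c *\<^sub>R v)"
        using d1(2)[of "x + (a *\<^sub>R u + c *\<^sub>R v)"] small[OF that] sN by (simp add: r_def)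
      also have "\<dots> \<le> e' * (s * N)" using small[OF that] e' by simp
      finally show ?thesis .
    qed
    \<comment> \<open>The second difference is p s - p 0; one mean value in \<open>t\<close> leaves
      a difference of two gradients, which the expansion of the gradient at \<open>x\<close>
      evaluates.\<close>
    define p where "p t = f ((x + s *\<^sub>R v) + t *\<^sub>R u) - f (x + t *\<^sub>R u)" for t
    have "\<exists>z>0. z < s \<and> p s - p 0 = (s - 0) * (grad f ((x + s *\<^sub>R v) + z *\<^sub>R u) \<bullet> u - grad f (x + z *\<^sub>R u) \<bullet> u)"
    proof (rule MVT2)
      fix t assume t: "0 \<le> t" "t \<le> s"
      have "x + s *\<^sub>R v + t *\<^sub>R u \<in> S" "x + t *\<^sub>R u \<in> S"
        using inS[of t s] inS[of t 0] t s by (simp_all add: algebra_simps)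
      then show "DERIV p t :> grad f (x + s *\<^sub>R v + t *\<^sub>R u) \<bullet> u - grad f (x + t *\<^sub>R u) \<bullet> u"
        unfolding p_def by (intro DERIV_diff has_real_derivative_line diff)
    qed (use s in auto)
    then obtain z where z: "0 < z" "z < s"
      and pz: "p s - p 0 = s * (grad f ((x + s *\<^sub>R v) + z *\<^sub>R u) \<bullet> u - grad f (x + z *\<^sub>R u) \<bullet> u)"
      by auto
    have "grad f ((x + s *\<^sub>R v) + z *\<^sub>R u) - grad f (x + z *\<^sub>R u)
        = r (z *\<^sub>R u + s *\<^sub>R v) - r (z *\<^sub>R u + 0 *\<^sub>R v) + s *\<^sub>R F v"
      by (simp add: r_def F.add F.scaleR algebra_simps)
    then have eq: "p s - p 0 = s * (u \<bullet> (r (z *\<^sub>R u + s *\<^sub>R v) - r (z *\<^sub>R u + 0 *\<^sub>R v))) + s\<^sup>2 * (u \<bullet> F v)"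
    proof -
      have "p s - p 0 = s * (u \<bullet> (grad f ((x + s *\<^sub>R v) + z *\<^sub>R u) - grad f (x + z *\<^sub>R u)))"
        by (simp add: pz inner_diff_right inner_commute)
      also have "\<dots> = s * (u \<bullet> (r (z *\<^sub>R u + s *\<^sub>R v) - r (z *\<^sub>R u + 0 *\<^sub>R v) + s *\<^sub>R F v))"
        by (simp only: \<open>grad f ((x + s *\<^sub>R v) + z *\<^sub>R u) - grad f (x + z *\<^sub>R u) = _\<close>)
      finally show ?thesis by (simp add: inner_add_right power2_eq_square algebra_simps)
    qed
    have "\<bar>u \<bullet> (r (z *\<^sub>R u + s *\<^sub>R v) - r (z *\<^sub>R u + 0 *\<^sub>R v))\<bar>
        \<le> norm u * norm (r (z *\<^sub>R u + s *\<^sub>R v) - r (z *\<^sub>R u + 0 *\<^sub>R v))"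
      by (rule Cauchy_Schwarz_ineq2)
    also have "\<dots> \<le> N * (e' * (s * N) + e' * (s * N))"
      using N r[of z s] r[of z 0] z s
      by (intro mult_mono order_trans[OF norm_triangle_ineq4] add_mono) auto
    also have "\<dots> = s * (e / 2)" using N by (simp add: e'_def power2_eq_square)
    finally have bd: "\<bar>u \<bullet> (r (z *\<^sub>R u + s *\<^sub>R v) - r (z *\<^sub>R u + 0 *\<^sub>R v))\<bar> \<le> s * (e / 2)" .
    have "(f (x + s *\<^sub>R u + s *\<^sub>R v) - f (x + s *\<^sub>R u) - f (x + s *\<^sub>R v) + f x) / s\<^sup>2 - u \<bullet> F v
       = (p s - p 0) / s\<^sup>2 - u \<bullet> F v"
      by (simp add: p_def algebra_simps)
    also have "\<dots> = (u \<bullet> (r (z *\<^sub>R u + s *\<^sub>R v) - r (z *\<^sub>R u + 0 *\<^sub>R v))) / s"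
      unfolding eq using s by (simp add: field_simps power2_eq_square)
    finally have eq2: "(f (x + s *\<^sub>R u + s *\<^sub>R v) - f (x + s *\<^sub>R u) - f (x + s *\<^sub>R v) + f x) / s\<^sup>2 - u \<bullet> F v
       = (u \<bullet> (r (z *\<^sub>R u + s *\<^sub>R v) - r (z *\<^sub>R u + 0 *\<^sub>R v))) / s" .
    have "\<bar>(f (x + s *\<^sub>R u + s *\<^sub>R v) - f (x + s *\<^sub>R u) - f (x + s *\<^sub>R v) + f x) / s\<^sup>2 - u \<bullet> F v\<bar> \<le> e / 2"
      unfolding eq2 abs_divide using bd s by (simp add: pos_divide_le_eq mult.commute)
    then show ?thesis using e by linarith
  qed
  then show "\<forall>\<^sub>F s in at_right 0.
      dist ((f (x + s *\<^sub>R u + s *\<^sub>R v) - f (x + s *\<^sub>R u) - f (x + s *\<^sub>R v) + f x) / s\<^sup>2) (u \<bullet> F v) < e"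
    unfolding eventually_at_right_field dist_real_def using d by blast
qed

lemma second_derivative_symmetric:
  fixes f :: "real^'n \<Rightarrow> real"
  assumes "open S" "x \<in> S" "\<And>y. y \<in> S \<Longrightarrow> f differentiable (at y)"
    and "(grad f has_derivative F) (at x)"
  shows "u \<bullet> F v = v \<bullet> F u"
proof (rule tendsto_unique)
  let ?g = "\<lambda>u v s. (f (x + s *\<^sub>R u + s *\<^sub>R v) - f (x + s *\<^sub>R u) - f (x + s *\<^sub>R v) + f x) / s\<^sup>2"
  show "(?g u v \<longlongrightarrow> u \<bullet> F v) (at_right 0)"
    by (rule second_difference_tendsto[OF assms])
  have "?g u v = ?g v u"
    by (simp add: fun_eq_iff algebra_simps)
  then show "(?g u v \<longlongrightarrow> v \<bullet> F u) (at_right 0)"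
    using second_difference_tendsto[OF assms, where u = v and v = u] by metis
qed simp

section \<open>Symmetric trilinear forms\<close>

text \<open>For a unit vector \<open>h = cos a u + sin a v\<close> with \<open>u, v\<close> orthonormal, \<open>T h u u\<close> is a signed
  combination of the values of the cubic form at \<open>cos (a / 3) u + sin (a / 3) v\<close> and at its
  rotations by \<open>\<plusminus>2\<pi>/3\<close>, with weights of total mass 1. This is Riesz' interpolation formula for
  trigonometric polynomials of degree 3, stated with \<open>c = cos (a / 3)\<close>, \<open>s = sin (a / 3)\<close>,
  \<open>q = \<surd>3\<close> and with denominators cleared.\<close>

lemma cubic_interpolation:
  fixes c s a0 a1 a2 a3 q :: real
  assumes cs: "c\<^sup>2 + s\<^sup>2 = 1" and q: "q\<^sup>2 = 3"
  defines "p \<equiv> (\<lambda>X Y. a0 * X^3 + 3 * a1 * X\<^sup>2 * Y + 3 * a2 * X * Y\<^sup>2 + a3 * Y^3)"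
  shows "8 * (4 * c\<^sup>2 - 1)\<^sup>2 * p c s + ((- c - q * s)\<^sup>2 - 1)\<^sup>2 * p (- c - q * s) (- s + q * c)
      + ((- c + q * s)\<^sup>2 - 1)\<^sup>2 * p (- c + q * s) (- s - q * c)
      = 72 * ((4 * c^3 - 3 * c) * a0 + (3 * s - 4 * s^3) * a1)" (is ?thesis1)
    and "(4 * c\<^sup>2 - 1)\<^sup>2 + ((- c - q * s)\<^sup>2 - 1)\<^sup>2 + ((- c + q * s)\<^sup>2 - 1)\<^sup>2 = 9" (is ?thesis2)
proof -
  show ?thesis2 using cs q by algebra
  \<comment> \<open>Both sides are linear in a0, ..., a3, so coefficients are compared one at a
    time; those of a2 and a3 vanish.\<close>
  have "8 * (4 * c\<^sup>2 - 1)\<^sup>2 * c^3 + ((- c - q * s)\<^sup>2 - 1)\<^sup>2 * (- c - q * s)^3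
      + ((- c + q * s)\<^sup>2 - 1)\<^sup>2 * (- c + q * s)^3 = 72 * (4 * c^3 - 3 * c)"
    using cs q by algebra
  moreover have "8 * (4 * c\<^sup>2 - 1)\<^sup>2 * (c\<^sup>2 * s) + ((- c - q * s)\<^sup>2 - 1)\<^sup>2 * ((- c - q * s)\<^sup>2 * (- s + q * c))
      + ((- c + q * s)\<^sup>2 - 1)\<^sup>2 * ((- c + q * s)\<^sup>2 * (- s - q * c)) = 24 * (3 * s - 4 * s^3)"
    using cs q by algebra
  moreover have "8 * (4 * c\<^sup>2 - 1)\<^sup>2 * (c * s\<^sup>2) + ((- c - q * s)\<^sup>2 - 1)\<^sup>2 * ((- c - q * s) * (- s + q * c)\<^sup>2)
      + ((- c + q * s)\<^sup>2 - 1)\<^sup>2 * ((- c + q * s) * (- s - q * c)\<^sup>2) = 0"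
    using cs q by algebra
  moreover have "8 * (4 * c\<^sup>2 - 1)\<^sup>2 * s^3 + ((- c - q * s)\<^sup>2 - 1)\<^sup>2 * (- s + q * c)^3
      + ((- c + q * s)\<^sup>2 - 1)\<^sup>2 * (- s - q * c)^3 = 0"
    using cs q by algebra
  ultimately show ?thesis1 unfolding p_def by algebra
qed

lemma sin_treble_sin: "sin (3 * x) = 3 * sin x - 4 * sin x ^ 3" for x :: real
proof -
  have "sin (3 * x) = sin (2 * x + x)" by simp
  also have "\<dots> = 2 * sin x * (cos x)\<^sup>2 + (1 - 2 * (sin x)\<^sup>2) * sin x"
    unfolding sin_add by (simp add: sin_double cos_double_sin power2_eq_square)
  also have "\<dots> = 3 * sin x - 4 * sin x ^ 3"
    using sin_cos_squared_add[of x] by algebra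
  finally show ?thesis .
qed

text \<open>Everything happens in the span of \<open>u\<close> and \<open>h\<close>, where
  \<open>T\<close> becomes a binary cubic form and the interpolation formula applies. The inner
  product is a parameter because the local one changes with the point.\<close>

lemma symmetric_trilinear_bound:
  fixes T :: "'a::real_vector \<Rightarrow> 'a \<Rightarrow> 'a \<Rightarrow> real" and ip :: "'a \<Rightarrow> 'a \<Rightarrow> real"
  assumes T_lin: "\<And>v w. linear (\<lambda>u. T u v w)"
    and T_sym: "\<And>u v w. T u v w = T v u w" "\<And>u v w. T u v w = T u w v"
    and ip_lin: "\<And>v. linear (\<lambda>u. ip u v)" and ip_sym: "\<And>u v. ip u v = ip v u"
    and ip_pos: "\<And>u. 0 \<le> ip u u" "\<And>u. ip u u = 0 \<Longrightarrow> u = 0"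
    and bound: "\<And>z. ip z z \<le> 1 \<Longrightarrow> \<bar>T z z z\<bar> \<le> C"
    and unit: "ip u u = 1" "ip h h = 1"
  shows "\<bar>T h u u\<bar> \<le> C"
proof -
  have T_add1: "T (a + b) v w = T a v w + T b v w" for a b v w
    using linear_add[OF T_lin] .
  have T_scale1: "T (r *\<^sub>R a) v w = r * T a v w" for r a v w
    using linear_cmul[OF T_lin] by simp
  have T_add2: "T v (a + b) w = T v a w + T v b w" for a b v w
    by (metis T_add1 T_sym(1))
  have T_scale2: "T v (r *\<^sub>R a) w = r * T v a w" for r a v w
    by (metis T_scale1 T_sym(1))
  have T_add3: "T v w (a + b) = T v w a + T v w b" for a b v w
    by (metis T_add2 T_sym(2))
  have T_scale3: "T v w (r *\<^sub>R a) = r * T v w a" for r a v w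
    by (metis T_scale2 T_sym(2))
  have ip_add1: "ip (a + b) v = ip a v + ip b v" for a b v
    using linear_add[OF ip_lin] .
  have ip_scale1: "ip (r *\<^sub>R a) v = r * ip a v" for r a v
    using linear_cmul[OF ip_lin] by simp
  have ip_add2: "ip v (a + b) = ip v a + ip v b" for a b v
    by (metis ip_add1 ip_sym)
  have ip_scale2: "ip v (r *\<^sub>R a) = r * ip v a" for r a v
    by (metis ip_scale1 ip_sym)
  note T_simps = T_add1 T_scale1 T_add2 T_scale2 T_add3 T_scale3
  note ip_simps = ip_add1 ip_scale1 ip_add2 ip_scale2
  define \<alpha> where "\<alpha> = ip h u"
  define w where "w = h + (- \<alpha>) *\<^sub>R u"
  have ipw: "ip w w = 1 - \<alpha>\<^sup>2"
    unfolding w_def ip_simps by (simp add: unit \<alpha>_def ip_sym[of u h] power2_eq_square algebra_simps)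
  have ipuw: "ip u w = 0"
    unfolding w_def ip_simps by (simp add: unit \<alpha>_def ip_sym[of u h])
  have "\<alpha>\<^sup>2 \<le> 1" using ip_pos(1)[of w] ipw by simp
  then have \<alpha>: "-1 \<le> \<alpha>" "\<alpha> \<le> 1" by (simp_all add: abs_square_le_1 abs_le_iff)
  define \<beta> where "\<beta> = sqrt (1 - \<alpha>\<^sup>2)"
  have \<beta>: "\<beta>\<^sup>2 = 1 - \<alpha>\<^sup>2" using \<open>\<alpha>\<^sup>2 \<le> 1\<close> by (simp add: \<beta>_def)
  \<comment> \<open>If \<open>h\<close> is a multiple of \<open>u\<close>, then \<beta> = 0 and
    division by zero gives v = 0; hence \<open>v\<close> is only known to have norm at most
    1.\<close>
  define v where "v = (1 / \<beta>) *\<^sub>R w"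
  have w_eq: "w = \<beta> *\<^sub>R v"
    using ipw ip_pos(2)[of w] \<beta> by (cases "\<beta> = 0") (auto simp: v_def)
  have h_eq: "h = \<alpha> *\<^sub>R u + \<beta> *\<^sub>R v"
    using w_eq by (simp add: w_def algebra_simps)
  have ipuv: "ip u v = 0" "ip v u = 0" using ipuw ip_sym[of v u] by (simp_all add: v_def ip_simps)
  have ipv: "ip v v \<le> 1"
    using ipw \<beta> ip_pos(1)[of w] by (auto simp: v_def ip_simps power2_eq_square divide_le_eq_1)
  define a where "a = arccos \<alpha> / 3"
  have a3: "cos (3 * a) = \<alpha>" "sin (3 * a) = \<beta>"
    using \<alpha> by (simp_all add: a_def \<beta>_def sin_arccos)
  define c s where "c = cos a" and "s = sin a"
  have cs: "c\<^sup>2 + s\<^sup>2 = 1" by (simp add: c_def s_def)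
  have \<alpha>\<beta>: "\<alpha> = 4 * c^3 - 3 * c" "\<beta> = 3 * s - 4 * s^3"
    using a3 cos_treble_cos[of a] sin_treble_sin[of a] by (simp_all add: c_def s_def)
  define p where "p X Y = T u u u * X^3 + 3 * T v u u * X\<^sup>2 * Y + 3 * T v v u * X * Y\<^sup>2 + T v v v * Y^3"
    for X Y
  have p: "p X Y = T (X *\<^sub>R u + Y *\<^sub>R v) (X *\<^sub>R u + Y *\<^sub>R v) (X *\<^sub>R u + Y *\<^sub>R v)" for X Y
    unfolding p_def T_simps T_sym(1)[of u v u] T_sym(2)[of u u v] T_sym(1)[of u v v] T_sym(2)[of v u v]
    by (simp add: power2_eq_square power3_eq_cube algebra_simps)
  have p_unit: "\<bar>p X Y\<bar> \<le> C" if "X\<^sup>2 + Y\<^sup>2 \<le> 1" for X Y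
  proof -
    have "ip (X *\<^sub>R u + Y *\<^sub>R v) (X *\<^sub>R u + Y *\<^sub>R v) = X\<^sup>2 + Y\<^sup>2 * ip v v"
      by (simp add: ip_simps ipuv unit power2_eq_square)
    also have "\<dots> \<le> X\<^sup>2 + Y\<^sup>2" using ipv by (simp add: mult_left_le)
    finally show ?thesis unfolding p using that by (intro bound) simp
  qed
  \<comment> \<open>The two rotated points enter the formula with doubled coordinates, so
    homogeneity of degree 3 gives 8 C; with weights of sum 9 this makes 72 C.\<close>
  have p_two: "\<bar>p X Y\<bar> \<le> 8 * C" if "X\<^sup>2 + Y\<^sup>2 \<le> 4" for X Y
  proof -
    have "(X / 2)\<^sup>2 + (Y / 2)\<^sup>2 \<le> 1" using that by (simp add: power_divide)
    moreover have "p X Y = 8 * p (X / 2) (Y / 2)"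
      by (simp add: p_def power_divide field_simps)
    ultimately show ?thesis using p_unit[of "X / 2" "Y / 2"] by (simp add: abs_mult)
  qed
  define q :: real where "q = sqrt 3"
  have q: "q\<^sup>2 = 3" by (simp add: q_def)
  define w0 w1 w2 where "w0 = (4 * c\<^sup>2 - 1)\<^sup>2" and "w1 = ((- c - q * s)\<^sup>2 - 1)\<^sup>2"
    and "w2 = ((- c + q * s)\<^sup>2 - 1)\<^sup>2"
  note interp = cubic_interpolation[OF cs q, folded w0_def w1_def w2_def]
  have "72 * T h u u = 72 * (\<alpha> * T u u u + \<beta> * T v u u)"
    by (simp add: h_eq T_simps)
  also have "\<dots> = 8 * w0 * p c s + w1 * p (- c - q * s) (- s + q * c)
      + w2 * p (- c + q * s) (- s - q * c)"
    unfolding \<alpha>\<beta> p_def using interp(1)[of "T u u u" "T v u u" "T v v u" "T v v v"] by simp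
  finally have "\<bar>72 * T h u u\<bar> \<le> \<bar>8 * w0 * p c s\<bar> + \<bar>w1 * p (- c - q * s) (- s + q * c)\<bar>
      + \<bar>w2 * p (- c + q * s) (- s - q * c)\<bar>"
    by linarith
  also have "\<dots> = w0 * (8 * \<bar>p c s\<bar>) + w1 * \<bar>p (- c - q * s) (- s + q * c)\<bar>
      + w2 * \<bar>p (- c + q * s) (- s - q * c)\<bar>"
    by (simp add: abs_mult w0_def w1_def w2_def)
  also have "\<dots> \<le> w0 * (8 * C) + w1 * (8 * C) + w2 * (8 * C)"
  proof (intro add_mono mult_left_mono)
    show "\<bar>p c s\<bar> \<le> C" using p_unit[of c s] cs by simp
    have "(- c - q * s)\<^sup>2 + (- s + q * c)\<^sup>2 = (1 + q\<^sup>2) * (c\<^sup>2 + s\<^sup>2)"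
      "(- c + q * s)\<^sup>2 + (- s - q * c)\<^sup>2 = (1 + q\<^sup>2) * (c\<^sup>2 + s\<^sup>2)"
      by (simp_all add: power2_eq_square algebra_simps)
    then have "(- c - q * s)\<^sup>2 + (- s + q * c)\<^sup>2 = 4" "(- c + q * s)\<^sup>2 + (- s - q * c)\<^sup>2 = 4"
      unfolding cs q by simp_all
    then show "\<bar>p (- c - q * s) (- s + q * c)\<bar> \<le> 8 * C" "\<bar>p (- c + q * s) (- s - q * c)\<bar> \<le> 8 * C"
      by (auto intro: p_two)
  qed (simp_all add: w0_def w1_def w2_def)
  also have "\<dots> = (w0 + w1 + w2) * (8 * C)" by (simp add: algebra_simps)
  also have "\<dots> = 72 * C" using interp(2) by simp
  finally show ?thesis by simp
qed

section \<open>Positive definite matrices\<close>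

definition pos_def :: "real^'n^'n \<Rightarrow> bool" where
  "pos_def M \<longleftrightarrow> (\<forall>u v. u \<bullet> (M *v v) = v \<bullet> (M *v u)) \<and> (\<forall>v. v \<noteq> 0 \<longrightarrow> 0 < v \<bullet> (M *v v))"

definition quad_norm :: "real^'n^'n \<Rightarrow> real^'n \<Rightarrow> real" where
  "quad_norm M v = sqrt (v \<bullet> (M *v v))"

lemma pos_def_sym: "pos_def M \<Longrightarrow> u \<bullet> (M *v v) = v \<bullet> (M *v u)"
  by (simp add: pos_def_def)

lemma pos_def_nonneg: "pos_def M \<Longrightarrow> 0 \<le> v \<bullet> (M *v v)"
  by (cases "v = 0") (auto simp: pos_def_def less_imp_le)

lemma quad_norm_nonneg: "pos_def M \<Longrightarrow> 0 \<le> quad_norm M v"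
  by (simp add: quad_norm_def pos_def_nonneg)

lemma quad_norm_sq: "pos_def M \<Longrightarrow> (quad_norm M v)\<^sup>2 = v \<bullet> (M *v v)"
  by (simp add: quad_norm_def pos_def_nonneg)

lemma quad_norm_eq_0: "pos_def M \<Longrightarrow> quad_norm M v = 0 \<longleftrightarrow> v = 0"
  by (cases "v = 0") (auto simp: quad_norm_def pos_def_def less_le)

lemma quad_norm_scaleR: "quad_norm M (c *\<^sub>R v) = \<bar>c\<bar> * quad_norm M v"
proof -
  have "(c *\<^sub>R v) \<bullet> (M *v (c *\<^sub>R v)) = c\<^sup>2 * (v \<bullet> (M *v v))"
    by (simp add: matrix_vector_mult_scaleR power2_eq_square)
  then show ?thesis by (simp add: quad_norm_def real_sqrt_mult)
qed

lemma quad_norm_add_sq: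
  assumes "pos_def M"
  shows "(quad_norm M (u + v))\<^sup>2 = (quad_norm M u)\<^sup>2 + 2 * (u \<bullet> (M *v v)) + (quad_norm M v)\<^sup>2"
  using pos_def_sym[OF assms, of v u]
  by (simp add: quad_norm_sq[OF assms] inner_add_left inner_add_right matrix_vector_right_distrib)

lemma quad_norm_Cauchy_Schwarz:
  assumes "pos_def M"
  shows "\<bar>u \<bullet> (M *v v)\<bar> \<le> quad_norm M u * quad_norm M v"
proof (cases "v = 0")
  case False
  define q where "q = v \<bullet> (M *v v)"
  have q: "q > 0" using assms False by (simp add: q_def pos_def_def)
  define t where "t = - (u \<bullet> (M *v v)) / q"
  have "0 \<le> (quad_norm M (u + t *\<^sub>R v))\<^sup>2" by simp
  also have "\<dots> = (quad_norm M u)\<^sup>2 + 2 * t * (u \<bullet> (M *v v)) + t\<^sup>2 * q"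
    unfolding quad_norm_add_sq[OF assms]
    by (simp add: quad_norm_sq[OF assms, of v] matrix_vector_mult_scaleR q_def quad_norm_scaleR power_mult_distrib)
  also have "\<dots> = (quad_norm M u)\<^sup>2 - (u \<bullet> (M *v v))\<^sup>2 / q"
    using q by (simp add: t_def field_simps power2_eq_square)
  finally have "(u \<bullet> (M *v v))\<^sup>2 \<le> (quad_norm M u)\<^sup>2 * q"
    using q by (simp add: field_simps)
  also have "\<dots> = (quad_norm M u * quad_norm M v)\<^sup>2"
    by (simp add: quad_norm_sq[OF assms, of v] power_mult_distrib q_def)
  finally show ?thesis
    using quad_norm_nonneg[OF assms] by (metis abs_le_square_iff abs_of_nonneg mult_nonneg_nonneg)
qed (simp add: quad_norm_def)

lemma quad_norm_triangle:
  assumes "pos_def M"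
  shows "quad_norm M (u + v) \<le> quad_norm M u + quad_norm M v"
proof (rule power2_le_imp_le)
  show "(quad_norm M (u + v))\<^sup>2 \<le> (quad_norm M u + quad_norm M v)\<^sup>2"
    using quad_norm_Cauchy_Schwarz[OF assms, of u v]
    by (simp add: quad_norm_add_sq[OF assms] power2_sum)
qed (simp add: quad_norm_nonneg[OF assms])

lemma quad_norm_minus: "quad_norm M (- v) = quad_norm M v"
  using quad_norm_scaleR[of M "-1" v] by simp

lemma matrix_inv_mult:
  fixes M :: "real^'n^'n"
  assumes "invertible M"
  shows "M ** matrix_inv M = mat 1" "matrix_inv M ** M = mat 1"
proof -
  have "M ** matrix_inv M = mat 1 \<and> matrix_inv M ** M = mat 1"
    using assms unfolding invertible_def matrix_inv_def by (rule someI_ex)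
  then show "M ** matrix_inv M = mat 1" "matrix_inv M ** M = mat 1" by auto
qed

lemma pos_def_invertible:
  fixes M :: "real^'n^'n"
  assumes "pos_def M"
  shows "invertible M"
proof -
  have "\<forall>v. M *v v = 0 \<longrightarrow> v = 0"
    using assms by (metis inner_zero_right less_irrefl pos_def_def)
  then show ?thesis
    unfolding invertible_left_inverse matrix_left_invertible_ker .
qed

lemma pos_def_inv_mult:
  assumes "pos_def M"
  shows "M *v (matrix_inv M *v v) = v" "matrix_inv M *v (M *v v) = v"
  using matrix_inv_mult[OF pos_def_invertible[OF assms]] by (simp_all add: matrix_vector_mul_assoc)

lemma pos_def_matrix_inv:
  assumes "pos_def M"
  shows "pos_def (matrix_inv M)"
  unfolding pos_def_def
proof (intro conjI allI impI)
  fix u v :: "real^'a"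
  show "u \<bullet> (matrix_inv M *v v) = v \<bullet> (matrix_inv M *v u)"
    using pos_def_sym[OF assms, of "matrix_inv M *v v" "matrix_inv M *v u"]
    by (simp add: pos_def_inv_mult[OF assms] inner_commute)
next
  fix v :: "real^'a" assume "v \<noteq> 0"
  then have "matrix_inv M *v v \<noteq> 0"
    by (metis pos_def_inv_mult(1)[OF assms] matrix_vector_mult_0_right)
  then have "0 < (matrix_inv M *v v) \<bullet> (M *v (matrix_inv M *v v))"
    using assms unfolding pos_def_def by blast
  then show "0 < v \<bullet> (matrix_inv M *v v)"
    by (simp add: pos_def_inv_mult[OF assms] inner_commute)
qed

lemma quad_norm_matrix_inv:
  assumes "pos_def M"
  shows "quad_norm M (matrix_inv M *v v) = quad_norm (matrix_inv M) v"
  by (simp add: quad_norm_def pos_def_inv_mult[OF assms] inner_commute)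

lemma quad_norm_duality:
  assumes "pos_def M"
  shows "\<bar>v \<bullet> u\<bar> \<le> quad_norm (matrix_inv M) v * quad_norm M u"
  using quad_norm_Cauchy_Schwarz[OF assms, of "matrix_inv M *v v" u]
    pos_def_sym[OF assms, of "matrix_inv M *v v" u]
  by (simp add: pos_def_inv_mult[OF assms] quad_norm_matrix_inv[OF assms] inner_commute)

text \<open>Comparison of norms reverses under inversion: pair \<open>v\<close> with
  \<open>matrix_inv M *v v\<close>, whose \<open>M\<close>-norm is the dual norm of
  \<open>v\<close>, and cancel one factor.\<close>

lemma quad_norm_matrix_inv_le:
  assumes M: "pos_def M" and N: "pos_def N" and c: "0 \<le> c"
    and le: "\<And>u. quad_norm N u \<le> c * quad_norm M u"
  shows "quad_norm (matrix_inv M) v \<le> c * quad_norm (matrix_inv N) v"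
proof (cases "v = 0")
  case False
  let ?n = "quad_norm (matrix_inv M) v"
  have pos: "?n > 0"
    using False quad_norm_nonneg quad_norm_eq_0 pos_def_matrix_inv[OF M] by (metis less_eq_real_def)
  have "?n * ?n = v \<bullet> (matrix_inv M *v v)"
    using quad_norm_sq[OF pos_def_matrix_inv[OF M]] by (simp flip: power2_eq_square)
  also have "\<dots> \<le> quad_norm (matrix_inv N) v * quad_norm N (matrix_inv M *v v)"
    using quad_norm_duality[OF N, of v "matrix_inv M *v v"] by linarith
  also have "\<dots> \<le> quad_norm (matrix_inv N) v * (c * quad_norm M (matrix_inv M *v v))"
    using le quad_norm_nonneg[OF pos_def_matrix_inv[OF N]] by (intro mult_left_mono)
  also have "\<dots> = c * quad_norm (matrix_inv N) v * ?n"
    by (simp add: quad_norm_matrix_inv[OF M])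
  finally show ?thesis using pos by simp
qed (simp add: quad_norm_def)

lemma invertible_congruence:
  fixes A :: "real^'n^'m"
  assumes H: "pos_def H" and A: "rank A = CARD('m)"
  shows "invertible (A ** H ** transpose A)"
proof -
  have inj: "inj ((*v) (transpose A))"
    using A full_rank_injective[of "transpose A"] by (simp add: rank_transpose)
  have "v = 0" if "(A ** H ** transpose A) *v v = 0" for v
  proof (rule ccontr)
    assume "v \<noteq> 0"
    then have "transpose A *v v \<noteq> 0"
      using inj by (metis injD matrix_vector_mult_0_right)
    then have "0 < (transpose A *v v) \<bullet> (H *v (transpose A *v v))"
      using H unfolding pos_def_def by blast
    also have "\<dots> = v \<bullet> ((A ** H ** transpose A) *v v)"
      by (simp add: dot_lmul_matrix matrix_vector_mul_assoc[symmetric] del: matrix_vector_mul_assoc)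
    finally show False using that by simp
  qed
  then show ?thesis
    unfolding invertible_left_inverse matrix_left_invertible_ker by blast
qed

section \<open>Self-concordant barriers\<close>

text \<open>Regularising \<open>g\<close> by a positive constant makes \<open>g powr (- 1/2)\<close> differentiable with derivative at least
  \<open>-1\<close> even where \<open>g\<close> vanishes.\<close>

lemma self_concordant_growth:
  fixes g g' :: "real \<Rightarrow> real"
  assumes der: "\<And>t. 0 \<le> t \<Longrightarrow> t \<le> T \<Longrightarrow> (g has_real_derivative g' t) (at t)"
    and nonneg: "\<And>t. 0 \<le> t \<Longrightarrow> t \<le> T \<Longrightarrow> 0 \<le> g t"
    and bound: "\<And>t. 0 \<le> t \<Longrightarrow> t \<le> T \<Longrightarrow> \<bar>g' t\<bar> \<le> 2 * g t powr (3/2)"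
    and g0: "g 0 = r\<^sup>2" and r: "0 \<le> r" and T: "0 \<le> T" "r * T < 1"
  shows "g T \<le> (r / (1 - r * T))\<^sup>2"
proof -
  have step: "sqrt (g T) \<le> \<rho> / (1 - \<rho> * T)" if \<rho>: "r < \<rho>" "\<rho> * T < 1" for \<rho>
  proof -
    \<comment> \<open>Chosen so that g 0 + \<delta> = \<rho>^2; \<rho> > r keeps it positive even
      when r = 0.\<close>
    define \<delta> where "\<delta> = \<rho>\<^sup>2 - r\<^sup>2"
    have \<delta>: "\<delta> > 0" using \<rho> r by (simp add: \<delta>_def power_strict_mono)
    have \<rho>0: "\<rho> > 0" using \<rho> r by simp
    define h where "h = (\<lambda>t. inverse (sqrt (g t + \<delta>)) + t)"
    have "h 0 \<le> h T"
    proof (rule DERIV_nonneg_imp_nondecreasing[OF T(1)])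
      fix t assume t: "0 \<le> t" "t \<le> T"
      have pos: "g t + \<delta> > 0" using nonneg[OF t] \<delta> by simp
      define S where "S = sqrt (g t + \<delta>)"
      have S: "S > 0" "S * S = g t + \<delta>" using pos by (simp_all add: S_def)
      have "((\<lambda>t. sqrt (g t + \<delta>)) has_real_derivative inverse S / 2 * g' t) (at t)"
        using DERIV_chain2[OF DERIV_real_sqrt[OF pos] DERIV_add[OF der[OF t] DERIV_const[of \<delta>]]]
        by (simp add: S_def)
      from DERIV_add[OF DERIV_inverse'[OF this] DERIV_ident]
      have der_h: "(h has_real_derivative - (inverse S * (inverse S / 2 * g' t) * inverse S) + 1) (at t)"
        using S(1) unfolding h_def S_def by simp
      have "g' t \<le> 2 * g t powr (3/2)" using bound[OF t] by linarith
      also have "\<dots> \<le> 2 * (g t + \<delta>) powr (3/2)"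
        using nonneg[OF t] \<delta> by (intro mult_left_mono powr_mono2) auto
      also have "(g t + \<delta>) powr (3/2) = (g t + \<delta>) powr (1 + 1/2)" by simp
      also have "\<dots> = (g t + \<delta>) * S"
        using pos unfolding S_def by (subst powr_add) (simp add: powr_half_sqrt)
      finally have "g' t \<le> 2 * (S * S * S)" by (simp only: S(2))
      then have "inverse S * (inverse S / 2 * g' t) * inverse S \<le> 1"
        using S(1) by (simp add: field_simps)
      then show "\<exists>y. (h has_real_derivative y) (at t) \<and> 0 \<le> y"
        using der_h by (intro exI[of _ "- (inverse S * (inverse S / 2 * g' t) * inverse S) + 1"]) simp
    qed
    then have "1 / \<rho> \<le> 1 / sqrt (g T + \<delta>) + T"
      using \<rho>0 by (simp add: h_def g0 \<delta>_def divide_inverse)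
    then have "(1 - \<rho> * T) / \<rho> \<le> 1 / sqrt (g T + \<delta>)"
      using \<rho>0 by (simp add: field_simps)
    moreover have "sqrt (g T + \<delta>) > 0" using nonneg[of T] T \<delta> by simp
    ultimately have "sqrt (g T + \<delta>) \<le> \<rho> / (1 - \<rho> * T)"
      using \<rho>0 \<rho>(2) by (simp add: field_simps)
    moreover have "sqrt (g T) \<le> sqrt (g T + \<delta>)" using \<delta> by simp
    ultimately show ?thesis by linarith
  qed
  \<comment> \<open>The bound holds for every \<rho> slightly above \<open>r\<close>; letting \<rho>
    decrease to \<open>r\<close> removes the regularisation.\<close>
  have "sqrt (g T) \<le> r / (1 - r * T)"
  proof (rule tendsto_lowerbound)
    show "((\<lambda>\<rho>. \<rho> / (1 - \<rho> * T)) \<longlongrightarrow> r / (1 - r * T)) (at_right r)"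
      using T by (intro tendsto_intros) auto
    have "((\<lambda>\<rho>. \<rho> * T) \<longlongrightarrow> r * T) (at_right r)" by (intro tendsto_intros)
    then have "\<forall>\<^sub>F \<rho> in at_right r. \<rho> * T < 1"
      using T(2) by (rule order_tendstoD(2))
    moreover have "\<forall>\<^sub>F \<rho> in at_right r. r < \<rho>"
      by (rule eventually_at_right_less)
    ultimately show "\<forall>\<^sub>F \<rho> in at_right r. sqrt (g T) \<le> \<rho> / (1 - \<rho> * T)"
      by eventually_elim (rule step)
  qed simp
  then have "(sqrt (g T))\<^sup>2 \<le> (r / (1 - r * T))\<^sup>2"
    using nonneg[of T] T by (intro power_mono) auto
  then show ?thesis using nonneg[of T] T by simp
qed

section \<open>Derivatives of the barrier up to order three\<close>

locale sc_barrier =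
  fixes \<K> :: "(real^'n) set" and \<theta> :: real and B :: "real^'n \<Rightarrow> real"
  assumes cone: "proper_cone \<K>" and barrier: "lhsc_barrier \<K> \<theta> B"
begin

lemma B_smooth: "cont_diff_on 3 (interior \<K>) B"
  using barrier by (simp add: lhsc_barrier_def)

lemma B_differentiable: "y \<in> interior \<K> \<Longrightarrow> B differentiable (at y)"
  using B_smooth by (simp add: eval_nat_numeral)

lemma grad_B_has_derivative:
  assumes "y \<in> interior \<K>"
  shows "(grad B has_derivative (\<lambda>h. hess B y *v h)) (at y)"
proof -
  have "(\<lambda>x. grad B x $ i) differentiable (at y)" for i
    using B_smooth assms by (simp add: eval_nat_numeral)
  then have "grad B differentiable (at y)"
    unfolding differentiable_componentwise_within[of "grad B"]
    by (auto simp: Basis_vec_def inner_axis)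
  then show ?thesis
    unfolding hess_def using jacobian_works by blast
qed

lemma hess_sym:
  assumes "y \<in> interior \<K>"
  shows "u \<bullet> (hess B y *v v) = v \<bullet> (hess B y *v u)"
  by (rule second_derivative_symmetric[OF open_interior assms B_differentiable grad_B_has_derivative[OF assms]])

lemma grad_grad_B:
  assumes "y \<in> interior \<K>"
  shows "grad (\<lambda>x. u \<bullet> grad B x) y = hess B y *v u"
proof (rule grad_eqI)
  have "((\<lambda>x. u \<bullet> grad B x) has_derivative (\<lambda>h. u \<bullet> (hess B y *v h))) (at y)"
    using grad_B_has_derivative[OF assms] by (rule has_derivative_inner_right)
  then show "((\<lambda>x. u \<bullet> grad B x) has_derivative (\<lambda>h. (hess B y *v u) \<bullet> h)) (at y)"
    by (simp add: hess_sym[OF assms, of u] inner_commute)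
qed

text \<open>Ties the Hessian, a Jacobian, to the iterated partial derivatives in which
  \<open>cont_diff_on\<close> is phrased, so that its entries inherit their smoothness.\<close>

lemma hess_entry:
  assumes "y \<in> interior \<K>"
  shows "hess B y $ i $ j = grad (\<lambda>x. grad B x $ i) y $ j"
proof -
  have "grad (\<lambda>x. grad B x $ i) y = hess B y *v axis i 1"
    using grad_grad_B[OF assms, of "axis i 1"] by (simp add: inner_axis' )
  moreover have "(hess B y *v axis i 1) $ j = hess B y $ i $ j"
    using hess_sym[OF assms, of "axis j 1" "axis i 1"]
    by (simp add: inner_axis' matrix_vector_mult_basis column_def)
  ultimately show ?thesis by simp
qed

lemma hess_entry_differentiable:
  assumes "y \<in> interior \<K>"
  shows "(\<lambda>x. hess B x $ i $ j) differentiable (at y)"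
proof -
  have "(\<lambda>x. grad (\<lambda>x. grad B x $ i) x $ j) differentiable (at y)"
    using B_smooth assms by (simp add: eval_nat_numeral)
  then obtain D where "((\<lambda>x. grad (\<lambda>x. grad B x $ i) x $ j) has_derivative D) (at y)"
    by (auto simp: differentiable_def)
  then have "((\<lambda>x. hess B x $ i $ j) has_derivative D) (at y)"
    by (rule has_derivative_transform_within_open[OF _ open_interior assms]) (simp add: hess_entry)
  then show ?thesis by (auto simp: differentiable_def)
qed

lemma continuous_on_grad_B: "continuous_on (interior \<K>) (grad B)"
  by (meson continuous_at_imp_continuous_on grad_B_has_derivative has_derivative_continuous)

lemma continuous_on_hess_B: "continuous_on (interior \<K>) (hess B)"
proof -
  have "continuous_on (interior \<K>) (\<lambda>y. hess B y $ i $ j)" for i j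
    by (intro continuous_at_imp_continuous_on ballI differentiable_imp_continuous_within
        hess_entry_differentiable)
  then have "continuous_on (interior \<K>) (\<lambda>y. \<chi> i j. hess B y $ i $ j)"
    by (intro continuous_on_vec_lambda)
  then show ?thesis by simp
qed

text \<open>This is D^3 B(y)[v, u, w]; the last argument is the direction in which the Hessian is
  differentiated, so its symmetry with the others has to be proved.\<close>

definition third :: "real^'n \<Rightarrow> real^'n \<Rightarrow> real^'n \<Rightarrow> real^'n \<Rightarrow> real" where
  "third y v u w = v \<bullet> frechet_derivative (\<lambda>x. hess B x *v u) (at y) w"

lemma hess_mult_has_derivative:
  assumes "y \<in> interior \<K>"
  shows "((\<lambda>x. hess B x *v u) has_derivative frechet_derivative (\<lambda>x. hess B x *v u) (at y)) (at y)"
proof -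
  have "(\<lambda>x. \<Sum>j\<in>UNIV. hess B x $ i $ j * u $ j) differentiable (at y)" for i
    by (intro differentiable_sum ballI differentiable_mult hess_entry_differentiable[OF assms]) auto
  then have "(\<lambda>x. hess B x *v u) differentiable (at y)"
    unfolding differentiable_componentwise_within[of "\<lambda>x. hess B x *v u"]
    by (auto simp: Basis_vec_def inner_axis matrix_vector_mult_def)
  then show ?thesis by (simp add: frechet_derivative_works)
qed

lemma hess_form_has_derivative:
  assumes "y \<in> interior \<K>"
  shows "((\<lambda>x. v \<bullet> (hess B x *v u)) has_derivative third y v u) (at y)"
  unfolding third_def using hess_mult_has_derivative[OF assms] by (rule has_derivative_inner_right)

text \<open>Two transpositions generate all permutations: the first two slots swap because the
  Hessian is symmetric, the first and third because \<open>third y u v w\<close> is a second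
  derivative of the scalar function v . grad B.\<close>

lemma third_sym:
  assumes y: "y \<in> interior \<K>"
  shows "third y u v w = third y v u w" "third y u v w = third y u w v" "third y u v w = third y w v u"
proof -
  show sym1: "third y u v w = third y v u w" for u v w
  proof -
    have "((\<lambda>x. v \<bullet> (hess B x *v u)) has_derivative third y u v) (at y)"
      by (rule has_derivative_transform_within_open[OF hess_form_has_derivative[OF y] open_interior y])
        (simp add: hess_sym)
    from has_derivative_unique[OF this hess_form_has_derivative[OF y]]
    show ?thesis by (rule fun_cong)
  qed
  show sym2: "third y u v w = third y w v u" for u v w
    unfolding third_def
  proof (rule second_derivative_symmetric[OF open_interior y])
    show "(\<lambda>x. v \<bullet> grad B x) differentiable (at x)" if "x \<in> interior \<K>" for x
      using has_derivative_inner_right[OF grad_B_has_derivative[OF that]] by (auto simp: differentiable_def)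
    show "(grad (\<lambda>x. v \<bullet> grad B x) has_derivative frechet_derivative (\<lambda>x. hess B x *v v) (at y)) (at y)"
      by (rule has_derivative_transform_within_open[OF hess_mult_has_derivative[OF y] open_interior y])
        (simp add: grad_grad_B)
  qed
  show "third y u v w = third y u w v" by (metis sym1 sym2)
qed

section \<open>The barrier on lines\<close>

lemma has_derivative_line: "((\<lambda>t. x + t *\<^sub>R d) has_derivative (\<lambda>h. h *\<^sub>R d)) (at t)"
  by (auto intro!: derivative_eq_intros)

lemma B_line_deriv:
  assumes "x + t *\<^sub>R d \<in> interior \<K>"
  shows "((\<lambda>t. B (x + t *\<^sub>R d)) has_real_derivative d \<bullet> grad B (x + t *\<^sub>R d)) (at t)"
  using has_real_derivative_line[OF B_differentiable[OF assms]] by (simp add: inner_commute)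

lemma grad_line_deriv:
  assumes "x + t *\<^sub>R d \<in> interior \<K>"
  shows "((\<lambda>t. d \<bullet> grad B (x + t *\<^sub>R d)) has_real_derivative d \<bullet> (hess B (x + t *\<^sub>R d) *v d)) (at t)"
  using has_derivative_compose[OF has_derivative_line has_derivative_inner_right[OF grad_B_has_derivative[OF assms]]]
  by (simp add: has_field_derivative_def matrix_vector_mult_scaleR mult_commute_abs)

lemma hess_line_deriv:
  assumes "x + t *\<^sub>R d \<in> interior \<K>"
  shows "((\<lambda>t. u \<bullet> (hess B (x + t *\<^sub>R d) *v v)) has_real_derivative third (x + t *\<^sub>R d) u v d) (at t)"
proof -
  have "third (x + t *\<^sub>R d) u v (h *\<^sub>R d) = h * third (x + t *\<^sub>R d) u v d" for h
    using linear_cmul[OF has_derivative_linear[OF hess_form_has_derivative[OF assms]], of u v h d] by simp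
  then show ?thesis
    using has_derivative_compose[OF has_derivative_line hess_form_has_derivative[OF assms, of u v]]
    by (simp add: has_field_derivative_def mult_commute_abs)
qed

text \<open>For v = -u the second difference is (2 B(y) - B(y + s u) - B(y - s u)) / s^2, which
  midpoint convexity makes nonpositive.\<close>

lemma hess_nonneg:
  assumes y: "y \<in> interior \<K>"
  shows "0 \<le> u \<bullet> (hess B y *v u)"
proof -
  let ?q = "\<lambda>s. (B (y + s *\<^sub>R u + s *\<^sub>R (- u)) - B (y + s *\<^sub>R u) - B (y + s *\<^sub>R (- u)) + B y) / s\<^sup>2"
  obtain d where d: "d > 0" "ball y d \<subseteq> interior \<K>"
    using y open_interior openE by blast
  have "u \<bullet> (hess B y *v (- u)) \<le> 0"
  proof (rule tendsto_upperbound)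
    show "(?q \<longlongrightarrow> u \<bullet> (hess B y *v (- u))) (at_right 0)"
      by (rule second_difference_tendsto[OF open_interior y B_differentiable grad_B_has_derivative[OF y]])
    have "?q s \<le> 0" if s: "0 < s" "s < d / (norm u + 1)" for s
    proof -
      have "s * norm u \<le> s * (norm u + 1)" using s by simp
      also have "\<dots> < d" using s by (simp add: pos_less_divide_eq add_nonneg_pos)
      finally have "s * norm u < d" .
      then have "y + s *\<^sub>R u \<in> ball y d" "y + s *\<^sub>R (- u) \<in> ball y d"
        using s by (simp_all add: dist_norm)
      then have "y + s *\<^sub>R u \<in> interior \<K>" "y + s *\<^sub>R (- u) \<in> interior \<K>" using d by blast+
      moreover have "convex_on (interior \<K>) B" using barrier by (simp add: lhsc_barrier_def)
      ultimately have "B ((1 - 1/2) *\<^sub>R (y + s *\<^sub>R u) + (1/2) *\<^sub>R (y + s *\<^sub>R (- u)))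
          \<le> (1 - 1/2) * B (y + s *\<^sub>R u) + (1/2) * B (y + s *\<^sub>R (- u))"
        by (intro convex_onD) auto
      moreover have "(1 - 1/2) *\<^sub>R (y + s *\<^sub>R u) + (1/2) *\<^sub>R (y + s *\<^sub>R (- u)) = y"
        by (simp add: vec_eq_iff field_simps)
      ultimately show ?thesis by (simp add: divide_le_0_iff)
    qed
    moreover have "d / (norm u + 1) > 0" using d by (simp add: add_nonneg_pos)
    ultimately show "\<forall>\<^sub>F s in at_right 0. ?q s \<le> 0"
      unfolding eventually_at_right_field by blast
  qed simp
  then show ?thesis using matrix_vector_mult_scaleR[of "hess B y" "-1" u] by simp
qed

text \<open>Translates the iterated \<open>deriv\<close> of the hypothesis into
  \<open>third\<close>. A formula for one derivative must hold on a neighbourhood of 0 before the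
  next \<open>deriv\<close> can be evaluated there, hence the open set \<open>?U\<close>.\<close>

lemma third_bound:
  assumes y: "y \<in> interior \<K>"
  shows "\<bar>third y u u u\<bar> \<le> 2 * (u \<bullet> (hess B y *v u)) powr (3/2)"
proof -
  let ?U = "(\<lambda>t. y + t *\<^sub>R u) -` interior \<K>"
  have "open ?U" by (intro open_vimage open_interior continuous_intros)
  have d1: "deriv (\<lambda>t. B (y + t *\<^sub>R u)) t = u \<bullet> grad B (y + t *\<^sub>R u)" if "t \<in> ?U" for t
    using B_line_deriv that by (auto intro: DERIV_imp_deriv)
  have d2: "deriv (deriv (\<lambda>t. B (y + t *\<^sub>R u))) t = u \<bullet> (hess B (y + t *\<^sub>R u) *v u)" if "t \<in> ?U" for t
  proof -
    have "\<forall>\<^sub>F t in nhds t. deriv (\<lambda>t. B (y + t *\<^sub>R u)) t = u \<bullet> grad B (y + t *\<^sub>R u)"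
      using d1 \<open>open ?U\<close> that eventually_nhds by blast
    then have "deriv (deriv (\<lambda>t. B (y + t *\<^sub>R u))) t = deriv (\<lambda>t. u \<bullet> grad B (y + t *\<^sub>R u)) t"
      by (rule deriv_cong_ev) simp
    then show ?thesis using grad_line_deriv that by (auto intro: DERIV_imp_deriv)
  qed
  have 0: "0 \<in> ?U" using y by simp
  have "\<forall>\<^sub>F t in nhds 0. deriv (deriv (\<lambda>t. B (y + t *\<^sub>R u))) t = u \<bullet> (hess B (y + t *\<^sub>R u) *v u)"
    using d2 \<open>open ?U\<close> 0 eventually_nhds by blast
  then have "deriv (deriv (deriv (\<lambda>t. B (y + t *\<^sub>R u)))) 0 = deriv (\<lambda>t. u \<bullet> (hess B (y + t *\<^sub>R u) *v u)) 0"
    by (rule deriv_cong_ev) simp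
  also have "\<dots> = third y u u u"
    using hess_line_deriv[of y 0 u u u] y by (auto intro: DERIV_imp_deriv)
  finally have d3: "deriv (deriv (deriv (\<lambda>t. B (y + t *\<^sub>R u)))) 0 = third y u u u" .
  have "\<bar>(deriv ^^ 3) (\<lambda>t. B (y + t *\<^sub>R u)) 0\<bar> \<le> 2 * ((deriv ^^ 2) (\<lambda>t. B (y + t *\<^sub>R u)) 0) powr (3/2)"
    using barrier y by (simp add: lhsc_barrier_def)
  then show ?thesis using d3 d2[OF 0] by (simp add: eval_nat_numeral)
qed

lemma local_norm_sq:
  assumes "y \<in> interior \<K>"
  shows "(local_norm B y u)\<^sup>2 = u \<bullet> (hess B y *v u)"
  by (simp add: local_norm_def hess_nonneg[OF assms])

lemma hess_line_bound:
  assumes seg: "\<And>s. 0 \<le> s \<Longrightarrow> s \<le> t \<Longrightarrow> x + s *\<^sub>R d \<in> interior \<K>"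
    and t: "0 \<le> t" "local_norm B x d * t < 1"
  shows "d \<bullet> (hess B (x + t *\<^sub>R d) *v d) \<le> (local_norm B x d / (1 - local_norm B x d * t))\<^sup>2"
proof (rule self_concordant_growth)
  fix s assume s: "0 \<le> s" "s \<le> t"
  show "((\<lambda>t. d \<bullet> (hess B (x + t *\<^sub>R d) *v d)) has_real_derivative third (x + s *\<^sub>R d) d d d) (at s)"
    by (rule hess_line_deriv[OF seg[OF s]])
  show "0 \<le> d \<bullet> (hess B (x + s *\<^sub>R d) *v d)" by (rule hess_nonneg[OF seg[OF s]])
  show "\<bar>third (x + s *\<^sub>R d) d d d\<bar> \<le> 2 * (d \<bullet> (hess B (x + s *\<^sub>R d) *v d)) powr (3 / 2)"
    by (rule third_bound[OF seg[OF s]])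
next
  have x: "x \<in> interior \<K>" using seg[of 0] t by simp
  then show "d \<bullet> (hess B (x + 0 *\<^sub>R d) *v d) = (local_norm B x d)\<^sup>2"
    by (simp add: local_norm_sq)
  show "0 \<le> local_norm B x d" using hess_nonneg[OF x] by (simp add: local_norm_def)
qed (use t in auto)


section \<open>Dikin balls and definiteness of the Hessian\<close>

lemma exit_point:
  assumes x: "x \<in> interior \<K>" and out: "x + d \<notin> interior \<K>"
  obtains t0 where "0 < t0" "t0 \<le> 1" "\<And>t. 0 \<le> t \<Longrightarrow> t < t0 \<Longrightarrow> x + t *\<^sub>R d \<in> interior \<K>"
    "filterlim (\<lambda>t. B (x + t *\<^sub>R d)) at_top (at_left t0)"
proof -
  define S where "S = {0..1} \<inter> (\<lambda>t. x + t *\<^sub>R d) -` (- interior \<K>)"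
  have "closed S"
    unfolding S_def by (intro closed_Int closed_vimage continuous_intros) (auto simp: closed_def)
  have "1 \<in> S" using out by (simp add: S_def)
  have bdd: "bdd_below S" by (auto simp: S_def intro!: bdd_belowI[of _ 0])
  \<comment> \<open>The first exit time. The interior is open, so the infimum is attained, and
    \<open>B\<close> blows up as the segment approaches that point from inside.\<close>
  define t0 where "t0 = Inf S"
  have t0S: "t0 \<in> S"
    unfolding t0_def using \<open>closed S\<close> \<open>1 \<in> S\<close> bdd by (intro closed_contains_Inf) auto
  then have "t0 \<noteq> 0" "0 \<le> t0" "t0 \<le> 1" using x by (auto simp: S_def)
  then have t0: "0 < t0" "t0 \<le> 1" by auto
  have ins: "x + t *\<^sub>R d \<in> interior \<K>" if "0 \<le> t" "t < t0" for t
  proof (rule ccontr)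
    assume "x + t *\<^sub>R d \<notin> interior \<K>"
    then have "t \<in> S" using that t0 by (simp add: S_def)
    then have "t0 \<le> t" unfolding t0_def using bdd by (rule cInf_lower)
    then show False using that by simp
  qed
  let ?z = "x + t0 *\<^sub>R d"
  have lim: "((\<lambda>t. x + t *\<^sub>R d) \<longlongrightarrow> ?z) (at_left t0)"
    by (intro tendsto_intros)
  have ev: "\<forall>\<^sub>F t in at_left t0. x + t *\<^sub>R d \<in> interior \<K>"
    unfolding eventually_at_left_field using ins t0 by (intro exI[of _ 0]) auto
  have "?z \<in> closure (interior \<K>)"
    by (rule Lim_in_closed_set[OF closed_closure _ _ lim])
      (use ev closure_subset in \<open>auto elim!: eventually_mono\<close>)
  moreover have "closure (interior \<K>) \<subseteq> closure \<K>"
    by (rule closure_mono[OF interior_subset])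
  moreover have z: "?z \<notin> interior \<K>" using t0S by (simp add: S_def)
  ultimately have "?z \<in> frontier \<K>" by (auto simp: frontier_def)
  then have "filterlim B at_top (at ?z within interior \<K>)"
    using barrier by (simp add: lhsc_barrier_def)
  moreover have "filterlim (\<lambda>t. x + t *\<^sub>R d) (at ?z within interior \<K>) (at_left t0)"
    unfolding filterlim_at using lim ev z by (auto elim!: eventually_mono)
  ultimately have "filterlim (\<lambda>t. B (x + t *\<^sub>R d)) at_top (at_left t0)"
    by (rule filterlim_compose)
  with t0 ins that show thesis by blast
qed

lemma local_norm_nonneg: "y \<in> interior \<K> \<Longrightarrow> 0 \<le> local_norm B y u"
  by (simp add: local_norm_def hess_nonneg)

text \<open>On the part of the segment inside the cone the second derivative of the barrier is bounded, so
  the barrier cannot blow up there.\<close>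

lemma Dikin:
  assumes x: "x \<in> interior \<K>" and d: "local_norm B x d < 1"
  shows "x + d \<in> interior \<K>"
proof (rule ccontr)
  assume "x + d \<notin> interior \<K>"
  then obtain t0 where t0: "0 < t0" "t0 \<le> 1"
    and ins: "\<And>t. 0 \<le> t \<Longrightarrow> t < t0 \<Longrightarrow> x + t *\<^sub>R d \<in> interior \<K>"
    and lim: "filterlim (\<lambda>t. B (x + t *\<^sub>R d)) at_top (at_left t0)"
    using exit_point[OF x] by metis
  define r where "r = local_norm B x d"
  have r: "0 \<le> r" "r < 1" using d local_norm_nonneg[OF x] by (simp_all add: r_def)
  \<comment> \<open>Since r t \<le> r on the segment, this bounds the second derivative uniformly in
    \<open>t\<close>.\<close>
  define C where "C = (r / (1 - r))\<^sup>2"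
  have C: "C \<ge> 0" by (simp add: C_def)
  have second: "d \<bullet> (hess B (x + t *\<^sub>R d) *v d) \<le> C" if t: "0 \<le> t" "t < t0" for t
  proof -
    have rt: "r * t \<le> r" using t t0 r by (simp add: mult_left_le)
    have "d \<bullet> (hess B (x + t *\<^sub>R d) *v d) \<le> (r / (1 - r * t))\<^sup>2"
      unfolding r_def using t ins rt r(2) by (intro hess_line_bound) (auto simp: r_def)
    also have "\<dots> \<le> C"
      unfolding C_def using rt r by (intro power_mono divide_left_mono mult_pos_pos) auto
    finally show ?thesis .
  qed
  have first: "d \<bullet> grad B (x + t *\<^sub>R d) \<le> d \<bullet> grad B x + C" if t: "0 \<le> t" "t < t0" for t
  proof -
    have "d \<bullet> grad B (x + 0 *\<^sub>R d) - C * 0 \<ge> d \<bullet> grad B (x + t *\<^sub>R d) - C * t"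
    proof (rule DERIV_nonpos_imp_nonincreasing[OF t(1)])
      fix s assume s: "0 \<le> s" "s \<le> t"
      have "((\<lambda>t. d \<bullet> grad B (x + t *\<^sub>R d) - C * t) has_real_derivative
          d \<bullet> (hess B (x + s *\<^sub>R d) *v d) - C) (at s)"
        using s t by (auto intro!: derivative_eq_intros grad_line_deriv ins)
      moreover have "d \<bullet> (hess B (x + s *\<^sub>R d) *v d) - C \<le> 0" using second[of s] s t by simp
      ultimately show "\<exists>y. ((\<lambda>t. d \<bullet> grad B (x + t *\<^sub>R d) - C * t) has_real_derivative y) (at s) \<and> y \<le> 0"
        by blast
    qed
    moreover have "C * t \<le> C" using C t t0 by (simp add: mult_left_le)
    ultimately show ?thesis by simp
  qed
  define M where "M = \<bar>d \<bullet> grad B x + C\<bar>"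
  have val: "B (x + t *\<^sub>R d) \<le> B x + M" if t: "0 \<le> t" "t < t0" for t
  proof -
    have "B (x + 0 *\<^sub>R d) - M * 0 \<ge> B (x + t *\<^sub>R d) - M * t"
    proof (rule DERIV_nonpos_imp_nonincreasing[OF t(1)])
      fix s assume s: "0 \<le> s" "s \<le> t"
      have "((\<lambda>t. B (x + t *\<^sub>R d) - M * t) has_real_derivative
          d \<bullet> grad B (x + s *\<^sub>R d) - M) (at s)"
        using s t by (auto intro!: derivative_eq_intros B_line_deriv ins)
      moreover have "d \<bullet> grad B (x + s *\<^sub>R d) - M \<le> 0" using first[of s] s t by (simp add: M_def)
      ultimately show "\<exists>y. ((\<lambda>t. B (x + t *\<^sub>R d) - M * t) has_real_derivative y) (at s) \<and> y \<le> 0"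
        by blast
    qed
    moreover have "M * t \<le> M" using t t0 by (simp add: M_def mult_left_le)
    ultimately show ?thesis by simp
  qed
  have "\<forall>\<^sub>F t in at_left t0. B x + M + 1 \<le> B (x + t *\<^sub>R d)"
    using lim by (simp add: filterlim_at_top)
  moreover have "\<forall>\<^sub>F t in at_left t0. 0 < t \<and> t < t0"
    unfolding eventually_at_left_field using t0 by auto
  ultimately have "\<forall>\<^sub>F t in at_left t0. False"
  proof eventually_elim
    case (elim t)
    then show False using val[of t] by simp
  qed
  then show False by simp
qed

text \<open>A null direction \<open>d\<close> of the Hessian has local norm 0 at every scale, so the
  Dikin balls contain the whole line through \<open>x\<close> along \<open>d\<close>. Scaling this
  line towards the origin puts \<open>d\<close> and \<open>-d\<close> into the closed cone, against
  pointedness.\<close>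

lemma hess_pos_def:
  assumes x: "x \<in> interior \<K>"
  shows "pos_def (hess B x)"
  unfolding pos_def_def
proof (intro conjI allI impI)
  fix d :: "real^'n" assume "d \<noteq> 0"
  have "d \<bullet> (hess B x *v d) \<noteq> 0"
  proof
    assume null: "d \<bullet> (hess B x *v d) = 0"
    have line: "x + c *\<^sub>R d \<in> \<K>" for c
    proof -
      have "local_norm B x (c *\<^sub>R d) = 0"
        using quad_norm_scaleR[of "hess B x" c d] null by (simp add: local_norm_def quad_norm_def)
      then show ?thesis using Dikin[OF x, of "c *\<^sub>R d"] interior_subset by auto
    qed
    have rec: "s *\<^sub>R d \<in> \<K>" if "\<bar>s\<bar> = 1" for s :: real
    proof (rule Lim_in_closed_set)
      show "closed \<K>" using cone by (simp add: proper_cone_def)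
      show "((\<lambda>c. c *\<^sub>R x + s *\<^sub>R d) \<longlongrightarrow> s *\<^sub>R d) (at_right 0)"
        by (rule tendsto_eq_intros refl)+ simp
      have "c *\<^sub>R x + s *\<^sub>R d \<in> \<K>" if c: "c > 0" for c
      proof -
        have "c *\<^sub>R (x + (s / c) *\<^sub>R d) \<in> \<K>"
          using line cone c by (intro mem_cone) (auto simp: proper_cone_def)
        then show ?thesis using c by (simp add: scaleR_add_right)
      qed
      then show "\<forall>\<^sub>F c in at_right 0. c *\<^sub>R x + s *\<^sub>R d \<in> \<K>"
        by (auto simp: eventually_at_right_field intro: exI[of _ 1])
    qed simp
    have "d \<in> \<K>" "- d \<in> \<K>" using rec[of 1] rec[of "-1"] by simp_all
    then have "d = 0" using cone by (simp add: proper_cone_def)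
    with \<open>d \<noteq> 0\<close> show False ..
  qed
  then show "0 < d \<bullet> (hess B x *v d)" using hess_nonneg[OF x, of d] by simp
qed (rule hess_sym[OF x])

section \<open>Change of the local norms between points\<close>

lemma local_norm_eq: "local_norm B y = quad_norm (hess B y)"
  by (simp add: fun_eq_iff local_norm_def quad_norm_def)

lemma dual_norm_eq: "dual_norm B y = quad_norm (matrix_inv (hess B y))"
  by (simp add: fun_eq_iff dual_norm_def quad_norm_def)

lemma hess_inv_pos_def: "y \<in> interior \<K> \<Longrightarrow> pos_def (matrix_inv (hess B y))"
  by (intro pos_def_matrix_inv hess_pos_def)

text \<open>Polarised self-concordance: \<open>u\<close> and \<open>d\<close> are scaled to unit
  local norm and the diagonal bound 2 is transferred by the trilinear lemma. Zero vectors cannot be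
  scaled and are treated apart.\<close>

lemma third_trilinear_bound:
  assumes y: "y \<in> interior \<K>"
  shows "\<bar>third y u u d\<bar> \<le> 2 * (local_norm B y u)\<^sup>2 * local_norm B y d"
proof (cases "u = 0 \<or> d = 0")
  case True
  have "linear (third y u u)" "linear (\<lambda>v. third y v u d)"
    using has_derivative_linear[OF hess_form_has_derivative[OF y]]
    by (auto simp: third_def intro!: linearI inner_add_left)
  with True have "third y u u d = 0" by (auto simp: linear_0 dest: linear_0)
  then show ?thesis using local_norm_nonneg[OF y] by simp
next
  case False
  note pd = hess_pos_def[OF y]
  define a b where "a = local_norm B y u" and "b = local_norm B y d"
  have ab: "a > 0" "b > 0"
    using False quad_norm_nonneg[OF pd] quad_norm_eq_0[OF pd]
    unfolding a_def b_def local_norm_eq by (auto simp: less_le)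
  define u' d' where "u' = (1 / a) *\<^sub>R u" and "d' = (1 / b) *\<^sub>R d"
  have lin: "linear (\<lambda>w. third y v u w)" for v u
    using has_derivative_linear[OF hess_form_has_derivative[OF y]] .
  have "\<bar>third y d' u' u'\<bar> \<le> 2"
  proof (rule symmetric_trilinear_bound[where T = "third y" and ip = "\<lambda>u v. u \<bullet> (hess B y *v v)"])
    show "linear (\<lambda>u. third y u v w)" for v w
      using lin[of v w] by (simp add: third_sym(3)[OF y, of _ v w] third_sym(1)[OF y, of w v])
    show "third y u v w = third y v u w" "third y u v w = third y u w v" for u v w
      by (rule third_sym[OF y])+
    show "linear (\<lambda>u. u \<bullet> (hess B y *v v))" for v
      by (auto intro!: linearI inner_add_left)
    show "u \<bullet> (hess B y *v v) = v \<bullet> (hess B y *v u)" for u v by (rule hess_sym[OF y])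
    show "0 \<le> u \<bullet> (hess B y *v u)" for u by (rule hess_nonneg[OF y])
    show "u = 0" if "u \<bullet> (hess B y *v u) = 0" for u
      using pd that unfolding pos_def_def by force
    show "\<bar>third y z z z\<bar> \<le> 2" if "z \<bullet> (hess B y *v z) \<le> 1" for z
    proof -
      have "\<bar>third y z z z\<bar> \<le> 2 * (z \<bullet> (hess B y *v z)) powr (3/2)" by (rule third_bound[OF y])
      also have "\<dots> \<le> 2 * 1 powr (3/2)"
        using that hess_nonneg[OF y] by (intro mult_left_mono powr_mono2) auto
      finally show ?thesis by simp
    qed
    have "quad_norm (hess B y) u' = 1" "quad_norm (hess B y) d' = 1"
      using ab by (simp_all add: u'_def d'_def quad_norm_scaleR a_def b_def local_norm_eq)
    then show "u' \<bullet> (hess B y *v u') = 1" "d' \<bullet> (hess B y *v d') = 1"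
      using quad_norm_sq[OF pd] by (metis one_power2)+
  qed
  moreover have "third y u u d = a\<^sup>2 * b * third y d' u' u'"
  proof -
    have scale: "third y v u (c *\<^sub>R w) = c * third y v u w" for c v u w
      using linear_cmul[OF lin] by simp
    have scale2: "third y v (c *\<^sub>R u) w = c * third y v u w" for c v u w
      by (metis scale third_sym(2)[OF y])
    have scale1: "third y (c *\<^sub>R v) u w = c * third y v u w" for c v u w
      by (metis scale2 third_sym(1)[OF y])
    have "third y u u d = third y (a *\<^sub>R u') (a *\<^sub>R u') (b *\<^sub>R d')"
      using ab by (simp add: u'_def d'_def)
    also have "\<dots> = a\<^sup>2 * b * third y u' u' d'"
      by (simp only: scale scale1 scale2 power2_eq_square) simp
    also have "third y u' u' d' = third y d' u' u'" by (rule third_sym(3)[OF y])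
    finally show ?thesis .
  qed
  ultimately show ?thesis
    using ab by (simp add: abs_mult a_def[symmetric] b_def[symmetric])
qed

text \<open>With q(t) the squared norm of \<open>u\<close> at x + t d, the polarised bound gives q'
  \<ge> - 2 q r / (1 - r t), since \<open>d\<close> itself has norm at most r / (1 - r t) there. The
  integrating factor (1 - r t)^(-2) makes the product nondecreasing.\<close>

lemma local_norm_shift:
  assumes x: "x \<in> interior \<K>" and d: "local_norm B x d < 1"
  shows "local_norm B x u \<le> 1 / (1 - local_norm B x d) * local_norm B (x + d) u"
proof -
  define r where "r = local_norm B x d"
  have r: "0 \<le> r" "r < 1" using d local_norm_nonneg[OF x] by (simp_all add: r_def)
  have rt: "r * t < 1" if "0 \<le> t" "t \<le> 1" for t
    using r that mult_left_le[of t r] by simp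
  have seg: "x + t *\<^sub>R d \<in> interior \<K>" if t: "0 \<le> t" "t \<le> 1" for t
  proof (rule Dikin[OF x])
    show "local_norm B x (t *\<^sub>R d) < 1"
      using rt[OF t] t by (simp add: local_norm_eq quad_norm_scaleR r_def mult.commute)
  qed
  define q where "q t = u \<bullet> (hess B (x + t *\<^sub>R d) *v u)" for t
  define h where "h = (\<lambda>t. q t * (inverse (1 - r * t))\<^sup>2)"
  have "h 0 \<le> h 1"
  proof (rule DERIV_nonneg_imp_nondecreasing[of 0 1 h])
    fix t :: real assume t: "0 \<le> t" "t \<le> 1"
    let ?y = "x + t *\<^sub>R d" and ?i = "inverse (1 - r * t)"
    have i: "?i > 0" using rt[OF t] by simp
    have q0: "0 \<le> q t" unfolding q_def by (rule hess_nonneg[OF seg[OF t]])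
    have dq: "(q has_real_derivative third ?y u u d) (at t)"
      unfolding q_def by (rule hess_line_deriv[OF seg[OF t]])
    have "((\<lambda>t. 1 - r * t) has_real_derivative - r) (at t)"
      by (auto intro!: derivative_eq_intros)
    from DERIV_inverse'[OF this]
    have di: "((\<lambda>t. inverse (1 - r * t)) has_real_derivative ?i * r * ?i) (at t)"
      using rt[OF t] by simp
    have "((\<lambda>t. (inverse (1 - r * t))\<^sup>2) has_real_derivative 2 * ?i * (?i * r * ?i)) (at t)"
      using DERIV_power[OF di, of 2] by (simp add: mult_ac)
    from DERIV_mult[OF dq this]
    have dh: "(h has_real_derivative third ?y u u d * ?i\<^sup>2 + 2 * ?i * (?i * r * ?i) * q t) (at t)"
      unfolding h_def .
    have "(local_norm B ?y d)\<^sup>2 \<le> (r * ?i)\<^sup>2"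
      using hess_line_bound[of t x d] seg t rt[OF t]
      by (simp add: local_norm_sq[OF seg[OF t]] r_def divide_inverse)
    then have "local_norm B ?y d \<le> r * ?i"
      using r i by (simp add: abs_le_square_iff[symmetric] local_norm_nonneg[OF seg[OF t]])
    then have "2 * q t * local_norm B ?y d \<le> 2 * q t * (r * ?i)"
      using q0 by (intro mult_left_mono) auto
    then have "- third ?y u u d \<le> 2 * q t * (r * ?i)"
      using third_trilinear_bound[OF seg[OF t], of u d]
      by (simp add: local_norm_sq[OF seg[OF t]] q_def)
    then have "0 \<le> (third ?y u u d + 2 * q t * (r * ?i)) * ?i\<^sup>2"
      by (intro mult_nonneg_nonneg) auto
    then have "0 \<le> third ?y u u d * ?i\<^sup>2 + 2 * ?i * (?i * r * ?i) * q t"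
      by (simp add: algebra_simps power2_eq_square)
    with dh show "\<exists>y. (h has_real_derivative y) (at t) \<and> 0 \<le> y" by blast
  qed simp
  then have "(local_norm B x u)\<^sup>2 \<le> (1 / (1 - r) * local_norm B (x + d) u)\<^sup>2"
    using seg[of 1] x
    by (simp add: h_def q_def local_norm_sq power_mult_distrib divide_inverse mult.commute)
  then show ?thesis
    using r local_norm_nonneg[OF x] local_norm_nonneg[OF seg[of 1]]
    by (auto simp: r_def[symmetric] intro: power2_le_imp_le)
qed

lemma dual_norm_shift:
  assumes x: "x \<in> interior \<K>" and d: "local_norm B x d < 1"
  shows "dual_norm B (x + d) v \<le> 1 / (1 - local_norm B x d) * dual_norm B x v"
  unfolding dual_norm_eq
  using local_norm_shift[OF assms] d
  by (intro quad_norm_matrix_inv_le hess_pos_def x Dikin assms) (auto simp: local_norm_eq)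

text \<open>Two integrations along the segment. The first derivative gains r / (1 - r t) - r = r^2 t
  / (1 - r t), relaxed to a multiple of \<open>t\<close> so that the second integration gives a
  quadratic; this is the origin of 1 / (1 - s) in \<open>L_phi\<close>.\<close>

lemma B_upper_bound:
  assumes x: "x \<in> interior \<K>" and d: "local_norm B x d < 1"
  shows "B (x + d) \<le> B x + grad B x \<bullet> d + (local_norm B x d)\<^sup>2 / (2 * (1 - local_norm B x d))"
proof -
  define r where "r = local_norm B x d"
  have r: "0 \<le> r" "r < 1" using d local_norm_nonneg[OF x] by (simp_all add: r_def)
  have rt: "r * t < 1" "r * t \<le> r" if "0 \<le> t" "t \<le> 1" for t
    using r that mult_left_le[of t r] by simp_all
  have seg: "x + t *\<^sub>R d \<in> interior \<K>" if t: "0 \<le> t" "t \<le> 1" for t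
  proof (rule Dikin[OF x])
    show "local_norm B x (t *\<^sub>R d) < 1"
      using rt[OF t] t by (simp add: local_norm_eq quad_norm_scaleR r_def mult.commute)
  qed
  have first: "d \<bullet> grad B (x + t *\<^sub>R d) \<le> d \<bullet> grad B x + r\<^sup>2 / (1 - r) * t" if t: "0 \<le> t" "t \<le> 1" for t
  proof -
    define h where "h = (\<lambda>t. d \<bullet> grad B (x + t *\<^sub>R d) - r * inverse (1 - r * t))"
    have "h 0 \<ge> h t"
    proof (rule DERIV_nonpos_imp_nonincreasing[OF t(1)])
      fix s assume "0 \<le> s" "s \<le> t"
      then have s: "0 \<le> s" "s \<le> 1" using t by auto
      let ?i = "inverse (1 - r * s)"
      have "((\<lambda>t. 1 - r * t) has_real_derivative - r) (at s)"
        by (auto intro!: derivative_eq_intros)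
      from DERIV_inverse'[OF this]
      have "((\<lambda>t. inverse (1 - r * t)) has_real_derivative ?i * r * ?i) (at s)"
        using rt[OF s] by simp
      from DERIV_diff[OF grad_line_deriv[OF seg[OF s]] DERIV_cmult[OF this, of r]]
      have dh: "(h has_real_derivative d \<bullet> (hess B (x + s *\<^sub>R d) *v d) - r * (?i * r * ?i)) (at s)"
        unfolding h_def .
      have "d \<bullet> (hess B (x + s *\<^sub>R d) *v d) \<le> (r / (1 - r * s))\<^sup>2"
        unfolding r_def using s rt[OF s] seg by (intro hess_line_bound) (auto simp: r_def)
      then have "d \<bullet> (hess B (x + s *\<^sub>R d) *v d) - r * (?i * r * ?i) \<le> 0"
        by (simp add: divide_inverse power2_eq_square mult_ac)
      with dh show "\<exists>y. (h has_real_derivative y) (at s) \<and> y \<le> 0" by blast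
    qed
    then have "d \<bullet> grad B (x + t *\<^sub>R d) \<le> d \<bullet> grad B x + (r * inverse (1 - r * t) - r)"
      by (simp add: h_def)
    also have "r * inverse (1 - r * t) - r = r\<^sup>2 * t / (1 - r * t)"
      using rt[OF t] by (simp add: field_simps power2_eq_square)
    also have "\<dots> \<le> r\<^sup>2 * t / (1 - r)"
      using rt[OF t] r t by (intro divide_left_mono mult_pos_pos) auto
    finally show ?thesis by simp
  qed
  define c where "c = r\<^sup>2 / (1 - r)"
  define h where "h = (\<lambda>t. B (x + t *\<^sub>R d) - (d \<bullet> grad B x) * t - c * (t\<^sup>2 / 2))"
  have "h 0 \<ge> h 1"
  proof (rule DERIV_nonpos_imp_nonincreasing[of 0 1 h])
    fix t :: real assume t: "0 \<le> t" "t \<le> 1"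
    have "(h has_real_derivative d \<bullet> grad B (x + t *\<^sub>R d) - d \<bullet> grad B x - c * t) (at t)"
      unfolding h_def by (auto intro!: derivative_eq_intros B_line_deriv seg t)
    then show "\<exists>y. (h has_real_derivative y) (at t) \<and> y \<le> 0"
      using first[OF t] by (force simp: c_def)
  qed simp
  then show ?thesis by (simp add: h_def c_def r_def inner_commute mult.commute)
qed

end

section \<open>One step of the method\<close>

locale sipm = sc_barrier \<K> \<theta> B
  for \<K> :: "(real^'n) set" and \<theta> :: real and B :: "real^'n \<Rightarrow> real" +
  fixes A :: "real^'n^'m" and b :: "real^'m" and f :: "real^'n \<Rightarrow> real"
    and s L \<phi>low :: real
  assumes full_row_rank: "rank A = CARD('m)"
    and f_C1: "cont_diff_on 1 (feasible A b \<K>) f"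
    and s: "0 < s" "s < 1"
    and L_pos: "L > 0"
    and Lipschitz: "\<And>y z. y \<in> strictly_feasible A b \<K> \<Longrightarrow> z \<in> strictly_feasible A b \<K> \<Longrightarrow>
      local_norm B y (z - y) \<le> s \<Longrightarrow>
      dual_norm B y (grad f z - grad f y) \<le> L * local_norm B y (z - y)"
    and phi_low: "\<And>y \<nu>. y \<in> strictly_feasible A b \<K> \<Longrightarrow> 0 < \<nu> \<Longrightarrow> \<nu> \<le> 1 \<Longrightarrow> \<phi>low \<le> f y + \<nu> * B y"
begin

abbreviation S where "S \<equiv> strictly_feasible A b \<K>"

lemma S_interior: "y \<in> S \<Longrightarrow> y \<in> interior \<K>"
  by (simp add: strictly_feasible_def)

lemma S_feasible: "S \<subseteq> feasible A b \<K>"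
  using interior_subset by (auto simp: strictly_feasible_def feasible_def)

lemma f_differentiable: "y \<in> S \<Longrightarrow> f differentiable (at y)"
  using f_C1 S_feasible by auto

lemma continuous_on_grad_f: "continuous_on S (grad f)"
proof -
  have "continuous_on S (\<lambda>y. grad f y $ i)" for i
    using f_C1 S_feasible by (auto intro: continuous_on_subset)
  then have "continuous_on S (\<lambda>y. \<chi> i. grad f y $ i)"
    by (intro continuous_on_vec_lambda)
  then show ?thesis by simp
qed

lemma dual_nonneg: "y \<in> S \<Longrightarrow> 0 \<le> dual_norm B y v"
  by (simp add: dual_norm_eq quad_norm_nonneg hess_inv_pos_def S_interior)

lemma dual_triangle: "y \<in> S \<Longrightarrow> dual_norm B y (u + v) \<le> dual_norm B y u + dual_norm B y v"
  by (simp add: dual_norm_eq quad_norm_triangle hess_inv_pos_def S_interior)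

lemma dual_scaleR: "dual_norm B y (c *\<^sub>R v) = \<bar>c\<bar> * dual_norm B y v"
  by (simp add: dual_norm_eq quad_norm_scaleR)

lemma dual_commute: "dual_norm B y (u - v) = dual_norm B y (v - u)"
  using quad_norm_minus[of "matrix_inv (hess B y)" "u - v"] by (simp add: dual_norm_eq)

lemma dual_pairing: "y \<in> S \<Longrightarrow> v \<bullet> u \<le> dual_norm B y v * local_norm B y u"
  using quad_norm_duality[OF hess_pos_def[OF S_interior], of y v u]
  by (simp add: dual_norm_eq local_norm_eq)

lemma feasible_step:
  assumes "y \<in> S" "A *v d = 0" "local_norm B y d < 1"
  shows "y + d \<in> S"
  using assms Dikin[OF S_interior] by (simp add: strictly_feasible_def matrix_vector_right_distrib)

text \<open>The descent lemma with every norm taken at \<open>y\<close>: the Lipschitz hypothesis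
  compares \<open>y\<close> with y + t d, and the segment stays strictly feasible because
  \<open>d\<close> lies in the kernel of \<open>A\<close> and in a Dikin ball.\<close>

lemma f_upper_bound:
  assumes y: "y \<in> S" and Ad: "A *v d = 0" and d: "local_norm B y d \<le> s"
  shows "f (y + d) \<le> f y + grad f y \<bullet> d + L / 2 * (local_norm B y d)\<^sup>2"
proof -
  define r where "r = local_norm B y d"
  have r: "0 \<le> r" "r \<le> s" using d local_norm_nonneg[OF S_interior[OF y]] by (simp_all add: r_def)
  define h where "h = (\<lambda>t. f (y + t *\<^sub>R d) - (grad f y \<bullet> d) * t - L * r\<^sup>2 * (t\<^sup>2 / 2))"
  have "h 0 \<ge> h 1"
  proof (rule DERIV_nonpos_imp_nonincreasing[of 0 1 h])
    fix t :: real assume t: "0 \<le> t" "t \<le> 1"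
    have nt: "local_norm B y (t *\<^sub>R d) = t * r"
      using t by (simp add: local_norm_eq quad_norm_scaleR r_def)
    have tr: "t * r \<le> s" using t r mult_right_le_one_le[of r t] by (simp add: mult.commute)
    have seg: "y + t *\<^sub>R d \<in> S"
      using y Ad nt tr s by (intro feasible_step) (auto simp: matrix_vector_mult_scaleR)
    have dh: "(h has_real_derivative grad f (y + t *\<^sub>R d) \<bullet> d - grad f y \<bullet> d - L * r\<^sup>2 * t) (at t)"
      unfolding h_def
      by (auto intro!: derivative_eq_intros has_real_derivative_line f_differentiable seg)
    have "(grad f (y + t *\<^sub>R d) - grad f y) \<bullet> d \<le> dual_norm B y (grad f (y + t *\<^sub>R d) - grad f y) * r"
      unfolding r_def by (rule dual_pairing[OF y])
    also have "\<dots> \<le> L * (t * r) * r"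
      using Lipschitz[OF y seg] nt tr r by (intro mult_right_mono) auto
    finally have "grad f (y + t *\<^sub>R d) \<bullet> d - grad f y \<bullet> d - L * r\<^sup>2 * t \<le> 0"
      by (simp add: inner_diff_left power2_eq_square mult_ac)
    with dh show "\<exists>x. (h has_real_derivative x) (at t) \<and> x \<le> 0" by blast
  qed simp
  then show ?thesis by (simp add: h_def r_def)
qed

lemma phi_has_derivative:
  assumes "y \<in> S"
  shows "(phi f B \<nu> has_derivative (\<lambda>h. ((1 + \<nu>) *\<^sub>R grad f y + \<nu> *\<^sub>R grad B y) \<bullet> h)) (at y)"
proof -
  have "((\<lambda>x. f x + \<nu> * (f x + B x)) has_derivative
      (\<lambda>h. grad f y \<bullet> h + \<nu> * (grad f y \<bullet> h + grad B y \<bullet> h))) (at y)"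
    using assms
    by (intro has_derivative_add has_derivative_mult_right has_derivative_grad f_differentiable
        B_differentiable S_interior)
  then show ?thesis
    by (simp add: phi_def[abs_def] inner_add_left algebra_simps)
qed

lemma grad_phi:
  assumes "y \<in> S"
  shows "grad (phi f B \<nu>) y = (1 + \<nu>) *\<^sub>R grad f y + \<nu> *\<^sub>R grad B y"
  using phi_has_derivative[OF assms] by (rule grad_eqI)

text \<open>The factor 1 + \<nu> \<le> 2 in front of \<open>f\<close> accounts for 2 L in
  \<open>L_phi\<close>, the factor \<nu> \<le> 1 in front of \<open>B\<close> for 1 / (1 -
  s).\<close>

lemma phi_upper_bound:
  assumes y: "y \<in> S" and Ad: "A *v d = 0" and d: "local_norm B y d \<le> e" and e: "e \<le> s"
    and \<nu>: "0 < \<nu>" "\<nu> \<le> 1"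
  shows "phi f B \<nu> (y + d) \<le> phi f B \<nu> y + grad (phi f B \<nu>) y \<bullet> d + L_phi L s / 2 * e\<^sup>2"
proof -
  define r where "r = local_norm B y d"
  have r: "0 \<le> r" "r \<le> e" "r \<le> s" "r < 1"
    using d e s local_norm_nonneg[OF S_interior[OF y]] by (simp_all add: r_def)
  have r2: "r\<^sup>2 \<le> e\<^sup>2" using r by (simp add: power_mono)
  have "f (y + d) \<le> f y + grad f y \<bullet> d + L / 2 * r\<^sup>2"
    unfolding r_def using y Ad r by (intro f_upper_bound) (auto simp: r_def)
  also have "\<dots> \<le> f y + grad f y \<bullet> d + L / 2 * e\<^sup>2"
    using r2 L_pos by simp
  finally have 1: "(1 + \<nu>) * (f (y + d) - f y - grad f y \<bullet> d) \<le> (1 + \<nu>) * (L / 2 * e\<^sup>2)"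
    using \<nu> by (intro mult_left_mono) auto
  have "(1 + \<nu>) * (L / 2 * e\<^sup>2) \<le> 2 * (L / 2 * e\<^sup>2)"
    using \<nu> L_pos by (intro mult_right_mono) auto
  with 1 have 1: "(1 + \<nu>) * (f (y + d) - f y - grad f y \<bullet> d) \<le> L * e\<^sup>2" by simp
  have "B (y + d) \<le> B y + grad B y \<bullet> d + r\<^sup>2 / (2 * (1 - r))"
    using B_upper_bound[OF S_interior[OF y], of d] r by (simp add: r_def)
  also have "r\<^sup>2 / (2 * (1 - r)) \<le> e\<^sup>2 / (2 * (1 - s))"
    using r r2 s by (intro frac_le) auto
  finally have "\<nu> * (B (y + d) - B y - grad B y \<bullet> d) \<le> \<nu> * (e\<^sup>2 / (2 * (1 - s)))"
    using \<nu> by (intro mult_left_mono) auto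
  also have "\<dots> \<le> e\<^sup>2 / (2 * (1 - s))"
    using \<nu> s by (intro mult_left_le_one_le) auto
  finally have 2: "\<nu> * (B (y + d) - B y - grad B y \<bullet> d) \<le> e\<^sup>2 / (2 * (1 - s))" .
  have "L_phi L s / 2 * e\<^sup>2 = L * e\<^sup>2 + e\<^sup>2 / (2 * (1 - s))"
    using s by (simp add: L_phi_def field_simps)
  with 2 obtain c where c: "L_phi L s / 2 * e\<^sup>2 = L * e\<^sup>2 + c"
    "\<nu> * (B (y + d) - B y - grad B y \<bullet> d) \<le> c" by blast
  show ?thesis
    unfolding c(1) using 1 c(2) by (simp add: phi_def grad_phi[OF y] inner_add_left algebra_simps)
qed

text \<open>From here on the state of the method is the pair of a point \<open>y\<close> and a
  momentum vector \<open>v\<close>; the vectors \<open>m\<close>, \<open>lam\<close> and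
  \<open>m + transpose A *v lam\<close> of a run become functions of this pair.\<close>

definition regularized :: "real \<Rightarrow> real^'n \<Rightarrow> real^'n \<Rightarrow> real^'n" where
  "regularized \<nu> y v = v + \<nu> *\<^sub>R (v + grad B y)"

definition multiplier :: "real \<Rightarrow> real^'n \<Rightarrow> real^'n \<Rightarrow> real^'m" where
  "multiplier \<nu> y v = - (matrix_inv (A ** matrix_inv (hess B y) ** transpose A) *v
     (A *v (matrix_inv (hess B y) *v regularized \<nu> y v)))"

definition direction :: "real \<Rightarrow> real^'n \<Rightarrow> real^'n \<Rightarrow> real^'n" where
  "direction \<nu> y v = regularized \<nu> y v + transpose A *v multiplier \<nu> y v"

definition step :: "real \<Rightarrow> real \<Rightarrow> real^'n \<Rightarrow> real^'n \<Rightarrow> real^'n" where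
  "step e \<nu> y v = y - (e / dual_norm B y (direction \<nu> y v)) *\<^sub>R
     (matrix_inv (hess B y) *v direction \<nu> y v)"

context
  fixes y v :: "real^'n" and e \<nu> :: real
  assumes y: "y \<in> S" and e: "0 \<le> e" "e \<le> s" and \<nu>: "0 < \<nu>" "\<nu> \<le> 1"
begin

private abbreviation (input) "g \<equiv> direction \<nu> y v"
private abbreviation (input) "H \<equiv> matrix_inv (hess B y)"
private abbreviation (input) "d \<equiv> step e \<nu> y v - y"

lemma step_eq: "d = - (e / dual_norm B y g) *\<^sub>R (H *v g)"
  by (simp add: step_def)

text \<open>The multiplier solves (A H A^T) lam = - A H m, which says that A H annihilates the
  direction; so the step preserves the equality constraints.\<close>

lemma step_kernel: "A *v d = 0"
proof -
  let ?M = "A ** H ** transpose A"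
  have inv: "invertible ?M"
    by (intro invertible_congruence full_row_rank hess_inv_pos_def S_interior y)
  have "A *v (H *v (transpose A *v w)) = ?M *v w" for w
    by (simp only: matrix_vector_mul_assoc matrix_mul_assoc)
  then have "A *v (H *v (transpose A *v multiplier \<nu> y v)) = ?M *v multiplier \<nu> y v" .
  also have "\<dots> = - ((?M ** matrix_inv ?M) *v (A *v (H *v regularized \<nu> y v)))"
    using matrix_vector_mult_scaleR[of ?M "-1"]
    by (simp add: multiplier_def matrix_vector_mul_assoc matrix_mul_assoc)
  also have "\<dots> = - (A *v (H *v regularized \<nu> y v))"
    by (simp add: matrix_inv_mult[OF inv])
  finally have "A *v (H *v g) = 0"
    by (simp add: direction_def matrix_vector_right_distrib del: transpose_matrix_vector)
  then show ?thesis
    unfolding step_eq by (simp add: matrix_vector_mult_scaleR del: scaleR_minus_left)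
qed

lemma step_norm: "local_norm B y d \<le> e"
proof -
  have "local_norm B y d = \<bar>e / dual_norm B y g\<bar> * dual_norm B y g"
    unfolding step_eq local_norm_eq quad_norm_scaleR
    by (simp add: dual_norm_eq quad_norm_matrix_inv hess_pos_def S_interior y)
  then show ?thesis
    using e dual_nonneg[OF y, of g] by (cases "dual_norm B y g = 0") auto
qed

lemma step_feasible: "step e \<nu> y v \<in> S"
  using feasible_step[OF y step_kernel] step_norm e s by simp

lemma direction_step: "g \<bullet> d = - e * dual_norm B y g"
proof -
  have "g \<bullet> d = - (e / dual_norm B y g) * (dual_norm B y g)\<^sup>2"
    unfolding step_eq dual_norm_eq
    by (simp add: quad_norm_sq[OF hess_inv_pos_def[OF S_interior[OF y]]])
  then show ?thesis by (cases "dual_norm B y g = 0") (auto simp: power2_eq_square)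
qed

text \<open>The true gradient differs from \<open>regularized\<close> by (1 + \<nu>) (grad f - v),
  at most twice the momentum error. This is paid for twice, in the inner product with the step and
  when the norm of the direction is replaced by the residual; hence the 4.\<close>

lemma descent:
  "phi f B \<nu> (step e \<nu> y v) \<le> phi f B \<nu> y
     - e * dual_norm B y (grad (phi f B \<nu>) y + transpose A *v multiplier \<nu> y v)
     + 4 * e * dual_norm B y (v - grad f y) + L_phi L s / 2 * e\<^sup>2"
proof -
  let ?a = "grad (phi f B \<nu>) y - regularized \<nu> y v"
  let ?R = "dual_norm B y (grad (phi f B \<nu>) y + transpose A *v multiplier \<nu> y v)"
  have "?a = (1 + \<nu>) *\<^sub>R (grad f y - v)"
    by (simp add: grad_phi[OF y] regularized_def algebra_simps)
  then have "dual_norm B y ?a = (1 + \<nu>) * dual_norm B y (v - grad f y)"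
    using \<nu> by (simp add: dual_scaleR dual_commute[of y "grad f y"])
  also have "\<dots> \<le> 2 * dual_norm B y (v - grad f y)"
    using \<nu> dual_nonneg[OF y] by (intro mult_right_mono) auto
  finally have a: "dual_norm B y ?a \<le> 2 * dual_norm B y (v - grad f y)" .
  have "(transpose A *v multiplier \<nu> y v) \<bullet> d = 0"
    by (simp add: dot_lmul_matrix step_kernel)
  then have "grad (phi f B \<nu>) y \<bullet> d = g \<bullet> d + ?a \<bullet> d"
    by (simp add: direction_def inner_add_left inner_diff_left del: transpose_matrix_vector)
  also have "?a \<bullet> d \<le> dual_norm B y ?a * e"
    using dual_pairing[OF y, of ?a d] mult_left_mono[OF step_norm dual_nonneg[OF y, of ?a]] by linarith
  finally have inner: "grad (phi f B \<nu>) y \<bullet> d \<le> - e * dual_norm B y g + e * dual_norm B y ?a"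
    by (simp add: direction_step mult.commute)
  have "?R = dual_norm B y (g + ?a)"
    by (simp add: direction_def add.commute del: transpose_matrix_vector)
  also have "\<dots> \<le> dual_norm B y g + dual_norm B y ?a" by (rule dual_triangle[OF y])
  finally have "e * ?R \<le> e * dual_norm B y g + e * dual_norm B y ?a"
    using mult_left_mono[OF _ e(1)] by (metis distrib_left)
  moreover have "e * dual_norm B y ?a \<le> e * (2 * dual_norm B y (v - grad f y))"
    by (rule mult_left_mono[OF a e(1)])
  moreover have "phi f B \<nu> (y + d) \<le> phi f B \<nu> y + grad (phi f B \<nu>) y \<bullet> d + L_phi L s / 2 * e\<^sup>2"
    by (rule phi_upper_bound[OF y step_kernel step_norm e(2) \<nu>])
  ultimately show ?thesis using inner by simp
qed

text \<open>Moving the norm to the new point costs 1 / (1 - e), and (1 - \<gamma>) / (1 - e) is 1 -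
  \<alpha>, which explains the form of \<alpha>; e < \<gamma> is what makes it a contraction. The
  change of the gradient adds a = L e to the error.\<close>

lemma momentum_drift:
  assumes \<gamma>: "e < \<gamma>" "\<gamma> \<le> 1"
  defines "\<alpha> \<equiv> (\<gamma> - e) / (1 - e)"
  shows "((1 - \<gamma>) * dual_norm B (step e \<nu> y v) (v - grad f (step e \<nu> y v)))\<^sup>2
    \<le> (1 - \<alpha>) * (dual_norm B y (v - grad f y))\<^sup>2 + L\<^sup>2 * e\<^sup>2 / \<alpha>"
proof -
  let ?y' = "step e \<nu> y v"
  define E where "E = dual_norm B y (v - grad f y)"
  have E: "0 \<le> E" by (simp add: E_def dual_nonneg[OF y])
  define a where "a = L * e"
  have a: "0 \<le> a" using L_pos e by (simp add: a_def)
  have e1: "e < 1" using e s by simp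
  have \<alpha>: "0 < \<alpha>" "\<alpha> \<le> 1" using \<gamma> e1 by (simp_all add: \<alpha>_def)
  define r where "r = local_norm B y d"
  have r: "r \<le> e" using step_norm by (simp add: r_def)
  have "dual_norm B (y + d) (v - grad f ?y') \<le> 1 / (1 - r) * dual_norm B y (v - grad f ?y')"
    unfolding r_def using r e1 by (intro dual_norm_shift S_interior y) (simp add: r_def)
  also have "\<dots> \<le> 1 / (1 - e) * dual_norm B y (v - grad f ?y')"
    using r e1 dual_nonneg[OF y] by (intro mult_right_mono frac_le) auto
  also have "dual_norm B y (v - grad f ?y') \<le> E + a"
  proof -
    have "dual_norm B y (v - grad f ?y') \<le> E + dual_norm B y (grad f y - grad f ?y')"
      using dual_triangle[OF y, of "v - grad f y" "grad f y - grad f ?y'"] by (simp add: E_def)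
    also have "dual_norm B y (grad f y - grad f ?y') \<le> L * r"
      using Lipschitz[OF y step_feasible] r e by (simp add: dual_commute[of y "grad f y"] r_def)
    also have "L * r \<le> a" using r L_pos by (simp add: a_def)
    finally show ?thesis by simp
  qed
  finally have bd: "dual_norm B ?y' (v - grad f ?y') \<le> 1 / (1 - e) * (E + a)"
    using e1 by (simp add: divide_right_mono)
  have "(1 - \<gamma>) * dual_norm B ?y' (v - grad f ?y') \<le> (1 - \<gamma>) * (1 / (1 - e) * (E + a))"
    using bd \<gamma> by (intro mult_left_mono) auto
  also have "\<dots> = (1 - \<alpha>) * (E + a)"
    using e1 by (simp add: \<alpha>_def field_simps)
  finally have "((1 - \<gamma>) * dual_norm B ?y' (v - grad f ?y'))\<^sup>2 \<le> ((1 - \<alpha>) * (E + a))\<^sup>2"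
    using \<gamma> dual_nonneg[OF step_feasible] by (intro power_mono) auto
  also have "\<dots> \<le> (1 - \<alpha>) * E\<^sup>2 + a\<^sup>2 / \<alpha>"
  proof -
    \<comment> \<open>Young's inequality in exact form: this square is the slack between the two
      sides, apart from the factor (1 - \<alpha>)^2 \<le> 1 in front of a^2.\<close>
    have "(1 - \<alpha>) * (\<alpha> * E - (1 - \<alpha>) * a)\<^sup>2 \<ge> 0" using \<alpha> by simp
    moreover have "(1 - \<alpha>)\<^sup>2 * a\<^sup>2 \<le> a\<^sup>2"
      using \<alpha> by (intro mult_left_le_one_le) (auto simp: power_le_one)
    moreover have "\<alpha> * ((1 - \<alpha>) * (E + a))\<^sup>2 + (1 - \<alpha>) * (\<alpha> * E - (1 - \<alpha>) * a)\<^sup>2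
        = \<alpha> * ((1 - \<alpha>) * E\<^sup>2) + (1 - \<alpha>)\<^sup>2 * a\<^sup>2"
      by (simp add: power2_eq_square algebra_simps)
    ultimately have "\<alpha> * ((1 - \<alpha>) * (E + a))\<^sup>2 \<le> \<alpha> * ((1 - \<alpha>) * E\<^sup>2) + a\<^sup>2" by linarith
    then show ?thesis using \<alpha> by (simp add: field_simps)
  qed
  finally show ?thesis by (simp add: E_def a_def power_mult_distrib)
qed

end

text \<open>The difference is (\<nu> - \<nu>') (f + B), and f + B is bounded below by
  \<open>phi_low\<close> at weight 1.\<close>

lemma phi_barrier_change:
  assumes "y \<in> S" "\<nu>' \<le> \<nu>"
  shows "phi f B \<nu>' y \<le> phi f B \<nu> y - (\<nu> - \<nu>') * min \<phi>low 0"
proof -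
  have "(\<nu> - \<nu>') * min \<phi>low 0 \<le> (\<nu> - \<nu>') * (f y + B y)"
    using phi_low[OF assms(1), of 1] assms(2) by (intro mult_left_mono) auto
  then show ?thesis by (simp add: phi_def algebra_simps)
qed

text \<open>Dividing by 1 + \<nu> leaves f + \<nu> / (1 + \<nu>) B, whose barrier weight again lies
  in (0, 1].\<close>

lemma phi_lower_bound:
  assumes "y \<in> S" "0 < \<nu>" "\<nu> \<le> 1"
  shows "(1 + \<nu>) * min \<phi>low 0 \<le> phi f B \<nu> y"
proof -
  have "\<phi>low \<le> f y + \<nu> / (1 + \<nu>) * B y"
    using assms by (intro phi_low) auto
  then have "(1 + \<nu>) * min \<phi>low 0 \<le> (1 + \<nu>) * (f y + \<nu> / (1 + \<nu>) * B y)"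
    using assms by (intro mult_left_mono) auto
  also have "\<dots> = phi f B \<nu> y"
    using assms by (simp add: phi_def field_simps)
  finally show ?thesis .
qed

lemma Delta_nonneg:
  assumes "y \<in> S"
  shows "0 \<le> Delta f B \<phi>low y"
  using phi_lower_bound[OF assms, of 1] by (simp add: Delta_def phi_def)

text \<open>Write p = min \<phi>low 0. Lowering the barrier parameter costs -(\<mu> 0 - \<mu> K) p
  and the final lower bound is (1 + \<mu> K) p; together this is -(1 + \<mu> 0) p \<le> -2 p, as p
  \<le> 0. With \<mu> 0 (f + B) \<le> max (f + B) 0 this yields the three terms of
  \<open>Delta\<close>.\<close>

lemma total_descent:
  assumes y: "\<And>k. y k \<in> S" and step: "\<And>k. y (Suc k) = step (\<eta> k) (\<mu> k) (y k) (v k)"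
    and \<eta>: "\<And>k. 0 \<le> \<eta> k" "\<And>k. \<eta> k \<le> s"
    and \<mu>: "\<And>k. 0 < \<mu> k" "\<And>k. \<mu> k \<le> 1" "\<And>k. \<mu> (Suc k) \<le> \<mu> k"
  shows "(\<Sum>k<K. \<eta> k * dual_norm B (y k) (grad (phi f B (\<mu> k)) (y k) + transpose A *v multiplier (\<mu> k) (y k) (v k)))
    \<le> Delta f B \<phi>low (y 0) + (\<Sum>k<K. 4 * \<eta> k * dual_norm B (y k) (v k - grad f (y k)) + L_phi L s / 2 * (\<eta> k)\<^sup>2)"
    (is "(\<Sum>k<K. \<eta> k * ?R k) \<le> _ + (\<Sum>k<K. ?c k)")
proof -
  let ?p = "min \<phi>low 0"
  have "phi f B (\<mu> K) (y K) + (\<Sum>k<K. \<eta> k * ?R k)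
      \<le> phi f B (\<mu> 0) (y 0) - (\<mu> 0 - \<mu> K) * ?p + (\<Sum>k<K. ?c k)"
  proof (induction K)
    case (Suc K)
    have "phi f B (\<mu> (Suc K)) (y (Suc K)) \<le> phi f B (\<mu> K) (y (Suc K)) - (\<mu> K - \<mu> (Suc K)) * ?p"
      by (rule phi_barrier_change[OF y \<mu>(3)])
    also have "phi f B (\<mu> K) (y (Suc K)) \<le> phi f B (\<mu> K) (y K) - \<eta> K * ?R K + ?c K"
      using descent[OF y \<eta> \<mu>(1,2), of K K K "v K"] by (simp add: step del: transpose_matrix_vector)
    finally show ?case using Suc by (simp add: algebra_simps)
  qed simp
  moreover have "(1 + \<mu> K) * ?p \<le> phi f B (\<mu> K) (y K)"
    by (rule phi_lower_bound[OF y \<mu>(1,2)])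
  moreover have "2 * ?p \<le> (\<mu> 0 + 1) * ?p"
    using \<mu>(2)[of 0] by (intro mult_right_mono_neg) auto
  moreover have "\<mu> 0 * (f (y 0) + B (y 0)) \<le> max (f (y 0) + B (y 0)) 0"
    using \<mu>(1,2)[of 0] by (cases "f (y 0) + B (y 0) \<ge> 0")
      (auto intro: mult_left_le_one_le simp: max_def mult_nonneg_nonpos)
  ultimately show ?thesis
    by (simp add: Delta_def phi_def algebra_simps)
qed

end

section \<open>Measurability\<close>

text \<open>\<open>matrix_inv\<close> is defined by a choice; Cramer's rule displays it as a
  rational function of the entries, from which continuity and then measurability follow.\<close>

lemma matrix_inv_cramer:
  fixes M :: "real^'n^'n"
  assumes "invertible M"
  shows "matrix_inv M = (\<chi> i j. det (\<chi> a c. if c = i then axis j 1 $ a else M $ a $ c) / det M)"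
proof -
  have "matrix_inv M $ i $ j = det (\<chi> a c. if c = i then axis j 1 $ a else M $ a $ c) / det M" for i j
  proof -
    have "det M \<noteq> 0" using assms by (simp add: invertible_det_nz)
    moreover have "M *v (matrix_inv M *v axis j 1) = axis j 1"
      by (simp add: matrix_vector_mul_assoc matrix_inv_mult[OF assms])
    ultimately have "matrix_inv M *v axis j 1
        = (\<chi> k. det (\<chi> a c. if c = k then axis j 1 $ a else M $ a $ c) / det M)"
      by (rule iffD1[OF cramer])
    from arg_cong[OF this, of "\<lambda>v. v $ i"] show ?thesis
      by (simp add: matrix_vector_mult_basis column_def)
  qed
  then show ?thesis by (simp add: vec_eq_iff)
qed

lemma continuous_on_det:
  fixes F :: "'a::topological_space \<Rightarrow> real^'n^'n"
  assumes "\<And>i j. continuous_on X (\<lambda>y. F y $ i $ j)"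
  shows "continuous_on X (\<lambda>y. det (F y))"
  unfolding det_def by (intro continuous_on_sum continuous_on_mult continuous_on_const continuous_on_prod assms)

lemma continuous_on_matrix_inv:
  fixes F :: "'a::topological_space \<Rightarrow> real^'n^'n"
  assumes F: "continuous_on X F" and inv: "\<And>y. y \<in> X \<Longrightarrow> invertible (F y)"
  shows "continuous_on X (\<lambda>y. matrix_inv (F y))"
proof -
  have entry: "continuous_on X (\<lambda>y. F y $ i $ j)" for i j
    using F by (intro continuous_intros)
  have "continuous_on X (\<lambda>y. \<chi> i j. det (\<chi> a c. if c = i then axis j 1 $ a else F y $ a $ c) / det (F y))"
  proof (intro continuous_on_vec_lambda continuous_on_divide continuous_on_det ballI)
    show "continuous_on X (\<lambda>y. (\<chi> a c. if c = i then axis j 1 $ a else F y $ a $ c) $ i' $ j')" for i j i' j'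
      using entry by (cases "j' = i") auto
    show "det (F y) \<noteq> 0" if "y \<in> X" for y
      using inv[OF that] by (simp add: invertible_det_nz)
  qed (rule entry)
  then show ?thesis
    by (rule continuous_on_eq) (simp add: matrix_inv_cramer inv)
qed

lemma continuous_on_matrix_mult:
  fixes F :: "'a::topological_space \<Rightarrow> real^'n^'m" and M :: "'a \<Rightarrow> real^'p^'n"
  assumes "continuous_on X F" "continuous_on X M"
  shows "continuous_on X (\<lambda>y. F y ** M y)"
  unfolding matrix_matrix_mult_def using assms
  by (intro continuous_on_vec_lambda continuous_intros)

lemma borel_measurable_matrix_vector_mult [measurable (raw)]:
  fixes F :: "'a \<Rightarrow> real^'n^'m" and v :: "'a \<Rightarrow> real^'n"
  assumes "F \<in> borel_measurable N" "v \<in> borel_measurable N"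
  shows "(\<lambda>w. F w *v v w) \<in> borel_measurable N"
  using assms
  by (rule borel_measurable_continuous_Pair)
    (auto simp: matrix_vector_mult_def intro!: continuous_on_vec_lambda continuous_intros)

section \<open>The stochastic method\<close>

text \<open>The parameter sequences stay general here; \<eta> k < \<gamma> k makes the contraction
  rate positive. \<open>D\<close> is the law of one sample, while \<open>P\<close> carries all the
  randomness, including the random index.\<close>

locale stochastic_sipm = sipm \<K> \<theta> B A b f s L \<phi>low + D: prob_space D + P: prob_space P
  for \<K> :: "(real^'n) set" and \<theta> :: real and B :: "real^'n \<Rightarrow> real"
    and A :: "real^'n^'m" and b :: "real^'m" and f :: "real^'n \<Rightarrow> real" and s L \<phi>low :: real
    and D :: "'b measure" and P :: "'w measure" +
  fixes G :: "real^'n \<Rightarrow> 'b \<Rightarrow> real^'n" and \<sigma> :: real and \<xi> :: "nat \<Rightarrow> 'w \<Rightarrow> 'b"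
    and x0 :: "real^'n" and \<eta> \<gamma> \<mu> :: "nat \<Rightarrow> real"
  assumes G_measurable: "(\<lambda>(y, z). G y z) \<in>
      restrict_space borel (strictly_feasible A b \<K>) \<Otimes>\<^sub>M D \<rightarrow>\<^sub>M borel"
    and G_unbiased: "\<And>y. y \<in> strictly_feasible A b \<K> \<Longrightarrow> integrable D (G y)"
      "\<And>y. y \<in> strictly_feasible A b \<K> \<Longrightarrow> integral\<^sup>L D (G y) = grad f y"
    and G_variance: "\<And>y. y \<in> strictly_feasible A b \<K> \<Longrightarrow>
        integrable D (\<lambda>z. (dual_norm B y (G y z - grad f y))\<^sup>2)"
      "\<And>y. y \<in> strictly_feasible A b \<K> \<Longrightarrow>
        (\<integral>z. (dual_norm B y (G y z - grad f y))\<^sup>2 \<partial>D) \<le> \<sigma>\<^sup>2"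
    and xi_indep: "P.indep_vars (\<lambda>_. D) \<xi> UNIV"
    and xi_distr: "\<And>k. distr P D (\<xi> k) = D"
    and x0: "x0 \<in> strictly_feasible A b \<K>"
    and \<eta>: "\<And>k. 0 < \<eta> k" "\<And>k. \<eta> k \<le> s"
    and \<gamma>: "\<And>k. \<eta> k < \<gamma> k" "\<And>k. \<gamma> k \<le> 1"
    and \<mu>: "\<And>k. 0 < \<mu> k" "\<And>k. \<mu> k \<le> 1" "\<And>k. \<mu> (Suc k) \<le> \<mu> k"
begin

text \<open>Gradients, inverse Hessians and \<open>G\<close> are regular on \<open>S\<close> only,
  so iterates are treated as measurable maps into the trace of the Borel sets on
  \<open>S\<close>.\<close>

abbreviation borel_S where "borel_S \<equiv> restrict_space borel S"

lemma G_measurable' [measurable]: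
  "Y \<in> N \<rightarrow>\<^sub>M borel_S \<Longrightarrow> Z \<in> N \<rightarrow>\<^sub>M D \<Longrightarrow> (\<lambda>w. G (Y w) (Z w)) \<in> borel_measurable N"
  using measurable_compose[OF measurable_Pair G_measurable] by simp

lemma borel_S_borel: "Y \<in> N \<rightarrow>\<^sub>M borel_S \<Longrightarrow> Y \<in> borel_measurable N"
  by (simp add: measurable_restrict_space2_iff)

lemma continuous_compose_borel_S:
  "continuous_on S h \<Longrightarrow> Y \<in> N \<rightarrow>\<^sub>M borel_S \<Longrightarrow> (\<lambda>w. h (Y w)) \<in> borel_measurable N"
  by (rule measurable_compose[OF _ borel_measurable_continuous_on_restrict])

lemma S_subset_interior: "S \<subseteq> interior \<K>"
  using S_interior by blast

lemma continuous_on_hess_inv: "continuous_on S (\<lambda>y. matrix_inv (hess B y))"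
  using continuous_on_subset[OF continuous_on_hess_B S_subset_interior]
  by (rule continuous_on_matrix_inv) (simp add: pos_def_invertible hess_pos_def S_interior)

lemma dual_norm_measurable [measurable]:
  assumes "Y \<in> N \<rightarrow>\<^sub>M borel_S" "v \<in> borel_measurable N"
  shows "(\<lambda>w. dual_norm B (Y w) (v w)) \<in> borel_measurable N"
  using continuous_compose_borel_S[OF continuous_on_hess_inv assms(1)] assms(2)
  unfolding dual_norm_def by measurable

lemma grad_f_measurable [measurable]:
  "Y \<in> N \<rightarrow>\<^sub>M borel_S \<Longrightarrow> (\<lambda>w. grad f (Y w)) \<in> borel_measurable N"
  by (rule continuous_compose_borel_S[OF continuous_on_grad_f])

lemma grad_B_measurable [measurable]:
  "Y \<in> N \<rightarrow>\<^sub>M borel_S \<Longrightarrow> (\<lambda>w. grad B (Y w)) \<in> borel_measurable N"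
  by (rule continuous_compose_borel_S[OF continuous_on_subset[OF continuous_on_grad_B S_subset_interior]])

lemma hess_inv_measurable [measurable]:
  "Y \<in> N \<rightarrow>\<^sub>M borel_S \<Longrightarrow> (\<lambda>w. matrix_inv (hess B (Y w))) \<in> borel_measurable N"
  by (rule continuous_compose_borel_S[OF continuous_on_hess_inv])

lemma schur_inv_measurable [measurable]:
  assumes "Y \<in> N \<rightarrow>\<^sub>M borel_S"
  shows "(\<lambda>w. matrix_inv (A ** matrix_inv (hess B (Y w)) ** transpose A)) \<in> borel_measurable N"
proof (rule continuous_compose_borel_S[OF continuous_on_matrix_inv assms])
  show "continuous_on S (\<lambda>y. A ** matrix_inv (hess B y) ** transpose A)"
    by (intro continuous_on_matrix_mult continuous_on_const continuous_on_hess_inv)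
  show "invertible (A ** matrix_inv (hess B y) ** transpose A)" if "y \<in> S" for y
    using that by (intro invertible_congruence full_row_rank hess_inv_pos_def S_interior)
qed

lemma regularized_measurable [measurable]:
  assumes [measurable]: "Y \<in> N \<rightarrow>\<^sub>M borel_S" "v \<in> borel_measurable N"
  shows "(\<lambda>w. regularized \<nu> (Y w) (v w)) \<in> borel_measurable N"
  unfolding regularized_def by measurable

lemma multiplier_measurable [measurable]:
  assumes [measurable]: "Y \<in> N \<rightarrow>\<^sub>M borel_S" "v \<in> borel_measurable N"
  shows "(\<lambda>w. multiplier \<nu> (Y w) (v w)) \<in> borel_measurable N"
  unfolding multiplier_def by measurable

lemma direction_measurable [measurable]:
  assumes [measurable]: "Y \<in> N \<rightarrow>\<^sub>M borel_S" "v \<in> borel_measurable N"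
  shows "(\<lambda>w. direction \<nu> (Y w) (v w)) \<in> borel_measurable N"
  unfolding direction_def
  by (intro borel_measurable_add regularized_measurable borel_measurable_matrix_vector_mult
      borel_measurable_const multiplier_measurable assms)

lemma step_in_S: "y \<in> S \<Longrightarrow> step (\<eta> k) (\<mu> k) y v \<in> S"
  by (rule step_feasible[OF _ less_imp_le[OF \<eta>(1)] \<eta>(2) \<mu>(1,2)])

lemma step_measurable [measurable]:
  assumes [measurable]: "Y \<in> N \<rightarrow>\<^sub>M borel_S" "v \<in> borel_measurable N"
  shows "(\<lambda>w. step (\<eta> k) (\<mu> k) (Y w) (v w)) \<in> N \<rightarrow>\<^sub>M borel_S"
proof (rule measurable_restrict_space2)
  have Y: "Y w \<in> S" if "w \<in> space N" for w
    using measurable_space[OF assms(1) that] by (simp add: space_restrict_space)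
  then show "(\<lambda>w. step (\<eta> k) (\<mu> k) (Y w) (v w)) \<in> space N \<rightarrow> S"
    by (auto intro: step_in_S)
  note [measurable] = borel_S_borel[OF assms(1)]
  show "(\<lambda>w. step (\<eta> k) (\<mu> k) (Y w) (v w)) \<in> borel_measurable N"
    unfolding step_def by measurable
qed

text \<open>The iterates live on sample sequences rather than on the probability space: that iterate \<open>k\<close>
  depends on finitely many samples then becomes measurability over a subproduct.\<close>

primrec state :: "nat \<Rightarrow> (nat \<Rightarrow> 'b) \<Rightarrow> (real^'n) \<times> (real^'n)" where
  "state 0 z = (x0, G x0 (z 0))"
| "state (Suc k) z = (let y = step (\<eta> k) (\<mu> k) (fst (state k z)) (snd (state k z))
     in (y, (1 - \<gamma> k) *\<^sub>R snd (state k z) + \<gamma> k *\<^sub>R G y (z (Suc k))))"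

definition X where "X k z = fst (state k z)"
definition V where "V k z = snd (state k z)"

lemma state_simps:
  "X 0 z = x0" "V 0 z = G x0 (z 0)"
  "X (Suc k) z = step (\<eta> k) (\<mu> k) (X k z) (V k z)"
  "V (Suc k) z = (1 - \<gamma> k) *\<^sub>R V k z + \<gamma> k *\<^sub>R G (X (Suc k) z) (z (Suc k))"
  by (simp_all add: X_def V_def Let_def)

lemma X_feasible: "X k z \<in> S"
proof (induction k)
  case (Suc k)
  then show ?case by (simp add: state_simps step_in_S)
qed (simp add: state_simps x0)

lemma state_cong: "(\<And>i. i \<le> k \<Longrightarrow> z i = z' i) \<Longrightarrow> X k z = X k z' \<and> V k z = V k z'"
  by (induction k) (simp_all add: state_simps)

text \<open>The index set is left open because two products are needed: the samples up to
  \<open>k\<close> for independence from the next sample, and all samples for independence from the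
  random index.\<close>

lemma state_measurable:
  assumes "{..k} \<subseteq> I"
  shows "X k \<in> PiM I (\<lambda>_. D) \<rightarrow>\<^sub>M borel_S" "V k \<in> PiM I (\<lambda>_. D) \<rightarrow>\<^sub>M borel"
proof -
  have "X k \<in> PiM I (\<lambda>_. D) \<rightarrow>\<^sub>M borel_S \<and> V k \<in> PiM I (\<lambda>_. D) \<rightarrow>\<^sub>M borel"
    using assms
  proof (induction k)
    case 0
    have [measurable]: "(\<lambda>z. x0) \<in> PiM I (\<lambda>_. D) \<rightarrow>\<^sub>M borel_S"
      using x0 by (intro measurable_const) (simp add: space_restrict_space)
    have [measurable]: "(\<lambda>z. z 0) \<in> PiM I (\<lambda>_. D) \<rightarrow>\<^sub>M D"
      using 0 by (intro measurable_component_singleton) auto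
    show ?case unfolding state_simps[abs_def] by (intro conjI) measurable
  next
    case (Suc k)
    from Suc.prems have "{..k} \<subseteq> I" by auto
    from Suc.IH[OF this]
    have [measurable]: "X k \<in> PiM I (\<lambda>_. D) \<rightarrow>\<^sub>M borel_S" "V k \<in> PiM I (\<lambda>_. D) \<rightarrow>\<^sub>M borel"
      by auto
    have [measurable]: "(\<lambda>z. z (Suc k)) \<in> PiM I (\<lambda>_. D) \<rightarrow>\<^sub>M D"
      using Suc.prems by (intro measurable_component_singleton) auto
    have [measurable]: "X (Suc k) \<in> PiM I (\<lambda>_. D) \<rightarrow>\<^sub>M borel_S"
      unfolding state_simps[abs_def] by measurable
    have "V (Suc k) \<in> PiM I (\<lambda>_. D) \<rightarrow>\<^sub>M borel"
      unfolding state_simps(4)[abs_def] by measurable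
    then show ?case by simp
  qed
  then show "X k \<in> PiM I (\<lambda>_. D) \<rightarrow>\<^sub>M borel_S" "V k \<in> PiM I (\<lambda>_. D) \<rightarrow>\<^sub>M borel" by auto
qed


section \<open>Second moments of the momentum error\<close>

definition samples :: "'w \<Rightarrow> nat \<Rightarrow> 'b" where "samples \<omega> k = \<xi> k \<omega>"

definition err2 where "err2 k \<omega> = (dual_norm B (X k (samples \<omega>)) (V k (samples \<omega>) - grad f (X k (samples \<omega>))))\<^sup>2"

lemma xi_measurable [measurable]: "\<xi> k \<in> P \<rightarrow>\<^sub>M D"
  using xi_indep by (auto simp: P.indep_vars_def)

lemma samples_measurable [measurable]: "samples \<in> P \<rightarrow>\<^sub>M PiM UNIV (\<lambda>_. D)"
  unfolding samples_def[abs_def] by (rule measurable_PiM_single') (auto simp: measurable_space[OF xi_measurable])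

lemma state_samples_measurable [measurable]:
  "(\<lambda>\<omega>. X k (samples \<omega>)) \<in> P \<rightarrow>\<^sub>M borel_S" "(\<lambda>\<omega>. V k (samples \<omega>)) \<in> P \<rightarrow>\<^sub>M borel"
  using measurable_compose[OF samples_measurable state_measurable(1)[of k UNIV]]
    measurable_compose[OF samples_measurable state_measurable(2)[of k UNIV]] by auto

lemma err2_nonneg: "0 \<le> err2 k \<omega>"
  by (simp add: err2_def)

lemma err2_measurable [measurable]: "err2 k \<in> borel_measurable P"
  unfolding err2_def[abs_def] by measurable

text \<open>Takes the place of a conditional expectation: the samples up to \<open>k\<close> and the
  sample \<open>Suc k\<close> are independent blocks, so their joint law is a product and Tonelli
  applies. Iterate \<open>Suc k\<close> belongs to the past, being computed from \<open>V k\<close>.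
  Nonnegative integrals avoid any prior integrability.\<close>

lemma nn_integral_fresh_sample:
  defines "Y \<equiv> \<lambda>k z. (X (Suc k) z, V k z)"
  assumes h [measurable]: "h \<in> borel_measurable ((borel_S \<Otimes>\<^sub>M borel) \<Otimes>\<^sub>M D)"
  shows "(\<integral>\<^sup>+\<omega>. h (Y k (samples \<omega>), \<xi> (Suc k) \<omega>) \<partial>P)
    = (\<integral>\<^sup>+\<omega>. (\<integral>\<^sup>+z. h (Y k (samples \<omega>), z) \<partial>D) \<partial>P)"
proof -
  let ?U = "\<lambda>\<omega>. restrict (\<lambda>i. \<xi> i \<omega>) {..k}" and ?W = "\<lambda>\<omega>. restrict (\<lambda>i. \<xi> i \<omega>) {Suc k}"
  let ?M = "PiM {..k} (\<lambda>_. D)" and ?N = "PiM {Suc k} (\<lambda>_. D)"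
  have [measurable]: "X k \<in> ?M \<rightarrow>\<^sub>M borel_S" "V k \<in> ?M \<rightarrow>\<^sub>M borel"
    by (auto intro: state_measurable)
  have Y [measurable]: "Y k \<in> ?M \<rightarrow>\<^sub>M borel_S \<Otimes>\<^sub>M borel"
    unfolding Y_def state_simps by measurable
  have last [measurable]: "(\<lambda>z. z (Suc k)) \<in> ?N \<rightarrow>\<^sub>M D"
    by (intro measurable_component_singleton) simp
  have U [measurable]: "?U \<in> P \<rightarrow>\<^sub>M ?M" and W [measurable]: "?W \<in> P \<rightarrow>\<^sub>M ?N"
    by (auto intro!: measurable_restrict)
  interpret W: prob_space "distr P ?N ?W" by (rule P.prob_space_distr[OF W])
  \<comment> \<open>Restriction makes the samples beyond \<open>k\<close> undefined, which neither
    component of \<open>Y k\<close> sees.\<close>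
  have YU: "Y k (?U \<omega>) = Y k (samples \<omega>)" for \<omega>
  proof -
    have "X k (?U \<omega>) = X k (samples \<omega>) \<and> V k (?U \<omega>) = V k (samples \<omega>)"
      by (rule state_cong) (simp add: samples_def)
    then show ?thesis by (simp add: Y_def state_simps)
  qed
  define h' where "h' p = h (Y k (fst p), snd p (Suc k))" for p
  have h'_eq: "h' (?U \<omega>, ?W \<omega>') = h (Y k (samples \<omega>), \<xi> (Suc k) \<omega>')" for \<omega> \<omega>'
    by (simp add: h'_def YU)
  have h' [measurable]: "h' \<in> borel_measurable (?M \<Otimes>\<^sub>M ?N)"
    unfolding h'_def[abs_def] by measurable
  have h'2: "h' \<in> borel_measurable (?M \<Otimes>\<^sub>M distr P ?N ?W)"
    using h' by (simp cong: measurable_cong_sets sets_pair_measure_cong)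
  have "P.indep_var ?M ?U ?N ?W"
    by (rule P.indep_var_restrict[OF xi_indep]) auto
  then have prod: "distr P ?M ?U \<Otimes>\<^sub>M distr P ?N ?W = distr P (?M \<Otimes>\<^sub>M ?N) (\<lambda>\<omega>. (?U \<omega>, ?W \<omega>))"
    unfolding P.indep_var_distribution_eq by blast
  have "(\<integral>\<^sup>+\<omega>. h (Y k (samples \<omega>), \<xi> (Suc k) \<omega>) \<partial>P) = (\<integral>\<^sup>+\<omega>. h' (?U \<omega>, ?W \<omega>) \<partial>P)"
    by (simp only: h'_eq)
  also have "\<dots> = (\<integral>\<^sup>+p. h' p \<partial>distr P (?M \<Otimes>\<^sub>M ?N) (\<lambda>\<omega>. (?U \<omega>, ?W \<omega>)))"
    by (rule nn_integral_distr[symmetric]) measurable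
  also have "\<dots> = (\<integral>\<^sup>+p. h' p \<partial>(distr P ?M ?U \<Otimes>\<^sub>M distr P ?N ?W))"
    by (simp only: prod)
  also have "\<dots> = (\<integral>\<^sup>+u. (\<integral>\<^sup>+w. h' (u, w) \<partial>distr P ?N ?W) \<partial>distr P ?M ?U)"
    by (rule W.nn_integral_fst[symmetric]) (use h'2 in \<open>simp cong: measurable_cong_sets sets_pair_measure_cong\<close>)
  also have "\<dots> = (\<integral>\<^sup>+\<omega>. (\<integral>\<^sup>+w. h' (?U \<omega>, w) \<partial>distr P ?N ?W) \<partial>P)"
    by (rule nn_integral_distr[OF U]) (use W.borel_measurable_nn_integral_fst[OF h'2] in simp)
  also have "\<dots> = (\<integral>\<^sup>+\<omega>. (\<integral>\<^sup>+z. h (Y k (samples \<omega>), z) \<partial>D) \<partial>P)"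
  proof (rule nn_integral_cong)
    fix \<omega> assume \<omega>: "\<omega> \<in> space P"
    have "?U \<omega> \<in> space ?M" using measurable_space[OF U \<omega>] .
    then have [measurable]: "(\<lambda>w. h' (?U \<omega>, w)) \<in> borel_measurable ?N"
      by (rule measurable_compose[OF measurable_Pair1' h'])
    have "Y k (samples \<omega>) \<in> space (borel_S \<Otimes>\<^sub>M borel)"
      using measurable_space[OF Y \<open>?U \<omega> \<in> space ?M\<close>] by (simp only: YU)
    then have hD: "(\<lambda>z. h (Y k (samples \<omega>), z)) \<in> borel_measurable D"
      by (rule measurable_compose[OF measurable_Pair1' h])
    have "(\<integral>\<^sup>+w. h' (?U \<omega>, w) \<partial>distr P ?N ?W) = (\<integral>\<^sup>+\<omega>'. h (Y k (samples \<omega>), \<xi> (Suc k) \<omega>') \<partial>P)"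
      by (subst nn_integral_distr) (simp_all add: h'_eq del: restrict_apply)
    also have "\<dots> = (\<integral>\<^sup>+z. h (Y k (samples \<omega>), z) \<partial>distr P D (\<xi> (Suc k)))"
      by (rule nn_integral_distr[OF xi_measurable, symmetric]) (use hD in simp)
    finally show "(\<integral>\<^sup>+w. h' (?U \<omega>, w) \<partial>distr P ?N ?W) = (\<integral>\<^sup>+z. h (Y k (samples \<omega>), z) \<partial>D)"
      by (simp only: xi_distr)
  qed
  finally show ?thesis .
qed

text \<open>With the point frozen, the new sample enters through a mean-zero vector, so the cross
  term of the expanded square integrates to 0 and only the variance, weighted by \<gamma>^2,
  remains.\<close>

lemma conditional_second_moment:
  assumes y: "y \<in> S"
  shows "(\<integral>\<^sup>+z. ennreal ((dual_norm B y ((1 - \<gamma> k) *\<^sub>R v + \<gamma> k *\<^sub>R G y z - grad f y))\<^sup>2) \<partial>D)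
    \<le> ennreal (((1 - \<gamma> k) * dual_norm B y (v - grad f y))\<^sup>2 + (\<gamma> k)\<^sup>2 * \<sigma>\<^sup>2)"
proof -
  let ?H = "matrix_inv (hess B y)"
  note pd = hess_inv_pos_def[OF S_interior[OF y]]
  define a where "a = v - grad f y"
  define g where "g z = G y z - grad f y" for z
  have g_int: "integrable D g" unfolding g_def using G_unbiased(1)[OF y] by simp
  have g_mean: "integral\<^sup>L D g = 0"
    unfolding g_def using G_unbiased[OF y] by (simp add: D.prob_space)
  have g2_int: "integrable D (\<lambda>z. (dual_norm B y (g z))\<^sup>2)"
    unfolding g_def by (rule G_variance(1)[OF y])
  define c where "c = 2 * \<gamma> k * (1 - \<gamma> k)"
  have expand: "(dual_norm B y ((1 - \<gamma> k) *\<^sub>R v + \<gamma> k *\<^sub>R G y z - grad f y))\<^sup>2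
      = ((1 - \<gamma> k) * dual_norm B y a)\<^sup>2 + c * ((?H *v a) \<bullet> g z) + (\<gamma> k)\<^sup>2 * (dual_norm B y (g z))\<^sup>2" for z
  proof -
    have "(1 - \<gamma> k) *\<^sub>R v + \<gamma> k *\<^sub>R G y z - grad f y = (1 - \<gamma> k) *\<^sub>R a + \<gamma> k *\<^sub>R g z"
      by (simp add: a_def g_def algebra_simps)
    moreover have "a \<bullet> (?H *v g z) = (?H *v a) \<bullet> g z"
      using pos_def_sym[OF pd, of a "g z"] by (simp add: inner_commute)
    ultimately show ?thesis
      by (simp add: dual_norm_eq quad_norm_add_sq[OF pd] quad_norm_scaleR power_mult_distrib
          matrix_vector_mult_scaleR c_def)
  qed
  have int: "integrable D (\<lambda>z. ((1 - \<gamma> k) * dual_norm B y a)\<^sup>2 + c * ((?H *v a) \<bullet> g z)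
      + (\<gamma> k)\<^sup>2 * (dual_norm B y (g z))\<^sup>2)"
    using g_int g2_int by (intro Bochner_Integration.integrable_add integrable_mult_right integrable_inner_right) auto
  have "(\<integral>\<^sup>+z. ennreal ((dual_norm B y ((1 - \<gamma> k) *\<^sub>R v + \<gamma> k *\<^sub>R G y z - grad f y))\<^sup>2) \<partial>D)
      = ennreal (\<integral>z. (dual_norm B y ((1 - \<gamma> k) *\<^sub>R v + \<gamma> k *\<^sub>R G y z - grad f y))\<^sup>2 \<partial>D)"
    using int unfolding expand[symmetric] by (rule nn_integral_eq_integral) simp
  also have "(\<integral>z. (dual_norm B y ((1 - \<gamma> k) *\<^sub>R v + \<gamma> k *\<^sub>R G y z - grad f y))\<^sup>2 \<partial>D)
      = ((1 - \<gamma> k) * dual_norm B y a)\<^sup>2 + c * ((?H *v a) \<bullet> integral\<^sup>L D g)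
        + (\<gamma> k)\<^sup>2 * (\<integral>z. (dual_norm B y (g z))\<^sup>2 \<partial>D)"
    unfolding expand using g_int g2_int
    by (simp add: D.prob_space integrable_inner_right)
  also have "\<dots> \<le> ((1 - \<gamma> k) * dual_norm B y a)\<^sup>2 + (\<gamma> k)\<^sup>2 * \<sigma>\<^sup>2"
    using G_variance(2)[OF y] by (simp add: g_mean g_def mult_left_mono)
  finally show ?thesis by (simp add: a_def ennreal_leI)
qed

definition \<alpha> where "\<alpha> k = (\<gamma> k - \<eta> k) / (1 - \<eta> k)"

lemma eta_less_1: "\<eta> k < 1"
  using \<eta>(2)[of k] s by simp

lemma alpha_bounds: "0 < \<alpha> k" "\<alpha> k \<le> 1"
  using \<gamma>[of k] eta_less_1[of k] by (simp_all add: \<alpha>_def)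

lemma err2_0: "integrable P (err2 0)" "integral\<^sup>L P (err2 0) \<le> \<sigma>\<^sup>2"
proof -
  let ?h = "\<lambda>z. (dual_norm B x0 (G x0 z - grad f x0))\<^sup>2"
  have h: "integrable D ?h" "integral\<^sup>L D ?h \<le> \<sigma>\<^sup>2" using G_variance[OF x0] by auto
  have eq: "err2 0 = (\<lambda>\<omega>. ?h (\<xi> 0 \<omega>))"
    by (simp add: err2_def fun_eq_iff state_simps samples_def)
  have "integrable (distr P D (\<xi> 0)) ?h" using h by (simp add: xi_distr)
  then show "integrable P (err2 0)"
    unfolding eq by (subst (asm) integrable_distr_eq) (use h in auto)
  have "integral\<^sup>L (distr P D (\<xi> 0)) ?h = integral\<^sup>L P (err2 0)"
    unfolding eq by (rule integral_distr) (use h in auto)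
  then show "integral\<^sup>L P (err2 0) \<le> \<sigma>\<^sup>2" using h by (simp add: xi_distr)
qed

text \<open>Integrability travels with the bound: the extended integral of the next squared error is
  below a finite number, which settles both.\<close>

lemma err2_Suc:
  assumes int: "integrable P (err2 k)"
  defines "c \<equiv> L\<^sup>2 * (\<eta> k)\<^sup>2 / \<alpha> k + (\<gamma> k)\<^sup>2 * \<sigma>\<^sup>2"
  shows "integrable P (err2 (Suc k))"
    and "integral\<^sup>L P (err2 (Suc k)) \<le> (1 - \<alpha> k) * integral\<^sup>L P (err2 k) + c"
proof -
  let ?Y = "\<lambda>\<omega>. (X (Suc k) (samples \<omega>), V k (samples \<omega>))"
  let ?N = "borel_S \<Otimes>\<^sub>M (borel :: (real^'n) measure)"
  define h where "h p = ennreal ((dual_norm B (fst (fst p))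
      ((1 - \<gamma> k) *\<^sub>R snd (fst p) + \<gamma> k *\<^sub>R G (fst (fst p)) (snd p) - grad f (fst (fst p))))\<^sup>2)"
    for p :: "((real^'n) \<times> (real^'n)) \<times> 'b"
  have h [measurable]: "h \<in> borel_measurable (?N \<Otimes>\<^sub>M D)"
    unfolding h_def[abs_def] by measurable
  have c: "0 \<le> c" unfolding c_def using alpha_bounds[of k] by simp
  have "(\<integral>\<^sup>+\<omega>. ennreal (err2 (Suc k) \<omega>) \<partial>P) = (\<integral>\<^sup>+\<omega>. h (?Y \<omega>, \<xi> (Suc k) \<omega>) \<partial>P)"
    by (simp add: err2_def h_def state_simps(4) samples_def)
  also have "\<dots> = (\<integral>\<^sup>+\<omega>. \<integral>\<^sup>+z. h (?Y \<omega>, z) \<partial>D \<partial>P)"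
    by (rule nn_integral_fresh_sample[OF h])
  also have "\<dots> \<le> (\<integral>\<^sup>+\<omega>. ennreal ((1 - \<alpha> k) * err2 k \<omega> + c) \<partial>P)"
  proof (rule nn_integral_mono)
    fix \<omega>
    let ?x = "X (Suc k) (samples \<omega>)" and ?v = "V k (samples \<omega>)"
    have "(\<integral>\<^sup>+z. h (?Y \<omega>, z) \<partial>D)
        \<le> ennreal (((1 - \<gamma> k) * dual_norm B ?x (?v - grad f ?x))\<^sup>2 + (\<gamma> k)\<^sup>2 * \<sigma>\<^sup>2)"
      unfolding h_def fst_conv snd_conv by (rule conditional_second_moment[OF X_feasible])
    also have "\<dots> \<le> ennreal ((1 - \<alpha> k) * err2 k \<omega> + c)"
      using momentum_drift[OF X_feasible less_imp_le[OF \<eta>(1)] \<eta>(2) \<mu>(1,2) \<gamma>, where v = ?v]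
      by (intro ennreal_leI) (simp add: state_simps \<alpha>_def c_def err2_def)
    finally show "(\<integral>\<^sup>+z. h (?Y \<omega>, z) \<partial>D) \<le> ennreal ((1 - \<alpha> k) * err2 k \<omega> + c)" .
  qed
  also have "\<dots> = ennreal (\<integral>\<omega>. (1 - \<alpha> k) * err2 k \<omega> + c \<partial>P)"
    using int alpha_bounds[of k] c
    by (intro nn_integral_eq_integral) (auto intro!: add_nonneg_nonneg mult_nonneg_nonneg simp: err2_nonneg)
  also have "(\<integral>\<omega>. (1 - \<alpha> k) * err2 k \<omega> + c \<partial>P) = (1 - \<alpha> k) * integral\<^sup>L P (err2 k) + c"
    using int by (simp add: P.prob_space)
  finally have bd: "(\<integral>\<^sup>+\<omega>. ennreal (err2 (Suc k) \<omega>) \<partial>P) \<le> ennreal ((1 - \<alpha> k) * integral\<^sup>L P (err2 k) + c)" .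
  show int': "integrable P (err2 (Suc k))"
    by (rule integrableI_bounded) (use bd in \<open>auto simp: err2_def order_le_less_trans\<close>)
  have "ennreal (integral\<^sup>L P (err2 (Suc k))) \<le> ennreal ((1 - \<alpha> k) * integral\<^sup>L P (err2 k) + c)"
    using bd nn_integral_eq_integral[OF int'] by (simp add: err2_def)
  moreover have "0 \<le> (1 - \<alpha> k) * integral\<^sup>L P (err2 k) + c"
    using alpha_bounds[of k] c by (auto intro!: add_nonneg_nonneg mult_nonneg_nonneg simp: err2_def)
  ultimately show "integral\<^sup>L P (err2 (Suc k)) \<le> (1 - \<alpha> k) * integral\<^sup>L P (err2 k) + c"
    by (simp add: ennreal_le_iff)
qed

lemma err2_integrable: "integrable P (err2 k)"
  by (induction k) (auto intro: err2_0 err2_Suc)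

text \<open>The recursion is summed and the final error dropped; the initial momentum is a single
  sample, which contributes the leading \<sigma>^2.\<close>

lemma sum_err2:
  "(\<Sum>k<K. \<alpha> k * integral\<^sup>L P (err2 k)) \<le> \<sigma>\<^sup>2 + (\<Sum>k<K. L\<^sup>2 * (\<eta> k)\<^sup>2 / \<alpha> k + (\<gamma> k)\<^sup>2 * \<sigma>\<^sup>2)"
proof -
  have "integral\<^sup>L P (err2 K) + (\<Sum>k<K. \<alpha> k * integral\<^sup>L P (err2 k))
      \<le> \<sigma>\<^sup>2 + (\<Sum>k<K. L\<^sup>2 * (\<eta> k)\<^sup>2 / \<alpha> k + (\<gamma> k)\<^sup>2 * \<sigma>\<^sup>2)"
  proof (induction K)
    case (Suc K)
    then show ?case using err2_Suc(2)[OF err2_integrable, of K] by (simp add: algebra_simps)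
  qed (simp add: err2_0)
  moreover have "0 \<le> integral\<^sup>L P (err2 K)" by (simp add: err2_def)
  ultimately show ?thesis by simp
qed

section \<open>Expected residuals\<close>

definition res :: "nat \<Rightarrow> (nat \<Rightarrow> 'b) \<Rightarrow> real" where
  "res k z = dual_norm B (X k z) (grad (phi f B (\<mu> k)) (X k z) + transpose A *v multiplier (\<mu> k) (X k z) (V k z))"

lemma res_nonneg: "0 \<le> res k z"
  by (simp add: res_def dual_nonneg X_feasible)

lemma res_measurable [measurable]: "res k \<in> borel_measurable (PiM UNIV (\<lambda>_. D))"
proof -
  have [measurable]: "X k \<in> PiM UNIV (\<lambda>_. D) \<rightarrow>\<^sub>M borel_S" "V k \<in> PiM UNIV (\<lambda>_. D) \<rightarrow>\<^sub>M borel"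
    by (auto intro: state_measurable)
  have "res k = (\<lambda>z. dual_norm B (X k z) (((1 + \<mu> k) *\<^sub>R grad f (X k z) + \<mu> k *\<^sub>R grad B (X k z))
      + transpose A *v multiplier (\<mu> k) (X k z) (V k z)))"
    by (simp add: res_def[abs_def] grad_phi[OF X_feasible])
  also have "\<dots> \<in> borel_measurable (PiM UNIV (\<lambda>_. D))"
    by (intro dual_norm_measurable borel_measurable_add borel_measurable_matrix_vector_mult) measurable
  finally show ?thesis .
qed

text \<open>The weights are dictated by \<open>sum_err2\<close>, where the squared error appears
  with factor \<alpha>; dividing by \<open>L\<close> puts both remainders on the scale L \<eta>^2 /
  \<alpha>.\<close>

lemma err_bound:
  "4 * \<eta> k * sqrt (err2 k \<omega>) \<le> \<alpha> k / L * err2 k \<omega> + 4 * L * (\<eta> k)\<^sup>2 / \<alpha> k"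
proof -
  let ?e = "sqrt (err2 k \<omega>)"
  have e2: "?e\<^sup>2 = err2 k \<omega>" by (simp add: err2_def)
  have "0 \<le> (\<alpha> k * ?e - 2 * L * \<eta> k)\<^sup>2 / (\<alpha> k * L)"
    using alpha_bounds[of k] L_pos by simp
  also have "\<dots> = \<alpha> k / L * ?e\<^sup>2 + 4 * L * (\<eta> k)\<^sup>2 / \<alpha> k - 4 * \<eta> k * ?e"
    using alpha_bounds[of k] L_pos by (simp add: power2_diff field_simps power2_eq_square)
  finally show ?thesis unfolding e2 by simp
qed

lemma total_residual_pointwise:
  "(\<Sum>k<K. \<eta> k * res k (samples \<omega>)) \<le> Delta f B \<phi>low x0
     + (\<Sum>k<K. \<alpha> k / L * err2 k \<omega> + (4 * L * (\<eta> k)\<^sup>2 / \<alpha> k + L_phi L s / 2 * (\<eta> k)\<^sup>2))"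
proof -
  let ?z = "samples \<omega>"
  have "(\<Sum>k<K. \<eta> k * res k ?z) \<le> Delta f B \<phi>low (X 0 ?z)
     + (\<Sum>k<K. 4 * \<eta> k * dual_norm B (X k ?z) (V k ?z - grad f (X k ?z)) + L_phi L s / 2 * (\<eta> k)\<^sup>2)"
    unfolding res_def
    by (rule total_descent) (auto simp: X_feasible state_simps \<eta> \<mu> less_imp_le)
  also have "(\<Sum>k<K. 4 * \<eta> k * dual_norm B (X k ?z) (V k ?z - grad f (X k ?z)) + L_phi L s / 2 * (\<eta> k)\<^sup>2)
    \<le> (\<Sum>k<K. \<alpha> k / L * err2 k \<omega> + (4 * L * (\<eta> k)\<^sup>2 / \<alpha> k + L_phi L s / 2 * (\<eta> k)\<^sup>2))"
  proof (rule sum_mono)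
    fix k
    have "dual_norm B (X k ?z) (V k ?z - grad f (X k ?z)) = sqrt (err2 k \<omega>)"
      by (simp add: err2_def dual_nonneg X_feasible)
    then show "4 * \<eta> k * dual_norm B (X k ?z) (V k ?z - grad f (X k ?z)) + L_phi L s / 2 * (\<eta> k)\<^sup>2
      \<le> \<alpha> k / L * err2 k \<omega> + (4 * L * (\<eta> k)\<^sup>2 / \<alpha> k + L_phi L s / 2 * (\<eta> k)\<^sup>2)"
      using err_bound[of k \<omega>] by simp
  qed
  finally show ?thesis by (simp add: state_simps)
qed

text \<open>A weighted residual is dominated by the sum up to its own index, and the pointwise bound
  on that sum is made of integrable squared errors and constants.\<close>

lemma res_integrable: "integrable P (\<lambda>\<omega>. res k (samples \<omega>))"
proof -
  have "integrable P (\<lambda>\<omega>. Delta f B \<phi>low x0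
     + (\<Sum>k<Suc k. \<alpha> k / L * err2 k \<omega> + (4 * L * (\<eta> k)\<^sup>2 / \<alpha> k + L_phi L s / 2 * (\<eta> k)\<^sup>2)))"
    by (intro Bochner_Integration.integrable_add Bochner_Integration.integrable_sum
        integrable_mult_right err2_integrable) auto
  then have "integrable P (\<lambda>\<omega>. \<eta> k * res k (samples \<omega>))"
  proof (rule Bochner_Integration.integrable_bound)
    show "(\<lambda>\<omega>. \<eta> k * res k (samples \<omega>)) \<in> borel_measurable P" by measurable
    show "AE \<omega> in P. norm (\<eta> k * res k (samples \<omega>)) \<le> norm (Delta f B \<phi>low x0
       + (\<Sum>k<Suc k. \<alpha> k / L * err2 k \<omega> + (4 * L * (\<eta> k)\<^sup>2 / \<alpha> k + L_phi L s / 2 * (\<eta> k)\<^sup>2)))"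
    proof (rule AE_I2)
      fix \<omega>
      have "\<eta> k * res k (samples \<omega>) \<le> (\<Sum>k<Suc k. \<eta> k * res k (samples \<omega>))"
        using \<eta> res_nonneg by (intro member_le_sum) (auto simp: less_imp_le)
      with total_residual_pointwise[where K = "Suc k" and \<omega> = \<omega>] \<eta>(1)[of k] res_nonneg[of k "samples \<omega>"]
      show "norm (\<eta> k * res k (samples \<omega>)) \<le> norm (Delta f B \<phi>low x0
       + (\<Sum>k<Suc k. \<alpha> k / L * err2 k \<omega> + (4 * L * (\<eta> k)\<^sup>2 / \<alpha> k + L_phi L s / 2 * (\<eta> k)\<^sup>2)))"
        by (simp del: sum.lessThan_Suc)
    qed
  qed
  then show ?thesis using \<eta>(1)[of k] by simp
qed

text \<open>The coefficient 5 is 4 from \<open>err_bound\<close> plus 1 from the drift term of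
  \<open>sum_err2\<close> divided by \<open>L\<close>; the same division produces the terms with
  \<sigma>^2 / L.\<close>

lemma expected_total_residual:
  "(\<Sum>k<K. \<eta> k * (\<integral>\<omega>. res k (samples \<omega>) \<partial>P)) \<le> Delta f B \<phi>low x0 + \<sigma>\<^sup>2 / L
     + (\<Sum>k<K. 5 * L * (\<eta> k)\<^sup>2 / \<alpha> k + \<sigma>\<^sup>2 / L * (\<gamma> k)\<^sup>2 + L_phi L s / 2 * (\<eta> k)\<^sup>2)"
proof -
  let ?c = "\<lambda>k. 4 * L * (\<eta> k)\<^sup>2 / \<alpha> k + L_phi L s / 2 * (\<eta> k)\<^sup>2"
  have "(\<Sum>k<K. \<eta> k * (\<integral>\<omega>. res k (samples \<omega>) \<partial>P)) = (\<integral>\<omega>. (\<Sum>k<K. \<eta> k * res k (samples \<omega>)) \<partial>P)"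
    using res_integrable by (subst Bochner_Integration.integral_sum) auto
  also have "\<dots> \<le> (\<integral>\<omega>. Delta f B \<phi>low x0 + (\<Sum>k<K. \<alpha> k / L * err2 k \<omega> + ?c k) \<partial>P)"
    by (intro integral_mono total_residual_pointwise Bochner_Integration.integrable_add
        Bochner_Integration.integrable_sum integrable_mult_right err2_integrable res_integrable) auto
  also have "\<dots> = Delta f B \<phi>low x0 + (\<Sum>k<K. \<alpha> k / L * integral\<^sup>L P (err2 k) + ?c k)"
    using err2_integrable
    by (subst Bochner_Integration.integral_add) (auto simp: P.prob_space)
  also have "(\<Sum>k<K. \<alpha> k / L * integral\<^sup>L P (err2 k) + ?c k)
      = (\<Sum>k<K. \<alpha> k * integral\<^sup>L P (err2 k)) / L + (\<Sum>k<K. ?c k)"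
    by (simp add: sum.distrib sum_divide_distrib)
  also have "(\<Sum>k<K. \<alpha> k * integral\<^sup>L P (err2 k)) / L
      \<le> (\<sigma>\<^sup>2 + (\<Sum>k<K. L\<^sup>2 * (\<eta> k)\<^sup>2 / \<alpha> k + (\<gamma> k)\<^sup>2 * \<sigma>\<^sup>2)) / L"
    using sum_err2 L_pos by (intro divide_right_mono) auto
  also have "\<dots> = \<sigma>\<^sup>2 / L + (\<Sum>k<K. L * (\<eta> k)\<^sup>2 / \<alpha> k + \<sigma>\<^sup>2 / L * (\<gamma> k)\<^sup>2)"
    using L_pos by (simp add: add_divide_distrib sum_divide_distrib power2_eq_square mult_ac)
  finally show ?thesis
    by (simp add: sum.distrib[symmetric] algebra_simps add_divide_distrib[symmetric])
qed


text \<open>The index has finitely many values, so the residual at it is a finite sum of indicators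
  times residuals. Independence factors the expectation of each product, and each indicator has mean
  1 / card I.\<close>

lemma random_index:
  assumes I: "finite I"
    and \<kappa>: "\<kappa> \<in> P \<rightarrow>\<^sub>M count_space I"
    and unif: "distr P (count_space I) \<kappa> = uniform_count_measure I"
    and indep: "P.indep_set {\<kappa> -` J \<inter> space P | J. J \<subseteq> I}
      {samples -` T \<inter> space P | T. T \<in> sets (PiM UNIV (\<lambda>_. D))}"
  shows "integrable P (\<lambda>\<omega>. res (\<kappa> \<omega>) (samples \<omega>))"
    and "(\<integral>\<omega>. res (\<kappa> \<omega>) (samples \<omega>) \<partial>P) = (\<Sum>k\<in>I. \<integral>\<omega>. res k (samples \<omega>) \<partial>P) / card I"
proof -
  define i where "i k \<omega> = (indicator {k} (\<kappa> \<omega>) :: real)" for k \<omega>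
  define r where "r k \<omega> = res k (samples \<omega>)" for k \<omega>
  have \<kappa>_in: "\<kappa> \<omega> \<in> I" if "\<omega> \<in> space P" for \<omega>
    using measurable_space[OF \<kappa> that] by simp
  have i_meas: "i k \<in> borel_measurable P" for k
    unfolding i_def[abs_def] by (rule measurable_compose[OF \<kappa>]) simp
  have r_meas: "r k \<in> borel_measurable P" for k
    unfolding r_def[abs_def] by measurable
  \<comment> \<open>The given independence concerns families of preimages; extending it to the
    generated sigma-algebras in \<open>indep_var\<close> requires families closed under
    intersection.\<close>
  have stable: "Int_stable {Z -` U \<inter> space P | U. U \<in> sets borel}" for Z :: "'w \<Rightarrow> real"
  proof (rule Int_stableI)
    fix a b assume "a \<in> {Z -` U \<inter> space P | U. U \<in> sets borel}" "b \<in> {Z -` U \<inter> space P | U. U \<in> sets borel}"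
    then obtain U U' where "a = Z -` U \<inter> space P" "b = Z -` U' \<inter> space P" "U \<in> sets borel" "U' \<in> sets borel"
      by auto
    then show "a \<inter> b \<in> {Z -` U \<inter> space P | U. U \<in> sets borel}"
      by (intro CollectI exI[of _ "U \<inter> U'"]) auto
  qed
  have ind: "P.indep_var borel (i k) borel (r k)" for k
    unfolding P.indep_var_eq
  proof (intro conjI i_meas r_meas P.indep_set_sigma_sets stable)
    have 1: "{i k -` U \<inter> space P | U. U \<in> sets borel} \<subseteq> {\<kappa> -` J \<inter> space P | J. J \<subseteq> I}"
    proof clarify
      fix U :: "real set"
      have "i k -` U \<inter> space P = \<kappa> -` {j \<in> I. indicator {k} j \<in> U} \<inter> space P"
        using \<kappa>_in by (auto simp: i_def)
      then show "\<exists>J. i k -` U \<inter> space P = \<kappa> -` J \<inter> space P \<and> J \<subseteq> I" by blast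
    qed
    have 2: "{r k -` U \<inter> space P | U. U \<in> sets borel}
      \<subseteq> {samples -` T \<inter> space P | T. T \<in> sets (PiM UNIV (\<lambda>_. D))}"
    proof clarify
      fix U :: "real set" assume U: "U \<in> sets borel"
      have "r k -` U \<inter> space P = samples -` (res k -` U \<inter> space (PiM UNIV (\<lambda>_. D))) \<inter> space P"
        using measurable_space[OF samples_measurable] by (auto simp: r_def)
      moreover have "res k -` U \<inter> space (PiM UNIV (\<lambda>_. D)) \<in> sets (PiM UNIV (\<lambda>_. D))"
        using res_measurable U by (rule measurable_sets)
      ultimately show "\<exists>T. r k -` U \<inter> space P = samples -` T \<inter> space P \<and> T \<in> sets (PiM UNIV (\<lambda>_. D))"
        by blast
    qed
    show "P.indep_set {i k -` U \<inter> space P | U. U \<in> sets borel} {r k -` U \<inter> space P | U. U \<in> sets borel}"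
      using indep unfolding P.indep_set_def
      by (rule P.indep_sets_mono_sets) (use 1 2 in \<open>auto split: bool.split\<close>)
  qed
  have i_int: "integrable P (i k)" for k
    by (rule P.integrable_const_bound[where B = 1]) (auto simp: i_def indicator_def i_meas)
  have r_int: "integrable P (r k)" for k
    unfolding r_def[abs_def] by (rule res_integrable)
  have int: "integrable P (\<lambda>\<omega>. i k \<omega> * r k \<omega>)" for k
    by (rule P.indep_var_integrable[OF ind i_int r_int])
  have i_mean: "integral\<^sup>L P (i k) = 1 / card I" if "k \<in> I" for k
  proof -
    have "integral\<^sup>L P (i k) = (\<integral>j. indicator {k} j \<partial>distr P (count_space I) \<kappa>)"
      unfolding i_def[abs_def] by (rule integral_distr[symmetric]) (use \<kappa> in auto)
    also have "\<dots> = measure (uniform_count_measure I) {k}"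
      unfolding unif using that by (simp add: space_uniform_count_measure)
    also have "\<dots> = 1 / card I"
      using I that by (simp add: measure_uniform_count_measure)
    finally show ?thesis .
  qed
  have split: "res (\<kappa> \<omega>) (samples \<omega>) = (\<Sum>k\<in>I. i k \<omega> * r k \<omega>)" if "\<omega> \<in> space P" for \<omega>
  proof -
    have "(\<Sum>k\<in>I. i k \<omega> * r k \<omega>) = (\<Sum>k\<in>I. if k = \<kappa> \<omega> then r k \<omega> else 0)"
      by (intro sum.cong) (auto simp: i_def)
    then show ?thesis using I \<kappa>_in[OF that] by (simp add: r_def)
  qed
  show "integrable P (\<lambda>\<omega>. res (\<kappa> \<omega>) (samples \<omega>))"
    using int by (subst Bochner_Integration.integrable_cong[OF refl split]) auto
  have "(\<integral>\<omega>. res (\<kappa> \<omega>) (samples \<omega>) \<partial>P) = (\<integral>\<omega>. (\<Sum>k\<in>I. i k \<omega> * r k \<omega>) \<partial>P)"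
    by (rule Bochner_Integration.integral_cong[OF refl split])
  also have "\<dots> = (\<Sum>k\<in>I. integral\<^sup>L P (i k) * integral\<^sup>L P (r k))"
    using int P.indep_var_lebesgue_integral[OF ind i_int r_int]
    by (subst Bochner_Integration.integral_sum) auto
  also have "\<dots> = (\<Sum>k\<in>I. integral\<^sup>L P (r k)) / card I"
    by (simp add: i_mean sum_divide_distrib)
  finally show "(\<integral>\<omega>. res (\<kappa> \<omega>) (samples \<omega>) \<partial>P) = (\<Sum>k\<in>I. \<integral>\<omega>. res k (samples \<omega>) \<partial>P) / card I"
    by (simp add: r_def[abs_def])
qed

end

section \<open>Step sizes\<close>

lemma sum_inverse_le_ln: "K \<ge> 1 \<Longrightarrow> (\<Sum>k<K. 1 / (real k + 1)) \<le> 1 + ln (real K)"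
proof (induction K rule: nat_induct_at_least)
  case (Suc K)
  have "ln (real K / (real K + 1)) \<le> real K / (real K + 1) - 1"
    using Suc.hyps by (intro ln_le_minus_one) auto
  also have "\<dots> = - (1 / (real K + 1))" by (simp add: field_simps)
  finally have "1 / (real K + 1) \<le> ln (real K + 1) - ln (real K)"
    using Suc.hyps by (simp add: ln_div)
  then show ?case using Suc.IH by (simp add: add.commute)
qed simp

text \<open>Telescoping against 2 / sqrt K - 2 / sqrt (K + 1). The subtracted term makes the
  induction close and is discarded later, leaving the 3 in \<open>M_pm\<close>.\<close>

lemma sum_powr_le: "K \<ge> 1 \<Longrightarrow> (\<Sum>k<K. 1 / (real k + 1) powr (3/2)) \<le> 3 - 2 / sqrt (real K)"
proof (induction K rule: nat_induct_at_least)
  case (Suc K)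
  define a b where "a = sqrt (real K)" and "b = sqrt (real K + 1)"
  have ab: "0 < a" "a \<le> b" "b > 0" "b * b = a * a + 1" using Suc.hyps by (simp_all add: a_def b_def)
  have "(real K + 1) powr (3/2) = (real K + 1) powr (1 + 1/2)" by simp
  also have "\<dots> = (b * b) * b"
    by (subst powr_add) (simp add: powr_half_sqrt b_def)
  finally have p: "(real K + 1) powr (3/2) = b * b * b" .
  have "1 / (b * b * b) \<le> 2 / (a * b * (a + b))"
  proof -
    have "a * b * (a + b) \<le> b * b * (b + b)" using ab by (intro mult_mono add_mono) auto
    then have "2 / (b * b * (b + b)) \<le> 2 / (a * b * (a + b))" using ab
      by (intro divide_left_mono mult_pos_pos add_pos_pos) auto
    moreover have "2 / (b * b * (b + b)) = 1 / (b * b * b)" using ab(3) by (simp add: field_simps)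
    ultimately show ?thesis by simp
  qed
  also have "2 / (a * b * (a + b)) = 2 / a - 2 / b"
  proof -
    have "(b - a) * (a + b) = 1" using ab(4) by (simp add: algebra_simps)
    then have "2 / (a * b * (a + b)) = 2 * ((b - a) * (a + b)) / (a * b * (a + b))" by simp
    also have "\<dots> = 2 * (b - a) / (a * b)" using ab by simp
    also have "\<dots> = 2 / a - 2 / b" using ab by (simp add: field_simps)
    finally show ?thesis .
  qed
  finally have "1 / (real K + 1) powr (3/2) \<le> 2 / sqrt (real K) - 2 / sqrt (real K + 1)"
    by (simp only: p a_def[symmetric] b_def[symmetric])
  then show ?case using Suc.IH by (simp add: add.commute)
qed simp

text \<open>For \<open>c\<close> up to Euler's number, ln y \<le> y / exp 1 suffices. Beyond it,
  \<open>ln\<close> lies below its tangent at t = 2 c ln (2 c), and c ln t \<le> t. The absolute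
  value is there because the hypothesis on K is a fourth power, which forgets the sign of the
  logarithm.\<close>

lemma mult_ln_le:
  fixes c y :: real
  assumes c: "c > 0" and y: "y \<ge> 1" and le: "\<bar>2 * c * ln (2 * c)\<bar> \<le> y"
  shows "c * ln y \<le> y"
proof (cases "c \<le> exp 1")
  case True
  have "ln (y / exp 1) \<le> y / exp 1 - 1" using y by (intro ln_le_minus_one) auto
  then have ly: "ln y \<le> y / exp 1" using y by (simp add: ln_div)
  have "c * ln y \<le> exp 1 * (y / exp 1)"
    using True ly y by (intro mult_mono) auto
  then show ?thesis by simp
next
  case False
  define l where "l = ln (2 * c)"
  have "ln (exp 1) \<le> ln (2 * c)" using False c by (subst ln_le_cancel_iff) auto
  then have l: "l \<ge> 1" by (simp add: l_def)
  define t where "t = 2 * c * l"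
  have t: "0 < t" "t \<le> y"
    using le c l by (auto simp: t_def l_def[symmetric] intro!: mult_pos_pos)
  have "ln (y / t) \<le> y / t - 1" using t by (intro ln_le_minus_one) auto
  then have "ln y \<le> ln t + (y - t) / t" using t by (simp add: ln_div diff_divide_distrib)
  then have "c * ln y \<le> c * (ln t + (y - t) / t)" using c by (intro mult_left_mono) auto
  also have "\<dots> = c * ln t + (y - t) * (c / t)" by (simp add: algebra_simps)
  also have "(y - t) * (c / t) \<le> (y - t) * 1"
    using t c l by (intro mult_left_mono) (auto simp: t_def)
  also have "c * ln t \<le> t"
  proof -
    have "ln t = l + ln l" using c l by (simp add: t_def l_def ln_mult)
    also have "\<dots> \<le> l + l" using ln_le_minus_one[of l] l by simp
    finally have "c * ln t \<le> c * (l + l)" using c by (intro mult_left_mono) auto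
    then show ?thesis by (simp add: t_def)
  qed
  finally show ?thesis by simp
qed

section \<open>Rates for the prescribed step sizes and momentum weights\<close>

locale stochastic_sipm_rates = stochastic_sipm \<K> \<theta> B A b f s L \<phi>low D P G \<sigma> \<xi> x0 \<eta> \<gamma> \<mu>
  for \<K> :: "(real^'n) set" and \<theta> :: real and B :: "real^'n \<Rightarrow> real"
    and A :: "real^'n^'m" and b :: "real^'m" and f :: "real^'n \<Rightarrow> real" and s L \<phi>low :: real
    and D :: "'b measure" and P :: "'w measure"
    and G :: "real^'n \<Rightarrow> 'b \<Rightarrow> real^'n" and \<sigma> :: real and \<xi> :: "nat \<Rightarrow> 'w \<Rightarrow> 'b"
    and x0 :: "real^'n" and \<eta> \<gamma> \<mu> :: "nat \<Rightarrow> real" +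
  assumes eta_eq: "\<And>k. \<eta> k = s / (real k + 1) powr (3/4)"
    and gamma_eq: "\<And>k. \<gamma> k = 1 / (real k + 1) powr (1/2)"
begin

abbreviation M where "M \<equiv> M_pm (Delta f B \<phi>low x0) \<sigma> L s"

lemma L_phi_pos: "0 < L_phi L s"
  using L_pos s by (simp add: L_phi_def add_pos_pos)

lemma M_pos: "0 < M"
proof -
  have "0 \<le> (Delta f B \<phi>low x0 + \<sigma>\<^sup>2 / L) / s" "0 \<le> 3 * s * L_phi L s / 2" "0 \<le> \<sigma>\<^sup>2 / (s * L)"
    "0 < 5 * s * L / (1 - s)"
    using Delta_nonneg[OF x0] L_pos s L_phi_pos by simp_all
  then have "0 < (Delta f B \<phi>low x0 + \<sigma>\<^sup>2 / L) / s + 3 * s * L_phi L s / 2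
      + 2 * (5 * s * L / (1 - s) + \<sigma>\<^sup>2 / (s * L))"
    by (intro add_nonneg_pos add_nonneg_nonneg mult_pos_pos[OF zero_less_numeral] add_pos_nonneg)
  then show ?thesis unfolding M_pm_def by (rule mult_pos_pos[OF zero_less_numeral])
qed

lemma eta_sq: "(\<eta> k)\<^sup>2 = s\<^sup>2 * (1 / (real k + 1) powr (3/2))"
proof -
  have "((real k + 1) powr (3/4))\<^sup>2 = (real k + 1) powr (3/4 + 3/4)"
    unfolding power2_eq_square by (rule powr_add[symmetric])
  then show ?thesis by (simp add: eta_eq power_divide)
qed

lemma gamma_sq: "(\<gamma> k)\<^sup>2 = 1 / (real k + 1)"
proof -
  have "((real k + 1) powr (1/2))\<^sup>2 = (real k + 1) powr (1/2 + 1/2)"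
    unfolding power2_eq_square by (rule powr_add[symmetric])
  then show ?thesis by (simp add: gamma_eq power_divide)
qed

text \<open>The exponents give \<eta> \<le> s \<gamma>, so \<alpha> \<ge> \<gamma> - \<eta> \<ge> (1
  - s) \<gamma>, and 3/2 - 1/2 = 1 is the power of k + 1 that remains.\<close>

lemma eta_sq_div_alpha: "(\<eta> k)\<^sup>2 / \<alpha> k \<le> s\<^sup>2 / (1 - s) * (1 / (real k + 1))"
proof -
  let ?j = "real k + 1"
  have "?j powr (1/2) \<le> ?j powr (3/4)" by (intro powr_mono) auto
  then have "\<eta> k \<le> s * \<gamma> k"
    using s by (simp add: eta_eq gamma_eq frac_le)
  then have "(1 - s) * \<gamma> k \<le> \<gamma> k - \<eta> k" by (simp add: algebra_simps)
  also have "\<dots> \<le> \<alpha> k"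
    using \<gamma>(1)[of k] \<eta>(1)[of k] eta_less_1[of k]
    by (simp add: \<alpha>_def pos_le_divide_eq mult_left_le)
  finally have "(1 - s) * \<gamma> k \<le> \<alpha> k" .
  then have "(\<eta> k)\<^sup>2 / \<alpha> k \<le> (\<eta> k)\<^sup>2 / ((1 - s) * \<gamma> k)"
  proof (intro divide_left_mono mult_pos_pos)
    show "0 < \<gamma> k" using \<gamma>(1)[of k] \<eta>(1)[of k] by linarith
  qed (use s alpha_bounds in auto)
  also have "\<dots> = s\<^sup>2 / (1 - s) * (1 / (?j powr (3/2) / ?j powr (1/2)))"
    by (simp add: eta_sq gamma_eq)
  also have "?j powr (3/2) / ?j powr (1/2) = ?j"
    by (subst powr_diff[symmetric]) simp
  finally show ?thesis .
qed

text \<open>K \<ge> 3 enters as ln K \<ge> 1: it allows 1 + ln K \<le> 2 ln K and lets the bounded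
  terms be multiplied by ln K. The factors 2 and 3/2 inside the bracket of \<open>M_pm\<close> arise
  here.\<close>

lemma expected_total_bound:
  assumes K: "K \<ge> 3"
  shows "(\<Sum>k<K. \<eta> k * (\<integral>\<omega>. res k (samples \<omega>) \<partial>P)) \<le> s * (M / 2) * ln K"
proof -
  let ?D = "Delta f B \<phi>low x0"
  have lnK: "1 \<le> ln (real K)"
  proof -
    have "exp 1 \<le> real K" using exp_le K by linarith
    then show ?thesis using K by (subst ln_ge_iff) auto
  qed
  define a where "a = 5 * L * (s\<^sup>2 / (1 - s)) + \<sigma>\<^sup>2 / L"
  define c where "c = L_phi L s / 2 * s\<^sup>2"
  have a: "0 \<le> a" and c: "0 \<le> c" using L_pos s L_phi_pos by (simp_all add: a_def c_def)
  have "(\<Sum>k<K. \<eta> k * (\<integral>\<omega>. res k (samples \<omega>) \<partial>P)) \<le> ?D + \<sigma>\<^sup>2 / L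
     + (\<Sum>k<K. 5 * L * (\<eta> k)\<^sup>2 / \<alpha> k + \<sigma>\<^sup>2 / L * (\<gamma> k)\<^sup>2 + L_phi L s / 2 * (\<eta> k)\<^sup>2)"
    by (rule expected_total_residual)
  also have "(\<Sum>k<K. 5 * L * (\<eta> k)\<^sup>2 / \<alpha> k + \<sigma>\<^sup>2 / L * (\<gamma> k)\<^sup>2 + L_phi L s / 2 * (\<eta> k)\<^sup>2)
     \<le> (\<Sum>k<K. a * (1 / (real k + 1)) + c * (1 / (real k + 1) powr (3/2)))"
  proof (rule sum_mono)
    fix k
    have "5 * L * ((\<eta> k)\<^sup>2 / \<alpha> k) \<le> 5 * L * (s\<^sup>2 / (1 - s) * (1 / (real k + 1)))"
      using L_pos by (intro mult_left_mono eta_sq_div_alpha) auto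
    then show "5 * L * (\<eta> k)\<^sup>2 / \<alpha> k + \<sigma>\<^sup>2 / L * (\<gamma> k)\<^sup>2 + L_phi L s / 2 * (\<eta> k)\<^sup>2
      \<le> a * (1 / (real k + 1)) + c * (1 / (real k + 1) powr (3/2))"
      by (simp add: a_def c_def eta_sq gamma_sq distrib_right add_divide_distrib)
  qed
  also have "\<dots> = a * (\<Sum>k<K. 1 / (real k + 1)) + c * (\<Sum>k<K. 1 / (real k + 1) powr (3/2))"
    by (simp only: sum.distrib sum_distrib_left)
  also have "\<dots> \<le> a * (2 * ln K) + c * 3"
  proof (intro add_mono mult_left_mono a c)
    show "(\<Sum>k<K. 1 / (real k + 1)) \<le> 2 * ln (real K)"
      using sum_inverse_le_ln[of K] K lnK by simp
    have "0 \<le> 2 / sqrt (real K)" by simp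
    then show "(\<Sum>k<K. 1 / (real k + 1) powr (3/2)) \<le> 3"
      using sum_powr_le[of K] K by linarith
  qed
  finally have "(\<Sum>k<K. \<eta> k * (\<integral>\<omega>. res k (samples \<omega>) \<partial>P))
      \<le> (?D + \<sigma>\<^sup>2 / L + c * 3) + a * 2 * ln K" by simp
  also have "?D + \<sigma>\<^sup>2 / L + c * 3 \<le> (?D + \<sigma>\<^sup>2 / L + c * 3) * ln K"
    using lnK Delta_nonneg[OF x0] L_pos c mult_left_mono[of 1 "ln K" "?D + \<sigma>\<^sup>2 / L + c * 3"] by simp
  also have "(?D + \<sigma>\<^sup>2 / L + c * 3) * ln K + a * 2 * ln K = s * (M / 2) * ln K"
  proof -
    have "s * (M / 2) = ?D + \<sigma>\<^sup>2 / L + c * 3 + a * 2"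
    proof -
      have "s * ((?D + \<sigma>\<^sup>2 / L) / s) = ?D + \<sigma>\<^sup>2 / L"
        "s * (5 * s * L / (1 - s)) = 5 * L * (s\<^sup>2 / (1 - s))" "s * (\<sigma>\<^sup>2 / (s * L)) = \<sigma>\<^sup>2 / L"
        using s by (simp_all add: power2_eq_square)
      moreover have "s * (M / 2) = s * ((?D + \<sigma>\<^sup>2 / L) / s) + s * (3 * s * L_phi L s / 2)
          + 2 * (s * (5 * s * L / (1 - s)) + s * (\<sigma>\<^sup>2 / (s * L)))"
        unfolding M_pm_def by (simp only: distrib_left[of s] mult.left_commute[of s] times_divide_eq_left
            nonzero_mult_div_cancel_left[OF zero_neq_numeral[symmetric]])
      ultimately show ?thesis by (simp add: a_def c_def power2_eq_square)
    qed
    then show ?thesis by (simp add: distrib_right)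
  qed
  finally show ?thesis by simp
qed

text \<open>On the upper half each weight is at least s K^(-3/4), and the lower half may be added
  back because its terms are nonnegative. The range has at least K / 2 elements, which gives the
  outer factor 2 of \<open>M_pm\<close>.\<close>

lemma average_bound:
  assumes K: "K \<ge> 3"
  shows "(\<Sum>k\<in>{K div 2..K - 1}. \<integral>\<omega>. res k (samples \<omega>) \<partial>P) / card {K div 2..K - 1}
    \<le> M * ln K / real K powr (1/4)"
proof -
  let ?I = "{K div 2..K - 1}" and ?E = "\<lambda>k. \<integral>\<omega>. res k (samples \<omega>) \<partial>P"
  have E: "0 \<le> ?E k" for k by (simp add: res_nonneg)
  have "s / real K powr (3/4) * (\<Sum>k\<in>?I. ?E k) = (\<Sum>k\<in>?I. s / real K powr (3/4) * ?E k)"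
    by (rule sum_distrib_left)
  also have "\<dots> \<le> (\<Sum>k\<in>?I. \<eta> k * ?E k)"
  proof (intro sum_mono mult_right_mono E)
    fix k assume "k \<in> ?I"
    then have "real k + 1 \<le> real K" using K by auto
    then show "s / real K powr (3/4) \<le> \<eta> k"
      unfolding eta_eq using s by (intro divide_left_mono powr_mono2 mult_pos_pos) auto
  qed
  also have "\<dots> \<le> (\<Sum>k<K. \<eta> k * ?E k)"
    using K E \<eta> by (intro sum_mono2) (auto simp: less_imp_le)
  also have "\<dots> \<le> s * (M / 2) * ln K" by (rule expected_total_bound[OF K])
  finally have "(\<Sum>k\<in>?I. ?E k) \<le> real K powr (3/4) * (M / 2 * ln K)"
    using s K by (simp add: field_simps)
  moreover have "real K / 2 \<le> real (card ?I)" by simp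
  ultimately have "(\<Sum>k\<in>?I. ?E k) / card ?I \<le> real K powr (3/4) * (M / 2 * ln K) / (real K / 2)"
    using K M_pos by (intro frac_le) auto
  also have "\<dots> = M * ln K * (real K powr (3/4) / real K powr 1)"
    using K by simp
  also have "real K powr (3/4) / real K powr 1 = 1 / real K powr (1/4)"
    using K by (subst powr_diff[symmetric]) (simp add: powr_minus_divide)
  finally show ?thesis by simp
qed

lemma average_small:
  assumes K: "K \<ge> 3" and e: "e > 0"
    and le: "(8 * M / e * ln (8 * M / e)) ^ 4 \<le> real K"
  shows "M * ln K / real K powr (1/4) \<le> e"
proof -
  define y where "y = real K powr (1/4)"
  have y4: "y ^ 4 = real K"
    using K by (simp add: y_def powr_power)
  have y: "1 \<le> y" using K by (simp add: y_def ge_one_powr_ge_zero)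
  have lnK: "ln (real K) = 4 * ln y" using K by (simp add: y_def ln_powr)
  \<comment> \<open>With y = K^(1/4) and ln K = 4 ln y the claim reads c ln y \<le> y, and 2 c = 8 M
    / e is the quantity in the hypothesis.\<close>
  define c where "c = 4 * M / e"
  have c: "c > 0" using M_pos e by (simp add: c_def)
  have "\<bar>2 * c * ln (2 * c)\<bar> ^ 4 \<le> y ^ 4"
  proof -
    have abs4: "\<bar>z\<bar> ^ 4 = z ^ 4" for z :: real by (rule power_even_abs) simp
    have "2 * c = 8 * M / e" by (simp add: c_def)
    then show ?thesis using le by (simp only: abs4 y4)
  qed
  then have "\<bar>2 * c * ln (2 * c)\<bar> \<le> y"
    using y by (subst (asm) power_mono_iff) auto
  then have "c * ln y \<le> y" using c y by (intro mult_ln_le)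
  then show ?thesis
    using e y by (simp add: y_def[symmetric] lnK c_def field_simps)
qed

end

theorem theorem4:
  fixes \<K> :: "(real^'n) set"
    and A :: "real^'n^'m"
    and b :: "real^'m"
    and f B :: "real^'n \<Rightarrow> real"
    and \<theta> s\<^sub>\<eta> \<phi>low \<sigma> \<epsilon> :: real
    and L1 :: "real \<Rightarrow> real"
    and D :: "'b measure"
    and G :: "real^'n \<Rightarrow> 'b \<Rightarrow> real^'n"
    and P :: "'w measure"
    and \<xi> :: "nat \<Rightarrow> 'w \<Rightarrow> 'b"
    and \<kappa> :: "nat \<Rightarrow> 'w \<Rightarrow> nat"
    and x0 :: "real^'n"
    and \<eta> \<gamma> \<mu> :: "nat \<Rightarrow> real"
    and x mbar m :: "nat \<Rightarrow> 'w \<Rightarrow> real^'n"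
    and lam :: "nat \<Rightarrow> 'w \<Rightarrow> real^'m"
  assumes cone: "proper_cone \<K>"
    and full_row_rank: "rank A = CARD('m)"
    and f_C1: "cont_diff_on 1 (feasible A b \<K>) f"
    and optimum: "\<exists>z\<in>feasible A b \<K>. \<forall>y\<in>feasible A b \<K>. f z \<le> f y"
    and barrier: "lhsc_barrier \<K> \<theta> B"
    and s_eta: "s\<^sub>\<eta> \<in> {0<..<1}"
    and slater: "strictly_feasible A b \<K> \<noteq> {}"
    and phi_low: "\<forall>y\<in>strictly_feasible A b \<K>. \<forall>\<nu>\<in>{0<..1}. \<phi>low \<le> f y + \<nu> * B y"
    and L1: "\<forall>s\<in>{0<..<1}. L1 s > 0 \<and>
      (\<forall>y\<in>strictly_feasible A b \<K>. \<forall>z\<in>strictly_feasible A b \<K>.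
         local_norm B y (z - y) \<le> s \<longrightarrow>
         dual_norm B y (grad f z - grad f y) \<le> L1 s * local_norm B y (z - y))"
    and prob_D: "prob_space D"
    and G_measurable: "(\<lambda>(y, z). G y z) \<in>
      restrict_space borel (strictly_feasible A b \<K>) \<Otimes>\<^sub>M D \<rightarrow>\<^sub>M borel"
    and sigma: "\<sigma> > 0"
    and G_unbiased: "\<forall>y\<in>strictly_feasible A b \<K>.
      integrable D (G y) \<and> integral\<^sup>L D (G y) = grad f y"
    and G_variance: "\<forall>y\<in>strictly_feasible A b \<K>.
      integrable D (\<lambda>z. (dual_norm B y (G y z - grad f y))\<^sup>2) \<and>
      (\<integral>z. (dual_norm B y (G y z - grad f y))\<^sup>2 \<partial>D) \<le> \<sigma>\<^sup>2"
    and prob_P: "prob_space P"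
    and xi_indep: "prob_space.indep_vars P (\<lambda>_. D) \<xi> UNIV"
    and xi_distr: "\<forall>k. distr P D (\<xi> k) = D"
    and x0: "x0 \<in> strictly_feasible A b \<K>"
    and eps: "\<epsilon> \<in> {0<..<1}"
    and eta: "\<forall>k. \<eta> k = s\<^sub>\<eta> / (real k + 1) powr (3/4)"
    and gamma: "\<forall>k. \<gamma> k = 1 / (real k + 1) powr (1/2)"
    and mu: "\<forall>k. \<mu> k = max (1 / (real k + 1) powr (1/4)) (\<epsilon> / (1 + sqrt \<theta>))"
    and run: "\<forall>\<omega>\<in>space P. sipm_pm_run A B G x0 \<eta> \<gamma> \<mu> (\<lambda>k. \<xi> k \<omega>)
      (\<lambda>k. x k \<omega>) (\<lambda>k. mbar k \<omega>) (\<lambda>k. m k \<omega>) (\<lambda>k. lam k \<omega>)"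
    and well_defined: "AE \<omega> in P. \<forall>k. m k \<omega> + transpose A *v lam k \<omega> \<noteq> 0"
    and kappa_measurable: "\<forall>K\<ge>1. \<kappa> K \<in> P \<rightarrow>\<^sub>M count_space {K div 2..K - 1}"
    and kappa_uniform: "\<forall>K\<ge>1. distr P (count_space {K div 2..K - 1}) (\<kappa> K) =
      uniform_count_measure {K div 2..K - 1}"
    and kappa_indep: "\<forall>K\<ge>1. prob_space.indep_set P
      {\<kappa> K -` S \<inter> space P | S. S \<subseteq> {K div 2..K - 1}}
      {(\<lambda>\<omega> k. \<xi> k \<omega>) -` T \<inter> space P | T. T \<in> sets (\<Pi>\<^sub>M k\<in>UNIV. D)}"
  defines "M \<equiv> M_pm (Delta f B \<phi>low x0) \<sigma> (L1 s\<^sub>\<eta>) s\<^sub>\<eta>"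
  shows "\<forall>K::nat.
    real K \<ge> Max {2 * ((1 + sqrt \<theta>) / \<epsilon>) ^ 4,
                  (8 * M * (1 + sqrt \<theta>) / \<epsilon> * ln (8 * M * (1 + sqrt \<theta>) / \<epsilon>)) ^ 4,
                  3} \<longrightarrow>
    (let R = (\<lambda>\<omega>. dual_norm B (x (\<kappa> K \<omega>) \<omega>)
                   (grad (phi f B (\<mu> (\<kappa> K \<omega>))) (x (\<kappa> K \<omega>) \<omega>)
                    + transpose A *v lam (\<kappa> K \<omega>) \<omega>))
     in integrable P R \<and>
        (\<forall>\<omega>\<in>space P. integral\<^sup>L P R \<le> \<mu> (\<kappa> K \<omega>) \<and> \<mu> (\<kappa> K \<omega>) \<le> \<epsilon> / (1 + sqrt \<theta>)))"
proof (intro allI impI)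
  fix K :: nat
  define e where "e = \<epsilon> / (1 + sqrt \<theta>)"
  assume "real K \<ge> Max {2 * ((1 + sqrt \<theta>) / \<epsilon>) ^ 4,
    (8 * M * (1 + sqrt \<theta>) / \<epsilon> * ln (8 * M * (1 + sqrt \<theta>) / \<epsilon>)) ^ 4, 3}"
  then have K: "2 * (1 / e) ^ 4 \<le> real K" "(8 * M / e * ln (8 * M / e)) ^ 4 \<le> real K" "3 \<le> K"
    by (simp_all add: e_def)
  have theta: "1 \<le> \<theta>" using barrier by (simp add: lhsc_barrier_def)
  have e: "0 < e" "e \<le> 1"
  proof -
    show "0 < e" using eps theta by (simp add: e_def add_pos_nonneg)
    have "0 \<le> sqrt \<theta>" using theta by simp
    moreover have "\<epsilon> < 1" using eps by simp
    ultimately have "\<epsilon> \<le> 1 + sqrt \<theta>" "0 < 1 + sqrt \<theta>" by linarith+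
    then show "e \<le> 1" by (simp add: e_def pos_divide_le_eq)
  qed
  have mu': "\<mu> k = max (1 / (real k + 1) powr (1/4)) e" for k
    using mu by (simp add: e_def)
  interpret stochastic_sipm_rates \<K> \<theta> B A b f s\<^sub>\<eta> "L1 s\<^sub>\<eta>" \<phi>low D P G \<sigma> \<xi> x0 \<eta> \<gamma> \<mu>
  proof -
    interpret D: prob_space D by (rule prob_D)
    interpret P: prob_space P by (rule prob_P)
    show "stochastic_sipm_rates \<K> \<theta> B A b f s\<^sub>\<eta> (L1 s\<^sub>\<eta>) \<phi>low D P G \<sigma> \<xi> x0 \<eta> \<gamma> \<mu>"
    proof unfold_locales
      fix k
      have powr1: "(real k + 1) powr (1/2) \<le> (real k + 1) powr (3/4)" "1 \<le> (real k + 1) powr p" if "0 \<le> p" for p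
        using that by (auto intro: powr_mono ge_one_powr_ge_zero)
      show "0 < \<eta> k" "\<eta> k \<le> s\<^sub>\<eta>"
        using s_eta eta powr1(2)[of "3/4"] by (auto simp: divide_le_eq mult_left_le)
      show "\<gamma> k \<le> 1" using gamma powr1(2)[of "1/2"] by (simp add: divide_le_eq)
      have "\<eta> k < 1 / (real k + 1) powr (3/4)"
        using s_eta eta by (simp add: divide_strict_right_mono)
      also have "\<dots> \<le> \<gamma> k" using gamma powr1(1)[of 0] by (simp add: frac_le)
      finally show "\<eta> k < \<gamma> k" .
      show "0 < \<mu> k" using e by (simp add: mu')
      show "\<mu> k \<le> 1" using e powr1(2)[of "1/4"] by (simp add: mu' divide_le_eq)
      have "1 / (real (Suc k) + 1) powr (1/4) \<le> 1 / (real k + 1) powr (1/4)"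
        by (intro divide_left_mono powr_mono2 mult_pos_pos) auto
      then show "\<mu> (Suc k) \<le> \<mu> k" unfolding mu' by (rule max.mono) simp
    qed (use cone full_row_rank f_C1 barrier s_eta phi_low L1 G_measurable G_unbiased G_variance
        xi_indep xi_distr x0 eta gamma in auto)
  qed
  \<comment> \<open>For each outcome the run is the deterministic recursion applied to its samples;
    this carries the measurability and the bounds obtained there over to \<open>x\<close> and
    \<open>lam\<close>.\<close>
  have run_state: "x k \<omega> = X k (samples \<omega>)" "mbar k \<omega> = V k (samples \<omega>)"
      "lam k \<omega> = multiplier (\<mu> k) (X k (samples \<omega>)) (V k (samples \<omega>))" if "\<omega> \<in> space P" for k \<omega>
  proof -
    note run' = bspec[OF run that, unfolded sipm_pm_run_def Let_def]
    have reg: "m k \<omega> = regularized (\<mu> k) (x k \<omega>) (mbar k \<omega>)" for k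
      using run' by (simp add: regularized_def)
    have lam: "lam k \<omega> = multiplier (\<mu> k) (x k \<omega>) (mbar k \<omega>)" for k
      unfolding multiplier_def reg[symmetric] using run' by blast
    have dir: "m k \<omega> + transpose A *v lam k \<omega> = direction (\<mu> k) (x k \<omega>) (mbar k \<omega>)" for k
      by (simp only: direction_def reg lam)
    note init = run'[THEN conjunct1] run'[THEN conjunct2, THEN conjunct1]
      and mbar = run'[THEN conjunct2, THEN conjunct2, THEN conjunct1, rule_format]
    have next_x: "x (Suc k) \<omega> = step (\<eta> k) (\<mu> k) (x k \<omega>) (mbar k \<omega>)" for k
      unfolding step_def dir[symmetric] using run' by blast
    have "x k \<omega> = X k (samples \<omega>) \<and> mbar k \<omega> = V k (samples \<omega>)" for k
    proof (induction k)
      case 0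
      show ?case unfolding init state_simps by (simp add: samples_def)
    next
      case (Suc k)
      then have "x (Suc k) \<omega> = X (Suc k) (samples \<omega>)"
        by (simp only: next_x state_simps)
      with Suc show ?case
        by (simp only: mbar state_simps(4) samples_def[of \<omega> "Suc k"])
    qed
    then show "x k \<omega> = X k (samples \<omega>)" "mbar k \<omega> = V k (samples \<omega>)"
      "lam k \<omega> = multiplier (\<mu> k) (X k (samples \<omega>)) (V k (samples \<omega>))"
      using lam by auto
  qed
  let ?I = "{K div 2..K - 1}"
  define R where "R \<omega> = dual_norm B (x (\<kappa> K \<omega>) \<omega>) (grad (phi f B (\<mu> (\<kappa> K \<omega>))) (x (\<kappa> K \<omega>) \<omega>)
      + transpose A *v lam (\<kappa> K \<omega>) \<omega>)" for \<omega>
  have R: "R \<omega> = res (\<kappa> K \<omega>) (samples \<omega>)" if "\<omega> \<in> space P" for \<omega>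
    by (simp only: R_def res_def run_state[OF that])
  have K1: "K \<ge> 1" using K(3) by simp
  have samples_eq: "(\<lambda>\<omega> k. \<xi> k \<omega>) = samples" by (simp add: samples_def fun_eq_iff)
  note index = random_index[OF finite_atLeastAtMost kappa_measurable[rule_format, OF K1]
      kappa_uniform[rule_format, OF K1] kappa_indep[rule_format, OF K1, unfolded samples_eq]]
  have R_int: "integrable P R"
    using index(1) by (subst Bochner_Integration.integrable_cong[OF refl R]) auto
  have "integral\<^sup>L P R = (\<integral>\<omega>. res (\<kappa> K \<omega>) (samples \<omega>) \<partial>P)"
    by (rule Bochner_Integration.integral_cong[OF refl R])
  also have "\<dots> \<le> M_pm (Delta f B \<phi>low x0) \<sigma> (L1 s\<^sub>\<eta>) s\<^sub>\<eta> * ln K / real K powr (1/4)"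
    unfolding index(2) by (rule average_bound[OF K(3)])
  also have "\<dots> \<le> e"
    using average_small[OF K(3) e(1)] K(2) unfolding M_def by blast
  finally have mean: "integral\<^sup>L P R \<le> e" .
  \<comment> \<open>Although \<open>K div 2\<close> rounds down, every drawn index satisfies
    \<kappa> + 1 \<ge> K / 2 \<ge> (1 / e)^4, so the maximum defining \<mu> equals \<open>e\<close>.
    The random right-hand side of the claim is thus a constant.\<close>
  have mu_e: "\<mu> (\<kappa> K \<omega>) = e" if "\<omega> \<in> space P" for \<omega>
  proof -
    let ?k = "\<kappa> K \<omega>"
    have "?k \<in> ?I" using measurable_space[OF kappa_measurable[rule_format, OF K1] that] by simp
    then have "real K / 2 \<le> real ?k + 1" by auto
    with K(1) have le: "(1 / e) ^ 4 \<le> real ?k + 1" by simp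
    have "1 / e = ((1 / e) ^ 4) powr (1/4)"
    proof -
      have "(1 / e) ^ 4 = (1 / e) powr real 4" using e by (intro powr_realpow[symmetric]) simp
      then have "((1 / e) ^ 4) powr (1/4) = (1 / e) powr (real 4 * (1/4))" by (simp only: powr_powr)
      then show ?thesis using e by simp
    qed
    also have "\<dots> \<le> (real ?k + 1) powr (1/4)" using le e by (intro powr_mono2) auto
    finally have "1 / (real ?k + 1) powr (1/4) \<le> e" using e by (simp add: field_simps)
    then show ?thesis by (simp add: mu')
  qed
  have "integrable P R \<and> (\<forall>\<omega>\<in>space P. integral\<^sup>L P R \<le> \<mu> (\<kappa> K \<omega>) \<and> \<mu> (\<kappa> K \<omega>) \<le> \<epsilon> / (1 + sqrt \<theta>))"
    using R_int mean mu_e by (simp add: e_def)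
  then show "let R = (\<lambda>\<omega>. dual_norm B (x (\<kappa> K \<omega>) \<omega>)
                   (grad (phi f B (\<mu> (\<kappa> K \<omega>))) (x (\<kappa> K \<omega>) \<omega>)
                    + transpose A *v lam (\<kappa> K \<omega>) \<omega>))
     in integrable P R \<and>
        (\<forall>\<omega>\<in>space P. integral\<^sup>L P R \<le> \<mu> (\<kappa> K \<omega>) \<and> \<mu> (\<kappa> K \<omega>) \<le> \<epsilon> / (1 + sqrt \<theta>))"
    unfolding Let_def R_def[abs_def] .
qed

end
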